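(* Let $D$ be a transient connected Riemannian manifold, $\Gamma$ a countable group of isometries of $D$ such that $D/\Gamma$ is a compact manifold, and $\mu$ a discretization probability measure on $\Gamma$ associated to the base point $p_0\in D$. Let $X$ be a compact topological space on which $\Gamma$ acts by homeomorphisms, and let $(M,\mathcal{F})$ be the associated foliated bundle with fiber $X$ and base space $D/\Gamma$, $M=(D\times X)/\Gamma$. Then the restriction map $R:H(M,\mathcal{F})\to H(X,\Gamma,\mu)$ (defined using the same base point $p_0$) is a bijection. Furthermore, continuous leafwise constant functions on $M$ correspond bijectively under $R$ to $\Gamma$-invariant continuous functions on $X$. In particular, $(M,\mathcal{F})$ has the Liouville property if and only if all continuous $\mu$-harmonic functions on $X$ are $\Gamma$-invariant.
   Context: $D$ is transient if for every $p\in D$ Brownian motion starting at $p$ almost surely eventually escapes any compact set. $\Gamma$ acts freely and properly discontinuously on $D$. $M=(D\times X)/\Gamma$ is the orbit space of the action $\gamma(p,x)=(\gamma p,\gamma x)$, with projection $\pi:D\times X\to M$; the leaves of $\mathcal{F}$ are the images $\pi(D\times\{x\})$, with the Riemannian metric induced from $D$. $H(M,\mathcal{F})$ is the space of leafwise harmonic functions: continuous $f:M\to\mathbb{R}$ that are $C^2$ and harmonic (for the Laplace-Beltrami operator) on each leaf. Leafwise constant means constant on each leaf. $(M,\mathcal{F})$ has the Liouville property if every element of $H(M,\mathcal{F})$ is leafwise constant. For a probability measure $\mu$ on $\Gamma$, $H(X,\Gamma,\mu)$ is the space of continuous $\mu$-harmonic functions on $X$, i.e. continuous $\varphi:X\to\mathbb{R}$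 with $\varphi(x)=\sum_{\gamma\in\Gamma}\mu(\gamma)\varphi(\gamma x)$ for all $x\in X$. Restriction map: for $f:M\to\mathbb{R}$ continuous put $\tilde f:=f\circ\pi$, and define $Rf(x):=\tilde f(p_0,x)$ for $x\in X$, where $p_0\in D$ is a fixed point. Discretization measure: with $p_0\in D$ fixed, let $V=\Gamma\cdot p_0$. Let $P:D\times V\to(0,1)$ be a Markov kernel, i.e. $\sum_{v\in V}P(p,v)=1$ for all $p\in D$, compatible with $\Gamma$, i.e. $P(\gamma p,\gamma v)=P(p,v)$ for all $\gamma\in\Gamma$, $p\in D$, $v\in V$, and such that the following holds. Let $H_b(V,P)$ be the space of bounded $\varphi:V\to\mathbb{R}$ with $\varphi(u)=\sum_{v\in V}P(u,v)\varphi(v)$ for all $u\in V$, and $H_b(D,\Delta)$ the space of bounded harmonic functions on $D$. Then $\mathcal{P}\varphi(p):=\sum_{v\in V}P(p,v)\varphi(v)$ defines a bijection $\mathcal{P}:H_b(V,P)\to H_b(D,\Delta)$ with inverse the restriction $h\mapsto h|_V$. (Such $P$ exists by a theorem of Furstenberg and Lyons-Sullivan.) The probability measure $\mu(\gamma):=P(\gamma p_0,p_0)$ on $\Gamma$ is called a discretization measure; it does not depend on $X$. *)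

theory Defs
  imports "HOL-Probability.Probability" "HOL-Algebra.Group_Action"
begin

section \<open>Smooth maps between coordinate spaces\<close>

definition partial_deriv :: "'n::finite \<Rightarrow> (real^'n \<Rightarrow> 'b::real_normed_vector) \<Rightarrow> real^'n \<Rightarrow> 'b" where
  "partial_deriv i f y = frechet_derivative f (at y) (axis i 1)"

text \<open>\<open>Ck_on k f S\<close> is only used for open \<open>S\<close>.\<close>

primrec Ck_on :: "nat \<Rightarrow> (real^'n::finite \<Rightarrow> 'b::real_normed_vector) \<Rightarrow> (real^'n) set \<Rightarrow> bool" where
  "Ck_on 0 f S \<longleftrightarrow> continuous_on S f"
| "Ck_on (Suc k) f S \<longleftrightarrow> (\<forall>y\<in>S. f differentiable (at y)) \<and> (\<forall>i. Ck_on k (partial_deriv i f) S)"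

definition smooth_on :: "(real^'n::finite \<Rightarrow> 'b::real_normed_vector) \<Rightarrow> (real^'n) set \<Rightarrow> bool" where
  "smooth_on f S \<longleftrightarrow> (\<forall>k. Ck_on k f S)"


section \<open>Riemannian manifolds\<close>

text \<open>
  A Riemannian chart consists of a domain, a coordinate map on it, and the Gram matrix
  \<open>(g\<^sub>i\<^sub>j)\<close> of the metric as a function of the coordinates.  The values of the coordinate map
  outside the domain and of the Gram matrix outside the image of the chart are irrelevant.
  A Riemannian structure is given by an atlas of such charts.
\<close>

datatype ('a, 'n::finite) rchart =
  RChart (rc_dom: "'a set") (rc_map: "'a \<Rightarrow> real^'n") (rc_metric: "real^'n \<Rightarrow> real^'n^'n")

definition rc_img :: "('a, 'n::finite) rchart \<Rightarrow> (real^'n) set" where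
  "rc_img c = rc_map c ` rc_dom c"

definition rc_param :: "('a, 'n::finite) rchart \<Rightarrow> real^'n \<Rightarrow> 'a" where
  "rc_param c = inv_into (rc_dom c) (rc_map c)"

definition preserves_metric ::
    "('a::topological_space, 'n::finite) rchart set \<Rightarrow> ('a \<Rightarrow> 'a) \<Rightarrow> bool" where
  "preserves_metric A F \<longleftrightarrow>
     continuous_on UNIV F \<and>
     (\<forall>c\<in>A. \<forall>c'\<in>A.
        let \<tau> = rc_map c' \<circ> F \<circ> rc_param c;
            W = rc_map c ` {p \<in> rc_dom c. F p \<in> rc_dom c'}
        in smooth_on \<tau> W \<and>
           (\<forall>y\<in>W. \<forall>v w.
              v \<bullet> (rc_metric c y *v w) =
              frechet_derivative \<tau> (at y) v \<bullet>
                (rc_metric c' (\<tau> y) *v frechet_derivative \<tau> (at y) w)))"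

text \<open>
  The last conjunct says that coordinate changes are smooth and transform the Gram matrices as
  the components of a covariant 2-tensor.
\<close>

definition riemannian_manifold ::
    "('a::{t2_space, second_countable_topology}, 'n::finite) rchart set \<Rightarrow> bool" where
  "riemannian_manifold A \<longleftrightarrow>
     (\<Union>c\<in>A. rc_dom c) = UNIV \<and>
     (\<forall>c\<in>A. open (rc_dom c) \<and> open (rc_img c) \<and>
        homeomorphism (rc_dom c) (rc_img c) (rc_map c) (rc_param c) \<and>
        smooth_on (rc_metric c) (rc_img c) \<and>
        (\<forall>y\<in>rc_img c. transpose (rc_metric c y) = rc_metric c y \<and>
           (\<forall>v. v \<noteq> 0 \<longrightarrow> v \<bullet> (rc_metric c y *v v) > 0))) \<and>
     preserves_metric A (\<lambda>p. p)"

definition riemannian_isometry ::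
    "('a::topological_space, 'n::finite) rchart set \<Rightarrow> ('a \<Rightarrow> 'a) \<Rightarrow> bool" where
  "riemannian_isometry A F \<longleftrightarrow>
     bij F \<and> preserves_metric A F \<and> preserves_metric A (inv_into UNIV F)"

text \<open>
  The Laplace-Beltrami operator in coordinates,
  \<open>\<Delta>u = (det g)\<^bsup>-1/2\<^esup> \<Sum>\<^sub>i \<partial>\<^sub>i ((det g)\<^bsup>1/2\<^esup> \<Sum>\<^sub>j g\<^bsup>ij\<^esup> \<partial>\<^sub>j u)\<close>.
\<close>

definition coord_laplacian ::
    "(real^'n::finite \<Rightarrow> real^'n^'n) \<Rightarrow> (real^'n \<Rightarrow> real) \<Rightarrow> real^'n \<Rightarrow> real" where
  "coord_laplacian g u y =
     (\<Sum>i\<in>UNIV. partial_deriv i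
        (\<lambda>z. sqrt (det (g z)) * (\<Sum>j\<in>UNIV. matrix_inv (g z) $ i $ j * partial_deriv j u z)) y)
     / sqrt (det (g y))"

definition chart_laplacian :: "('a, 'n::finite) rchart \<Rightarrow> ('a \<Rightarrow> real) \<Rightarrow> 'a \<Rightarrow> real" where
  "chart_laplacian c f p = coord_laplacian (rc_metric c) (f \<circ> rc_param c) (rc_map c p)"

text \<open>For a \<open>C\<^sup>2\<close> function on a Riemannian manifold the value does not depend on the chart.\<close>

definition laplace_beltrami :: "('a, 'n::finite) rchart set \<Rightarrow> ('a \<Rightarrow> real) \<Rightarrow> 'a \<Rightarrow> real" where
  "laplace_beltrami A f p = chart_laplacian (SOME c. c \<in> A \<and> p \<in> rc_dom c) f p"

definition harmonic :: "('a, 'n::finite) rchart set \<Rightarrow> ('a \<Rightarrow> real) \<Rightarrow> bool" where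
  "harmonic A f \<longleftrightarrow>
     (\<forall>c\<in>A. Ck_on 2 (f \<circ> rc_param c) (rc_img c) \<and> (\<forall>p\<in>rc_dom c. chart_laplacian c f p = 0))"

definition test_function ::
    "('a::topological_space, 'n::finite) rchart set \<Rightarrow> ('a \<Rightarrow> real) \<Rightarrow> bool" where
  "test_function A f \<longleftrightarrow>
     (\<forall>c\<in>A. smooth_on (f \<circ> rc_param c) (rc_img c)) \<and> compact (closure {p. f p \<noteq> 0})"


section \<open>Brownian motion and transience\<close>

text \<open>
  Brownian motion is the diffusion generated by \<open>\<Delta>/2\<close>, characterized by its martingale problem.
  It may explode in finite time, so paths live in the one-point compactification: they are
  continuous there and stay at the added point \<open>None\<close> once they have reached it.
  Functions on the manifold are extended by 0 to the added point.
\<close>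

definition ext0 :: "('a \<Rightarrow> real) \<Rightarrow> 'a option \<Rightarrow> real" where
  "ext0 f z = (case z of None \<Rightarrow> 0 | Some p \<Rightarrow> f p)"

definition state_algebra :: "'a::topological_space option measure" where
  "state_algebra = sigma UNIV {U. openin (Alexandroff_compactification euclidean) U}"

definition past ::
    "'w measure \<Rightarrow> (real \<Rightarrow> 'w \<Rightarrow> 'a::topological_space option) \<Rightarrow> real \<Rightarrow> 'w measure" where
  "past \<Omega> B s = sigma (space \<Omega>)
     {B u -` S \<inter> space \<Omega> | u S. 0 \<le> u \<and> u \<le> s \<and> S \<in> sets state_algebra}"

definition dynkin_process ::
    "('a::topological_space, 'n::finite) rchart set \<Rightarrow> (real \<Rightarrow> 'w \<Rightarrow> 'a option) \<Rightarrow>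
     ('a \<Rightarrow> real) \<Rightarrow> real \<Rightarrow> 'w \<Rightarrow> real" where
  "dynkin_process A B f t \<omega> =
     ext0 f (B t \<omega>) - ext0 f (B 0 \<omega>)
     - integral {0..t} (\<lambda>r. ext0 (\<lambda>p. laplace_beltrami A f p / 2) (B r \<omega>))"

definition brownian_motion ::
    "('a::topological_space, 'n::finite) rchart set \<Rightarrow> 'a \<Rightarrow>
     'w measure \<Rightarrow> (real \<Rightarrow> 'w \<Rightarrow> 'a option) \<Rightarrow> bool" where
  "brownian_motion A p \<Omega> B \<longleftrightarrow>
     prob_space \<Omega> \<and>
     (\<forall>t\<ge>0. B t \<in> measurable \<Omega> state_algebra) \<and>
     (\<forall>\<omega>\<in>space \<Omega>.
        B 0 \<omega> = Some p \<and>
        continuous_map (top_of_set {0..}) (Alexandroff_compactification euclidean) (\<lambda>t. B t \<omega>) \<and>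
        (\<forall>s t. 0 \<le> s \<and> s \<le> t \<and> B s \<omega> = None \<longrightarrow> B t \<omega> = None)) \<and>
     (\<forall>f. test_function A f \<longrightarrow>
        (\<forall>t\<ge>0. integrable \<Omega> (dynkin_process A B f t)) \<and>
        (\<forall>s t. 0 \<le> s \<and> s \<le> t \<longrightarrow>
           (AE \<omega> in \<Omega>. real_cond_exp \<Omega> (past \<Omega> B s) (dynkin_process A B f t) \<omega>
                        = dynkin_process A B f s \<omega>)))"

text \<open>
  The sample space is taken to be the type of paths, on which the law of every Brownian
  motion can be realized by the coordinate process.
\<close>

definition transient :: "('a::topological_space, 'n::finite) rchart set \<Rightarrow> bool" where
  "transient A \<longleftrightarrow>
     (\<forall>p (\<Omega> :: (real \<Rightarrow> 'a option) measure) B. brownian_motion A p \<Omega> B \<longrightarrow>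
        (AE \<omega> in \<Omega>. \<forall>K. compact K \<longrightarrow> (\<forall>\<^sub>F t in at_top. B t \<omega> \<notin> Some ` K)))"


section \<open>Group actions and orbit spaces\<close>

definition transformation_group :: "('a \<Rightarrow> 'a) set \<Rightarrow> ('a \<Rightarrow> 'a) monoid" where
  "transformation_group \<Gamma> = (BijGroup UNIV)\<lparr>carrier := \<Gamma>\<rparr>"

definition isometry_group ::
    "('a::topological_space, 'n::finite) rchart set \<Rightarrow> ('a \<Rightarrow> 'a) set \<Rightarrow> bool" where
  "isometry_group A \<Gamma> \<longleftrightarrow>
     subgroup \<Gamma> (BijGroup UNIV) \<and> (\<forall>\<gamma>\<in>\<Gamma>. riemannian_isometry A \<gamma>)"

definition acts_freely :: "('a \<Rightarrow> 'a) set \<Rightarrow> bool" where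
  "acts_freely \<Gamma> \<longleftrightarrow> (\<forall>\<gamma>\<in>\<Gamma>. \<forall>p. \<gamma> p = p \<longrightarrow> \<gamma> = id)"

definition acts_properly_discontinuously :: "('a::topological_space \<Rightarrow> 'a) set \<Rightarrow> bool" where
  "acts_properly_discontinuously \<Gamma> \<longleftrightarrow>
     (\<forall>K. compact K \<longrightarrow> finite {\<gamma>\<in>\<Gamma>. \<gamma> ` K \<inter> K \<noteq> {}})"

definition acts_by_homeomorphisms ::
    "('a \<Rightarrow> 'a) set \<Rightarrow> (('a \<Rightarrow> 'a) \<Rightarrow> 'x::topological_space \<Rightarrow> 'x) \<Rightarrow> bool" where
  "acts_by_homeomorphisms \<Gamma> \<alpha> \<longleftrightarrow>
     group_action (transformation_group \<Gamma>) UNIV \<alpha> \<and>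
     (\<forall>\<gamma>\<in>\<Gamma>. homeomorphic_map euclidean euclidean (\<alpha> \<gamma>))"

definition quotient_topology :: "('a::topological_space \<Rightarrow> 'b) \<Rightarrow> 'b topology" where
  "quotient_topology q = topology (\<lambda>U. U \<subseteq> range q \<and> open (q -` U))"

lemma openin_quotient_topology:
  "openin (quotient_topology q) U \<longleftrightarrow> U \<subseteq> range q \<and> open (q -` U)"
proof -
  have "istopology (\<lambda>U. U \<subseteq> range q \<and> open (q -` U))"
    unfolding istopology_def vimage_Int vimage_Union by (blast intro: open_Int open_UN)
  then show ?thesis
    by (simp add: quotient_topology_def topology_inverse')
qed

lemma topspace_quotient_topology [simp]: "topspace (quotient_topology q) = range q"
proof -
  have "openin (quotient_topology q) (range q)"
    by (simp add: openin_quotient_topology vimage_def)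
  then show ?thesis
    unfolding topspace_def openin_quotient_topology by blast
qed

definition base_proj :: "('a \<Rightarrow> 'a) set \<Rightarrow> 'a \<Rightarrow> 'a set" where
  "base_proj \<Gamma> p = orbit (transformation_group \<Gamma>) (\<lambda>\<gamma>. \<gamma>) p"

definition base_space :: "('a::topological_space \<Rightarrow> 'a) set \<Rightarrow> 'a set topology" where
  "base_space \<Gamma> = quotient_topology (base_proj \<Gamma>)"


section \<open>The foliated bundle\<close>

definition bundle_proj ::
    "('a \<Rightarrow> 'a) set \<Rightarrow> (('a \<Rightarrow> 'a) \<Rightarrow> 'x \<Rightarrow> 'x) \<Rightarrow> 'a \<times> 'x \<Rightarrow> ('a \<times> 'x) set" where
  "bundle_proj \<Gamma> \<alpha> z = orbit (transformation_group \<Gamma>) (\<lambda>\<gamma> (p, x). (\<gamma> p, \<alpha> \<gamma> x)) z"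

definition foliated_bundle ::
    "('a::topological_space \<Rightarrow> 'a) set \<Rightarrow> (('a \<Rightarrow> 'a) \<Rightarrow> 'x::topological_space \<Rightarrow> 'x) \<Rightarrow>
     ('a \<times> 'x) set topology" where
  "foliated_bundle \<Gamma> \<alpha> = quotient_topology (bundle_proj \<Gamma> \<alpha>)"

definition leaf ::
    "('a \<Rightarrow> 'a) set \<Rightarrow> (('a \<Rightarrow> 'a) \<Rightarrow> 'x \<Rightarrow> 'x) \<Rightarrow> 'x \<Rightarrow> ('a \<times> 'x) set set" where
  "leaf \<Gamma> \<alpha> x = bundle_proj \<Gamma> \<alpha> ` (UNIV \<times> {x})"

text \<open>
  The Riemannian structure which the leaf through \<open>x\<close> inherits from the covering
  \<open>q = \<pi>(-, x)\<close>: every chart is restricted to the open sets \<open>W\<close> on which \<open>q\<close> is injective,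
  and transported to \<open>q ` W\<close>; the Gram matrix in coordinates is unchanged.
\<close>

definition leaf_atlas ::
    "('a::topological_space, 'n::finite) rchart set \<Rightarrow> ('a \<Rightarrow> 'a) set \<Rightarrow>
     (('a \<Rightarrow> 'a) \<Rightarrow> 'x \<Rightarrow> 'x) \<Rightarrow> 'x \<Rightarrow> (('a \<times> 'x) set, 'n) rchart set" where
  "leaf_atlas A \<Gamma> \<alpha> x =
     (let q = (\<lambda>p. bundle_proj \<Gamma> \<alpha> (p, x))
      in {RChart (q ` W) (rc_map c \<circ> inv_into W q) (rc_metric c) | c W.
            c \<in> A \<and> open W \<and> W \<subseteq> rc_dom c \<and> inj_on q W})"

text \<open>
  Functions on the orbit space are represented by their extensional versions, so that
  bijectivity on function spaces is meaningful.
\<close>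

definition bundle_continuous ::
    "('a::topological_space \<Rightarrow> 'a) set \<Rightarrow> (('a \<Rightarrow> 'a) \<Rightarrow> 'x::topological_space \<Rightarrow> 'x) \<Rightarrow>
     (('a \<times> 'x) set \<Rightarrow> real) set" where
  "bundle_continuous \<Gamma> \<alpha> =
     {f \<in> extensional (topspace (foliated_bundle \<Gamma> \<alpha>)).
        continuous_map (foliated_bundle \<Gamma> \<alpha>) euclideanreal f}"

definition leafwise_harmonic ::
    "('a::topological_space, 'n::finite) rchart set \<Rightarrow> ('a \<Rightarrow> 'a) set \<Rightarrow>
     (('a \<Rightarrow> 'a) \<Rightarrow> 'x::topological_space \<Rightarrow> 'x) \<Rightarrow> (('a \<times> 'x) set \<Rightarrow> real) set" where
  "leafwise_harmonic A \<Gamma> \<alpha> =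
     {f \<in> bundle_continuous \<Gamma> \<alpha>. \<forall>x. harmonic (leaf_atlas A \<Gamma> \<alpha> x) f}"

definition leafwise_constant ::
    "('a \<Rightarrow> 'a) set \<Rightarrow> (('a \<Rightarrow> 'a) \<Rightarrow> 'x \<Rightarrow> 'x) \<Rightarrow> (('a \<times> 'x) set \<Rightarrow> real) \<Rightarrow> bool" where
  "leafwise_constant \<Gamma> \<alpha> f \<longleftrightarrow> (\<forall>x. f constant_on leaf \<Gamma> \<alpha> x)"

definition liouville_property ::
    "('a::topological_space, 'n::finite) rchart set \<Rightarrow> ('a \<Rightarrow> 'a) set \<Rightarrow>
     (('a \<Rightarrow> 'a) \<Rightarrow> 'x::topological_space \<Rightarrow> 'x) \<Rightarrow> bool" where
  "liouville_property A \<Gamma> \<alpha> \<longleftrightarrow> (\<forall>f\<in>leafwise_harmonic A \<Gamma> \<alpha>. leafwise_constant \<Gamma> \<alpha> f)"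

definition restriction_map ::
    "('a \<Rightarrow> 'a) set \<Rightarrow> (('a \<Rightarrow> 'a) \<Rightarrow> 'x \<Rightarrow> 'x) \<Rightarrow> 'a \<Rightarrow> (('a \<times> 'x) set \<Rightarrow> real) \<Rightarrow> 'x \<Rightarrow> real" where
  "restriction_map \<Gamma> \<alpha> p\<^sub>0 f x = (f \<circ> bundle_proj \<Gamma> \<alpha>) (p\<^sub>0, x)"


section \<open>Discretization measures and harmonic functions on the fiber\<close>

definition bounded_P_harmonic :: "'a set \<Rightarrow> ('a \<Rightarrow> 'a \<Rightarrow> real) \<Rightarrow> ('a \<Rightarrow> real) set" where
  "bounded_P_harmonic V P =
     {\<phi> \<in> extensional V. bounded (\<phi> ` V) \<and> (\<forall>u\<in>V. \<phi> u = (\<Sum>\<^sub>\<infinity>v\<in>V. P u v * \<phi> v))}"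

definition bounded_harmonic :: "('a, 'n::finite) rchart set \<Rightarrow> ('a \<Rightarrow> real) set" where
  "bounded_harmonic A = {h. bounded (range h) \<and> harmonic A h}"

definition discretization_kernel ::
    "('a, 'n::finite) rchart set \<Rightarrow> ('a \<Rightarrow> 'a) set \<Rightarrow> 'a \<Rightarrow> ('a \<Rightarrow> 'a \<Rightarrow> real) \<Rightarrow> bool" where
  "discretization_kernel A \<Gamma> p\<^sub>0 P \<longleftrightarrow>
     (let V = base_proj \<Gamma> p\<^sub>0;
          \<P> = (\<lambda>\<phi> p. \<Sum>\<^sub>\<infinity>v\<in>V. P p v * \<phi> v)
      in (\<forall>p. \<forall>v\<in>V. 0 < P p v \<and> P p v < 1) \<and>
         (\<forall>p. (P p has_sum 1) V) \<and>
         (\<forall>\<gamma>\<in>\<Gamma>. \<forall>p. \<forall>v\<in>V. P (\<gamma> p) (\<gamma> v) = P p v) \<and>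
         bij_betw \<P> (bounded_P_harmonic V P) (bounded_harmonic A) \<and>
         (\<forall>h\<in>bounded_harmonic A. inv_into (bounded_P_harmonic V P) \<P> h = restrict h V))"

definition discretization_measure ::
    "('a, 'n::finite) rchart set \<Rightarrow> ('a \<Rightarrow> 'a) set \<Rightarrow> 'a \<Rightarrow> ('a \<Rightarrow> 'a) pmf \<Rightarrow> bool" where
  "discretization_measure A \<Gamma> p\<^sub>0 \<mu> \<longleftrightarrow>
     set_pmf \<mu> \<subseteq> \<Gamma> \<and>
     (\<exists>P. discretization_kernel A \<Gamma> p\<^sub>0 P \<and> (\<forall>\<gamma>\<in>\<Gamma>. pmf \<mu> \<gamma> = P (\<gamma> p\<^sub>0) p\<^sub>0))"

definition fiber_harmonic ::
    "('a \<Rightarrow> 'a) set \<Rightarrow> (('a \<Rightarrow> 'a) \<Rightarrow> 'x::topological_space \<Rightarrow> 'x) \<Rightarrow> ('a \<Rightarrow> 'a) pmf \<Rightarrow>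
     ('x \<Rightarrow> real) set" where
  "fiber_harmonic \<Gamma> \<alpha> \<mu> =
     {\<phi>. continuous_on UNIV \<phi> \<and> (\<forall>x. \<phi> x = (\<Sum>\<^sub>\<infinity>\<gamma>\<in>\<Gamma>. pmf \<mu> \<gamma> * \<phi> (\<alpha> \<gamma> x)))}"

definition action_invariant ::
    "('a \<Rightarrow> 'a) set \<Rightarrow> (('a \<Rightarrow> 'a) \<Rightarrow> 'x \<Rightarrow> 'x) \<Rightarrow> ('x \<Rightarrow> real) \<Rightarrow> bool" where
  "action_invariant \<Gamma> \<alpha> \<phi> \<longleftrightarrow> (\<forall>\<gamma>\<in>\<Gamma>. \<forall>x. \<phi> (\<alpha> \<gamma> x) = \<phi> x)"

end

theory Submission
  imports Defs
begin

text \<open>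
  For a leafwise harmonic \<open>f\<close> the functions \<open>h\<^sub>x = f (\<pi> (-, x))\<close> are bounded harmonic on the covering
  manifold, so they are the Poisson integrals of their values on the orbit of \<open>p\<^sub>0\<close>, and these
  are given by \<open>R f\<close>.  This yields \<open>\<mu>\<close>-harmonicity of \<open>R f\<close> and injectivity.  Conversely the
  Poisson integrals of \<open>\<gamma> p\<^sub>0 \<mapsto> \<phi> (\<gamma>\<^sup>-\<^sup>1 x)\<close> define an invariant function of \<open>(p, x)\<close> that is
  continuous in \<open>x\<close> for fixed \<open>p\<close>; it is jointly continuous because uniformly bounded harmonic
  functions are equicontinuous.  No elliptic regularity theory is needed for the latter: a modulus
  of continuity follows from the maximum principle for \<open>u x - u y\<close> by the doubling of
  variables of Ishii and Lions (the analytic form of reflection coupling).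
\<close>

section \<open>A Hoelder estimate by doubling of variables\<close>

text \<open>What is known about \<open>P\<close> is positivity, normalization, equivariance and the
  correspondence of bounded harmonic functions; nothing says that \<open>P p v\<close> is continuous
  in \<open>p\<close>. Continuity in the direction of \<open>D\<close>, uniformly in
  \<open>x\<close>, thus has to come from harmonicity, with a modulus that depends only on the
  metric and on a sup bound. At a doubled maximum the Hessians are bounded from one side only, so
  the error made by freezing the coefficients cannot be estimated by absolute values. For this
  reason an affine change of coordinates first makes the principal part the identity at the centre,
  and the remaining error enters through a one-sided trace inequality. In
  \<open>\<mu> \<gamma> = P (\<gamma> p\<^sub>0) p\<^sub>0\<close> the group element moves the first
  argument of the kernel; this is why inverses appear in every passage between the orbit of the base
  point and the fiber.\<close>

lemma second_derivative_at_local_max: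
  fixes f f' :: "real \<Rightarrow> real"
  assumes "d > 0" and max: "\<And>t. \<bar>t\<bar> < d \<Longrightarrow> f t \<le> f 0"
    and f: "\<And>t. \<bar>t\<bar> < d \<Longrightarrow> (f has_real_derivative f' t) (at t)"
    and f': "(f' has_real_derivative l) (at 0)"
  shows "f' 0 = 0" and "l \<le> 0"
proof -
  show 0: "f' 0 = 0"
    using DERIV_local_max[OF f[of 0] \<open>d > 0\<close>] max \<open>d > 0\<close> by simp
  show "l \<le> 0"
  \<comment> \<open>A positive derivative of \<open>f'\<close> at its zero makes \<open>f'\<close>
    positive just to the right of 0, and the mean value theorem then lifts \<open>f\<close> above
    \<open>f 0\<close>.\<close>
  proof (rule ccontr)
    assume "\<not> l \<le> 0"
    then obtain e where e: "e > 0" "\<And>h. 0 < h \<Longrightarrow> h < e \<Longrightarrow> f' 0 < f' (0 + h)"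
      using DERIV_pos_inc_right[OF f'] by force
    define t where "t = min d e / 2"
    have t: "0 < t" "t < d" "t < e" using \<open>d > 0\<close> e by (auto simp: t_def)
    obtain \<xi> where "0 < \<xi>" "\<xi> < t" "f t - f 0 = (t - 0) * f' \<xi>"
      using MVT2[of 0 t f f'] f t by auto
    moreover have "f' \<xi> > 0" using e(2)[of \<xi>] calculation t 0 by simp
    ultimately have "f t > f 0" using t by (smt (verit) mult_pos_pos)
    then show False using max[of t] t by simp
  qed
qed

text \<open>One-variable calculus along the line \<open>t \<mapsto> (x + t w1, y + t w2)\<close>
  through the maximum point. The power 1/4 of the squared distance is the square root of the
  distance. The two directions are independent of each other: later they are a basis vector and its
  mirror image, or one of them is 0.\<close>

lemma doubled_maximum:
  fixes v :: "'a::real_inner \<Rightarrow> real"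
  assumes v: "\<And>z. z \<in> S \<Longrightarrow> (v has_derivative Dv z) (at z)"
    and Dv: "\<And>z w. z \<in> S \<Longrightarrow> ((\<lambda>z. Dv z w) has_derivative D2v z w) (at z)"
    and "open S" "x \<in> S" "y \<in> S" "x \<noteq> y"
    and max: "\<And>x' y'. x' \<in> S \<Longrightarrow> y' \<in> S \<Longrightarrow>
        v x' - v y' - C * ((x' - y') \<bullet> (x' - y')) powr (1/4) - K * (x' \<bullet> x' + y' \<bullet> y')
        \<le> v x - v y - C * ((x - y) \<bullet> (x - y)) powr (1/4) - K * (x \<bullet> x + y \<bullet> y)"
  defines "z \<equiv> x - y"
  shows "Dv x w1 - Dv y w2 =
      C / 2 * (z \<bullet> z) powr (-3/4) * (z \<bullet> (w1 - w2)) + 2 * K * (x \<bullet> w1 + y \<bullet> w2)"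
    and "D2v x w1 w1 - D2v y w2 w2 \<le>
      C * ((z \<bullet> z) powr (-3/4) * ((w1 - w2) \<bullet> (w1 - w2)) / 2
         - 3/4 * (z \<bullet> z) powr (-7/4) * (z \<bullet> (w1 - w2))\<^sup>2) + 2 * K * (w1 \<bullet> w1 + w2 \<bullet> w2)"
proof -
  define d where "d = w1 - w2"
  \<comment> \<open>On these parameters both points stay in \<open>S\<close> and remain distinct, so
    the power is differentiated at positive arguments only.\<close>
  define N where "N = {t. x + t *\<^sub>R w1 \<in> S \<and> y + t *\<^sub>R w2 \<in> S \<and> (z + t *\<^sub>R d) \<bullet> (z + t *\<^sub>R d) > 0}"
  have "open N" unfolding N_def
  proof (intro open_Collect_conj)
    show "open {t. x + t *\<^sub>R w1 \<in> S}"
      using open_vimage[OF \<open>open S\<close>, of "\<lambda>t. x + t *\<^sub>R w1"] by (simp add: vimage_def continuous_intros)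
    show "open {t. y + t *\<^sub>R w2 \<in> S}"
      using open_vimage[OF \<open>open S\<close>, of "\<lambda>t. y + t *\<^sub>R w2"] by (simp add: vimage_def continuous_intros)
    show "open {t. 0 < (z + t *\<^sub>R d) \<bullet> (z + t *\<^sub>R d)}"
      by (intro open_Collect_less continuous_intros)
  qed
  moreover have "0 \<in> N" using assms by (simp add: N_def)
  ultimately obtain r where r: "r > 0" "ball 0 r \<subseteq> N" using open_contains_ball by blast
  have rN: "t \<in> N" if "\<bar>t\<bar> < r" for t using that r(2) by (auto simp: dist_real_def)
  define q where "q t = z \<bullet> z + 2 * t * (z \<bullet> d) + t\<^sup>2 * (d \<bullet> d)" for t
  have q_eq: "(z + t *\<^sub>R d) \<bullet> (z + t *\<^sub>R d) = q t" for t
    by (simp add: q_def inner_add_left inner_add_right inner_commute power2_eq_square algebra_simps)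
  have q: "(q has_real_derivative (2 * (z \<bullet> d) + 2 * t * (d \<bullet> d))) (at t)" for t
    unfolding q_def by (auto intro!: derivative_eq_intros)
  have qpos: "q t > 0" if "t \<in> N" for t using that by (simp add: N_def q_eq)
  define f where "f t = v (x + t *\<^sub>R w1) - v (y + t *\<^sub>R w2) - C * q t powr (1/4)
      - K * ((x \<bullet> x + 2 * t * (x \<bullet> w1) + t\<^sup>2 * (w1 \<bullet> w1)) + (y \<bullet> y + 2 * t * (y \<bullet> w2) + t\<^sup>2 * (w2 \<bullet> w2)))" for t
  define f' where "f' t = Dv (x + t *\<^sub>R w1) w1 - Dv (y + t *\<^sub>R w2) w2
      - C * (1/4 * q t powr (-3/4) * (2 * (z \<bullet> d) + 2 * t * (d \<bullet> d)))
      - K * ((2 * (x \<bullet> w1) + 2 * t * (w1 \<bullet> w1)) + (2 * (y \<bullet> w2) + 2 * t * (w2 \<bullet> w2)))" for t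
  have line: "((\<lambda>t. g (p + t *\<^sub>R w)) has_real_derivative Dg w) (at t)"
    if "(g has_derivative Dg) (at (p + t *\<^sub>R w))" for g :: "'a \<Rightarrow> real" and Dg p w t
  proof -
    have "((\<lambda>t. g (p + t *\<^sub>R w)) has_derivative (\<lambda>h. Dg (h *\<^sub>R w))) (at t)"
      by (rule has_derivative_compose[where f="\<lambda>t. p + t *\<^sub>R w" and g=g, OF _ that])
         (auto intro!: derivative_eq_intros)
    moreover have "Dg (h *\<^sub>R w) = Dg w * h" for h
      using linear_scale[OF has_derivative_linear[OF that]] by simp
    ultimately show ?thesis by (simp add: has_field_derivative_def)
  qed
  have f: "(f has_real_derivative f' t) (at t)" if "t \<in> N" for t
    unfolding f_def f'_def using that qpos[OF that]
    by (auto intro!: derivative_eq_intros line[OF v] q simp: N_def)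
  have D2: "((\<lambda>t. Dv (x + t *\<^sub>R w1) w1) has_real_derivative D2v x w1 w1) (at 0)"
    "((\<lambda>t. Dv (y + t *\<^sub>R w2) w2) has_real_derivative D2v y w2 w2) (at 0)"
    using line[of "\<lambda>z. Dv z w1" "D2v x w1" x 0 w1] line[of "\<lambda>z. Dv z w2" "D2v y w2" y 0 w2]
      Dv[OF \<open>x \<in> S\<close>, of w1] Dv[OF \<open>y \<in> S\<close>, of w2] by simp_all
  have f': "(f' has_real_derivative (D2v x w1 w1 - D2v y w2 w2
      - C * ((z \<bullet> z) powr (-3/4) * (d \<bullet> d) / 2 - 3/4 * (z \<bullet> z) powr (-7/4) * (z \<bullet> d)\<^sup>2)
      - 2 * K * (w1 \<bullet> w1 + w2 \<bullet> w2))) (at 0)"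
    unfolding f'_def using qpos[OF \<open>0 \<in> N\<close>] D2
    by (auto intro!: derivative_eq_intros q simp: q_def field_simps power2_eq_square)
  have "f t \<le> f 0" if "\<bar>t\<bar> < r" for t
    using max[of "x + t *\<^sub>R w1" "y + t *\<^sub>R w2"] rN[OF that] q_eq[of t]
    by (simp add: f_def N_def z_def d_def q_def inner_add_left inner_add_right inner_commute
       power2_eq_square algebra_simps)
  from second_derivative_at_local_max[OF r(1) this f[OF rN] f']
  show "Dv x w1 - Dv y w2 =
      C / 2 * (z \<bullet> z) powr (-3/4) * (z \<bullet> (w1 - w2)) + 2 * K * (x \<bullet> w1 + y \<bullet> w2)"
    and "D2v x w1 w1 - D2v y w2 w2 \<le>
      C * ((z \<bullet> z) powr (-3/4) * ((w1 - w2) \<bullet> (w1 - w2)) / 2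
         - 3/4 * (z \<bullet> z) powr (-7/4) * (z \<bullet> (w1 - w2))\<^sup>2) + 2 * K * (w1 \<bullet> w1 + w2 \<bullet> w2)"
    by (simp_all add: f'_def q_def algebra_simps flip: d_def)
qed

text \<open>A symmetric diagonally dominant matrix is a nonnegative combination of the rank-one
  matrices of the vectors \<open>e_k\<close>, \<open>e_k + e_l\<close> and \<open>e_k - e_l\<close>.
  Hence the quadratic form of \<open>N\<close> need only be nonnegative on sums and differences of
  two basis vectors, which is what the last two hypotheses express.\<close>

lemma diagonally_dominant_trace_nonneg:
  fixes S N :: "'n::finite \<Rightarrow> 'n \<Rightarrow> real"
  assumes sym: "\<And>k l. S k l = S l k"
    and dom: "\<And>k. (\<Sum>l\<in>UNIV - {k}. \<bar>S k l\<bar>) \<le> S k k"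
    and plus: "\<And>k l. 0 \<le> N k k + N l l + (N k l + N l k)"
    and minus: "\<And>k l. 0 \<le> N k k + N l l - (N k l + N l k)"
  shows "0 \<le> (\<Sum>k\<in>UNIV. \<Sum>l\<in>UNIV. S k l * N k l)"
proof -
  define T where "T k l = (if k = l then 0 else \<bar>S k l\<bar>)" for k l
  have Tsym: "T k l = T l k" for k l using sym[of k l] by (simp add: T_def)
  have Nkk: "0 \<le> N k k" for k using plus[of k k] minus[of k k] by simp
  have Tsum: "(\<Sum>l\<in>UNIV. T k l) \<le> S k k" for k
  proof -
    have "(\<Sum>l\<in>UNIV. T k l) = (\<Sum>l\<in>UNIV - {k}. \<bar>S k l\<bar>)"
      by (rule sum.mono_neutral_cong_right) (auto simp: T_def)
    then show ?thesis using dom by simp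
  qed
  \<comment> \<open>Pairing each entry with its transpose leaves only the symmetric part of
    \<open>N\<close>, which is controlled by the diagonal; the factor 2 compensates for counting
    each pair twice.\<close>
  have pt: "S k l * (N k l + N l k) \<ge> (if l = k then 2 * (S k k * N k k) else 0) - T k l * (N k k + N l l)" for k l
  proof (cases "k = l")
    case False
    have "\<bar>N k l + N l k\<bar> \<le> N k k + N l l" using plus[of k l] minus[of k l] by linarith
    then have "\<bar>S k l\<bar> * \<bar>N k l + N l k\<bar> \<le> \<bar>S k l\<bar> * (N k k + N l l)" by (rule mult_left_mono) simp
    then show ?thesis using False by (simp add: T_def flip: abs_mult)
  qed (simp add: T_def)
  have swap: "(\<Sum>k\<in>UNIV. \<Sum>l\<in>UNIV. T k l * N l l) = (\<Sum>k\<in>UNIV. \<Sum>l\<in>UNIV. T k l * N k k)"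
    by (subst sum.swap) (simp add: Tsym)
  have swap': "(\<Sum>k\<in>UNIV. \<Sum>l\<in>UNIV. S k l * N l k) = (\<Sum>k\<in>UNIV. \<Sum>l\<in>UNIV. S k l * N k l)"
    by (subst sum.swap) (simp add: sym)
  have "0 \<le> 2 * (\<Sum>k\<in>UNIV. (S k k - (\<Sum>l\<in>UNIV. T k l)) * N k k)"
    by (intro mult_nonneg_nonneg sum_nonneg) (use Nkk Tsum in auto)
  also have "\<dots> = (\<Sum>k\<in>UNIV. \<Sum>l\<in>UNIV. (if l = k then 2 * (S k k * N k k) else 0) - T k l * (N k k + N l l))"
    by (simp add: sum_subtractf sum.distrib distrib_left swap left_diff_distrib sum_distrib_left
       sum_distrib_right right_diff_distrib)
  also have "\<dots> \<le> (\<Sum>k\<in>UNIV. \<Sum>l\<in>UNIV. S k l * (N k l + N l k))"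
    by (intro sum_mono pt)
  also have "\<dots> = 2 * (\<Sum>k\<in>UNIV. \<Sum>l\<in>UNIV. S k l * N k l)"
    by (simp add: distrib_left sum.distrib swap')
  finally show ?thesis by simp
qed

lemma sum_axis_inner:
  fixes f :: "real^'n \<Rightarrow> real"
  assumes "linear f"
  shows "(\<Sum>k\<in>UNIV. x $ k * f (axis k 1)) = f x"
proof -
  have "f x = f (\<Sum>k\<in>UNIV. x $ k *\<^sub>R axis k 1)" by (simp add: basis_expansion flip: scalar_mult_eq_scaleR)
  also have "\<dots> = (\<Sum>k\<in>UNIV. x $ k * f (axis k 1))"
    by (simp add: linear_sum[OF assms] linear_scale[OF assms])
  finally show ?thesis by simp
qed

text \<open>The vectors are the mirror images of the standard basis in the hyperplane orthogonal to
  \<open>z\<close>, hence again an orthonormal basis, and the trace does not depend on such a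
  choice. In the expansion the two mixed terms cancel the quadratic one.\<close>

lemma trace_reflection:
  fixes \<beta> :: "real^'n \<Rightarrow> real^'n \<Rightarrow> real"
  assumes "bilinear \<beta>" "z \<noteq> 0"
  shows "(\<Sum>k\<in>UNIV. \<beta> (axis k 1 - (2 * z $ k / (z \<bullet> z)) *\<^sub>R z) (axis k 1 - (2 * z $ k / (z \<bullet> z)) *\<^sub>R z))
       = (\<Sum>k\<in>UNIV. \<beta> (axis k 1) (axis k 1))"
proof -
  define Q where "Q = z \<bullet> z"
  have Q: "Q \<noteq> 0" using assms by (simp add: Q_def)
  have l: "linear (\<lambda>x. \<beta> x y)" "linear (\<beta> y)" for y using assms by (auto simp: bilinear_def)
  have zz: "(\<Sum>k\<in>UNIV. z $ k * z $ k) = Q" by (simp add: Q_def inner_vec_def)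
  have "(\<Sum>k\<in>UNIV. \<beta> (axis k 1 - (2 * z $ k / Q) *\<^sub>R z) (axis k 1 - (2 * z $ k / Q) *\<^sub>R z))
    = (\<Sum>k\<in>UNIV. \<beta> (axis k 1) (axis k 1) - 2 / Q * (z $ k * \<beta> (axis k 1) z)
       - 2 / Q * (z $ k * \<beta> z (axis k 1)) + 4 / Q^2 * \<beta> z z * (z $ k * z $ k))"
    by (intro sum.cong refl)
       (simp add: bilinear_lsub[OF assms(1)] bilinear_rsub[OF assms(1)] bilinear_lmul[OF assms(1)]
         bilinear_rmul[OF assms(1)] algebra_simps power2_eq_square)
  also have "\<dots> = (\<Sum>k\<in>UNIV. \<beta> (axis k 1) (axis k 1)) - 2 / Q * \<beta> z z - 2 / Q * \<beta> z z + 4 / Q^2 * \<beta> z z * Q"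
    unfolding sum.distrib sum_subtractf sum_distrib_left[symmetric]
    by (simp only: zz sum_axis_inner[OF l(1)] sum_axis_inner[OF l(2)])
  also have "\<dots> = (\<Sum>k\<in>UNIV. \<beta> (axis k 1) (axis k 1))"
    using Q by (simp add: field_simps power2_eq_square)
  finally show ?thesis by (simp add: Q_def)
qed

text \<open>Only an upper bound for \<beta> is available at a maximum. The matrix \<open>S\<close>,
  which is \<open>a\<close> minus \<open>1 - n * \<theta>\<close> times the identity, is diagonally
  dominant, and it is paired with the nonnegative form \<Lambda> times the inner product minus
  \<beta>. The price is \<Lambda> times the trace of \<open>S\<close>, which is at most
  \<open>2 * n\<^sup>2 * \<theta> \<le> 1 / 8\<close>.\<close>

lemma near_identity_trace_bound:
  fixes \<beta> :: "real^'n \<Rightarrow> real^'n \<Rightarrow> real" and a :: "'n::finite \<Rightarrow> 'n \<Rightarrow> real"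
  defines "n \<equiv> real CARD('n)"
  assumes bil: "bilinear \<beta>" and \<Lambda>: "\<And>w. \<beta> w w \<le> \<Lambda> * (w \<bullet> w)" "0 \<le> \<Lambda>"
    and sym: "\<And>k l. a k l = a l k"
    and a: "\<And>k l. \<bar>a k l - (if k = l then 1 else 0)\<bar> \<le> \<theta>"
    and \<theta>: "0 \<le> \<theta>" "16 * n\<^sup>2 * \<theta> \<le> 1"
  shows "(\<Sum>k\<in>UNIV. \<Sum>l\<in>UNIV. a k l * \<beta> (axis k 1) (axis l 1))
    \<le> (1 - n * \<theta>) * (\<Sum>k\<in>UNIV. \<beta> (axis k 1) (axis k 1)) + \<Lambda> / 8"
proof -
  define \<delta> :: "'n \<Rightarrow> 'n \<Rightarrow> real" where "\<delta> k l = (if l = k then 1 else 0)" for k l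
  define e :: "'n \<Rightarrow> real^'n" where "e k = axis k 1" for k
  define S where "S k l = a k l - (1 - n * \<theta>) * \<delta> k l" for k l
  define N where "N k l = \<Lambda> * \<delta> k l - \<beta> (e k) (e l)" for k l
  have n: "n \<ge> 1" by (simp add: n_def Suc_leI)
  have ee: "e k \<bullet> e l = \<delta> k l" for k l by (simp add: e_def \<delta>_def inner_axis_axis)
  \<comment> \<open>The \<open>n - 1\<close> other entries of a row contribute at most \<theta>
    each, and the diagonal entry is at least \<open>n * \<theta> - \<theta>\<close>; this balance
    fixes the factor \<open>1 - n * \<theta>\<close>.\<close>
  have dom: "(\<Sum>l\<in>UNIV - {k}. \<bar>S k l\<bar>) \<le> S k k" for k
  proof -
    have "\<bar>S k l\<bar> \<le> \<theta>" if "l \<in> UNIV - {k}" for l using a[of k l] that by (auto simp: S_def \<delta>_def)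
    then have "(\<Sum>l\<in>UNIV - {k}. \<bar>S k l\<bar>) \<le> (\<Sum>l\<in>UNIV - {k}. \<theta>)" by (rule sum_mono)
    also have "\<dots> = (n - 1) * \<theta>" using n by (simp add: n_def of_nat_diff card_Diff_singleton)
    also have "\<dots> \<le> S k k" using a[of k k] by (simp add: S_def \<delta>_def algebra_simps)
    finally show ?thesis .
  qed
  have plus: "0 \<le> N k k + N l l + (N k l + N l k)" for k l
    using \<Lambda>(1)[of "e k + e l"]
    by (simp add: N_def bilinear_ladd[OF bil] bilinear_radd[OF bil] inner_add_left inner_add_right ee algebra_simps)
  have minus: "0 \<le> N k k + N l l - (N k l + N l k)" for k l
    using \<Lambda>(1)[of "e k - e l"]
    by (simp add: N_def bilinear_lsub[OF bil] bilinear_rsub[OF bil] inner_diff_left inner_diff_right ee algebra_simps)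
  have symS: "S k l = S l k" for k l using sym[of k l] by (simp add: S_def \<delta>_def)
  have \<delta>sum: "(\<Sum>l\<in>UNIV. f l * \<delta> k l) = f k" for f k by (simp add: \<delta>_def if_distrib cong: if_cong)
  have pt: "S k l * N k l = \<Lambda> * (S k l * \<delta> k l) - a k l * \<beta> (e k) (e l) + (1 - n * \<theta>) * (\<beta> (e k) (e l) * \<delta> k l)" for k l
    by (simp add: S_def N_def algebra_simps)
  have "0 \<le> (\<Sum>k\<in>UNIV. \<Sum>l\<in>UNIV. S k l * N k l)"
    by (rule diagonally_dominant_trace_nonneg[OF symS dom plus minus])
  also have "\<dots> = \<Lambda> * (\<Sum>k\<in>UNIV. S k k) - (\<Sum>k\<in>UNIV. \<Sum>l\<in>UNIV. a k l * \<beta> (e k) (e l))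
      + (1 - n * \<theta>) * (\<Sum>k\<in>UNIV. \<beta> (e k) (e k))"
    unfolding pt sum.distrib sum_subtractf sum_distrib_left[symmetric] \<delta>sum ..
  finally have *: "(\<Sum>k\<in>UNIV. \<Sum>l\<in>UNIV. a k l * \<beta> (e k) (e l))
      \<le> (1 - n * \<theta>) * (\<Sum>k\<in>UNIV. \<beta> (e k) (e k)) + \<Lambda> * (\<Sum>k\<in>UNIV. S k k)" by simp
  have "S k k \<le> \<theta> + n * \<theta>" for k using a[of k k] by (simp add: S_def \<delta>_def algebra_simps)
  then have "(\<Sum>k\<in>UNIV. S k k) \<le> (\<Sum>k\<in>(UNIV::'n set). \<theta> + n * \<theta>)" by (intro sum_mono)
  also have "\<dots> = n * \<theta> + n\<^sup>2 * \<theta>" by (simp add: n_def power2_eq_square algebra_simps)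
  also have "\<dots> \<le> n\<^sup>2 * \<theta> + n\<^sup>2 * \<theta>" using n \<theta>(1) by (intro add_mono mult_right_mono) (simp_all add: power2_eq_square)
  also have "\<dots> \<le> 1 / 8" using \<theta>(2) by (simp add: algebra_simps)
  finally have "\<Lambda> * (\<Sum>k\<in>UNIV. S k k) \<le> \<Lambda> * (1 / 8)" using \<Lambda>(2) by (rule mult_left_mono)
  with * show ?thesis by (simp add: e_def)
qed

text \<open>
  Doubling of variables: a positive maximum of
  \<open>v x - v y - C \<bar>x - y\<bar>\<^bsup>1/2\<^esup> - K (\<bar>x\<bar>\<^sup>2 + \<bar>y\<bar>\<^sup>2)\<close> over pairs of points is interior, and there the
  second derivatives in the directions \<open>(w, R w)\<close>, with \<open>R\<close> the reflection along \<open>x - y\<close>, contradict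
  the equation.
\<close>

lemma elliptic_holder_estimate:
  fixes v :: "real^'n::finite \<Rightarrow> real" and a :: "real^'n \<Rightarrow> 'n \<Rightarrow> 'n \<Rightarrow> real"
    and b :: "real^'n \<Rightarrow> 'n \<Rightarrow> real"
  defines "n \<equiv> real CARD('n)"
  assumes \<rho>: "0 < \<rho>" "2 * \<rho> \<le> 1" "16 * n * B * \<rho> \<le> 1" and "cball 0 \<rho> \<subseteq> S"
    and v: "\<And>z. z \<in> S \<Longrightarrow> (v has_derivative Dv z) (at z)"
    and Dv: "\<And>z w. z \<in> S \<Longrightarrow> ((\<lambda>z. Dv z w) has_derivative D2v z w) (at z)"
    and bil: "\<And>z. z \<in> S \<Longrightarrow> bilinear (D2v z)"
    and sym: "\<And>z k l. z \<in> S \<Longrightarrow> a z k l = a z l k"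
    and a: "\<And>z k l. z \<in> S \<Longrightarrow> \<bar>a z k l - (if k = l then 1 else 0)\<bar> \<le> \<theta>"
    and \<theta>: "0 \<le> \<theta>" "16 * n\<^sup>2 * \<theta> \<le> 1"
    and b: "\<And>z k. z \<in> S \<Longrightarrow> \<bar>b z k\<bar> \<le> B"
    and M: "\<And>z. z \<in> S \<Longrightarrow> \<bar>v z\<bar> \<le> M"
    and eq: "\<And>z. z \<in> S \<Longrightarrow> (\<Sum>k\<in>UNIV. \<Sum>l\<in>UNIV. a z k l * D2v z (axis k 1) (axis l 1))
        + (\<Sum>k\<in>UNIV. b z k * Dv z (axis k 1)) = 0"
    and w: "norm w \<le> \<rho>"
  defines "K \<equiv> (2 * M + 1) / \<rho>\<^sup>2"
  shows "v w - v 0 \<le> (4 * K * (4 * n + 1 + 2 * n * B) + 1) * (w \<bullet> w) powr (1/4) + K * (w \<bullet> w)"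
proof -
  \<comment> \<open>The constant is read off from the end of the argument, where
    \<open>C / 4\<close> has to exceed \<open>4 * n * K + K / 2 + 2 * (n * B * K)\<close>.\<close>
  define C where "C = 4 * K * (4 * n + 1 + 2 * n * B) + 1"
  define G where "G x y = v x - v y - C * ((x - y) \<bullet> (x - y)) powr (1/4) - K * (x \<bullet> x + y \<bullet> y)" for x y
  have n: "n \<ge> 1" by (simp add: n_def Suc_leI)
  have S: "x \<in> S" if "norm x \<le> \<rho>" for x using that \<open>cball 0 \<rho> \<subseteq> S\<close> by auto
  have "0 \<in> S" using S[of 0] \<rho> by simp
  then have M0: "0 \<le> M" and B0: "0 \<le> B"
    using M[of 0] b[of 0] by (meson abs_ge_zero order_trans)+
  have K: "K > 0" "K * \<rho>\<^sup>2 = 2 * M + 1" using M0 \<rho> by (auto simp: K_def)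
  have nB: "n * B \<ge> 0" using n B0 by simp
  have C: "C > 0" unfolding C_def using K n nB
    by (intro add_nonneg_pos mult_nonneg_nonneg) auto
  have cv: "continuous_on (cball 0 \<rho>) v"
    by (metis S mem_cball_0 continuous_at_imp_continuous_on has_derivative_continuous v)
  have "continuous_on (cball 0 \<rho> \<times> cball 0 \<rho>) (\<lambda>p. G (fst p) (snd p))"
    unfolding G_def
    by (intro continuous_intros continuous_on_powr' continuous_on_compose2[OF cv]) auto
  moreover have "compact (cball (0::real^'n) \<rho> \<times> cball (0::real^'n) \<rho>)"
    by (intro compact_Times compact_cball)
  moreover have "cball (0::real^'n) \<rho> \<times> cball (0::real^'n) \<rho> \<noteq> {}" using \<rho> by auto
  ultimately obtain p where "p \<in> cball 0 \<rho> \<times> cball 0 \<rho>"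
    "\<forall>q\<in>cball 0 \<rho> \<times> cball 0 \<rho>. G (fst q) (snd q) \<le> G (fst p) (snd p)"
    by (metis (no_types, lifting) continuous_attains_sup)
  then obtain x y where xy: "norm x \<le> \<rho>" "norm y \<le> \<rho>"
    and max: "\<And>x' y'. norm x' \<le> \<rho> \<Longrightarrow> norm y' \<le> \<rho> \<Longrightarrow> G x' y' \<le> G x y"
    by (cases p) auto
  have "G x y \<le> 0"
  proof (rule ccontr)
    assume pos: "\<not> G x y \<le> 0"
    \<comment> \<open>\<open>K * \<rho>\<^sup>2\<close> is one more than the largest possible value
      of \<open>v x - v y\<close>, so a positive maximum cannot lie on the boundary.\<close>
    have "v x - v y \<le> 2 * M" using M[OF S[OF xy(1)]] M[OF S[OF xy(2)]] by linarith
    moreover have "C * ((x - y) \<bullet> (x - y)) powr (1/4) \<ge> 0" using C by simp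
    ultimately have "K * (x \<bullet> x + y \<bullet> y) < K * \<rho>\<^sup>2" using pos by (simp add: G_def K(2))
    then have "x \<bullet> x + y \<bullet> y < \<rho>\<^sup>2" using K(1) by simp
    then have "(norm x)\<^sup>2 < \<rho>\<^sup>2" "(norm y)\<^sup>2 < \<rho>\<^sup>2"
      by (simp_all add: power2_norm_eq_inner) (smt (verit) inner_ge_zero)+
    then have int: "x \<in> ball 0 \<rho>" "y \<in> ball 0 \<rho>"
      using \<rho> by (auto intro: power2_less_imp_less)
    then have xS: "x \<in> S" and yS: "y \<in> S" using S by auto
    have "x \<noteq> y" using pos K(1) by (auto simp: G_def mult_less_0_iff zero_le_mult_iff)
    define z where "z = x - y"
    define Q where "Q = z \<bullet> z"
    \<comment> \<open>Up to constant factors this is the size of the second derivatives of the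
      penalty at distance \<open>norm z\<close>. Since that distance is at most 1, \<open>F\<close>
      is at least \<open>C\<close>.\<close>
    define F where "F = C * Q powr (-3/4)"
    define \<Lambda> where "\<Lambda> = F / 2 + 2 * K"
    have z0: "z \<noteq> 0" using \<open>x \<noteq> y\<close> by (simp add: z_def)
    then have Q0: "Q > 0" by (simp add: Q_def)
    have nz: "norm z \<le> 2 * \<rho>" using xy norm_triangle_ineq4[of x y] by (simp add: z_def)
    have "(norm z)\<^sup>2 \<le> 1\<^sup>2" using nz \<rho> by (intro power_mono) auto
    then have "Q \<le> 1" by (simp add: Q_def power2_norm_eq_inner)
    then have "1 powr (-3/4) \<le> Q powr (-3/4)" using Q0 by (intro powr_mono2') auto
    then have FC: "F \<ge> C" using C by (simp add: F_def)
    have sub: "ball 0 \<rho> \<subseteq> S" using S by auto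
    have vb: "(v has_derivative Dv z) (at z)" and Dvb: "((\<lambda>z. Dv z w) has_derivative D2v z w) (at z)"
      if "z \<in> ball 0 \<rho>" for z w using v Dv sub that by blast+
    have mx: "v x' - v y' - C * ((x' - y') \<bullet> (x' - y')) powr (1/4) - K * (x' \<bullet> x' + y' \<bullet> y')
        \<le> v x - v y - C * ((x - y) \<bullet> (x - y)) powr (1/4) - K * (x \<bullet> x + y \<bullet> y)"
      if "x' \<in> ball 0 \<rho>" "y' \<in> ball 0 \<rho>" for x' y'
      using max[of x' y'] that by (simp add: G_def)
    have first: "Dv x w1 - Dv y w2 = C / 2 * Q powr (-3/4) * (z \<bullet> (w1 - w2)) + 2 * K * (x \<bullet> w1 + y \<bullet> w2)"
      and second: "D2v x w1 w1 - D2v y w2 w2 \<le>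
        C * (Q powr (-3/4) * ((w1 - w2) \<bullet> (w1 - w2)) / 2 - 3/4 * Q powr (-7/4) * (z \<bullet> (w1 - w2))\<^sup>2)
        + 2 * K * (w1 \<bullet> w1 + w2 \<bullet> w2)" for w1 w2
      unfolding Q_def z_def
      by (rule doubled_maximum[where S = "ball 0 \<rho>" and v = v and D2v = D2v and Dv = Dv];
          (rule vb Dvb open_ball int \<open>x \<noteq> y\<close> mx; assumption))+
    have lin: "Dv x 0 = 0" "Dv y 0 = 0" "D2v x 0 0 = 0" "D2v y 0 0 = 0"
      using has_derivative_linear[OF v[OF xS]] has_derivative_linear[OF v[OF yS]]
        bilinear_lzero[OF bil[OF xS]] bilinear_lzero[OF bil[OF yS]] by (simp_all add: linear_0)
    \<comment> \<open>Moving only one of the two points determines each gradient exactly.\<close>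
    have Dx: "Dv x w = F / 2 * (z \<bullet> w) + 2 * K * (x \<bullet> w)" for w
      using first[of w 0] lin by (simp add: F_def)
    have Dy: "Dv y w = F / 2 * (z \<bullet> w) - 2 * K * (y \<bullet> w)" for w
      using first[of 0 w] lin by (simp add: F_def)
    \<comment> \<open>Moving only one point and discarding the favourable radial term gives a bound
      for each Hessian, but only from above at \<open>x\<close> and from below at
      \<open>y\<close>.\<close>
    have nn: "0 \<le> C * (3/4 * Q powr (-7/4) * t\<^sup>2)" for t using C by simp
    have Xle: "D2v x w w \<le> \<Lambda> * (w \<bullet> w)" for w
      using second[of w 0] lin nn[of "z \<bullet> w"] by (simp add: \<Lambda>_def F_def algebra_simps)
    have Yle: "- D2v y w w \<le> \<Lambda> * (w \<bullet> w)" for w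
      using second[of 0 w] lin nn[of "z \<bullet> w"] by (simp add: \<Lambda>_def F_def algebra_simps)
    have \<Lambda>0: "\<Lambda> \<ge> 0" using FC C K by (simp add: \<Lambda>_def)
    define R where "R k = axis k 1 - (2 * z $ k / Q) *\<^sub>R z" for k :: 'n
    \<comment> \<open>The two directions differ by a multiple of \<open>z\<close>. The convex part
      of the second derivative of the penalty then contributes 2 and the concave part -3 times
      \<open>F / Q * (z $ k)\<^sup>2\<close>; the sum over \<open>k\<close> is the decisive gain
      \<open>- F\<close>.\<close>
    have refl: "D2v x (axis k 1) (axis k 1) - D2v y (R k) (R k) \<le> 4 * K - F / Q * (z $ k * z $ k)" for k
    proof -
      define t where "t = z $ k"
      have d: "axis k 1 - R k = (2 * t / Q) *\<^sub>R z" by (simp add: R_def t_def)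
      have zd: "z \<bullet> ((2 * t / Q) *\<^sub>R z) = 2 * t" using Q0 by (simp flip: Q_def)
      have dd: "((2 * t / Q) *\<^sub>R z) \<bullet> ((2 * t / Q) *\<^sub>R z) = 4 * t\<^sup>2 / Q"
        using Q0 by (simp add: power2_eq_square flip: Q_def)
      have RR: "R k \<bullet> R k = 1"
        using Q0 by (simp add: R_def inner_diff_left inner_diff_right inner_axis_axis inner_axis inner_axis' flip: Q_def)
      have p: "Q powr (-7/4) = Q powr (-3/4) / Q"
        using powr_diff[of Q "-3/4" 1] Q0 by simp
      have "C * (Q powr (-3/4) * (4 * t\<^sup>2 / Q) / 2 - 3/4 * Q powr (-7/4) * (2 * t)\<^sup>2) = - (F / Q * (t * t))"
        unfolding p F_def using Q0 by (simp add: field_simps power2_eq_square)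
      then show ?thesis
        using second[of "axis k 1" "R k"] unfolding d zd dd RR by (simp add: inner_axis_axis t_def)
    qed
    have "(\<Sum>k\<in>UNIV. D2v x (axis k 1) (axis k 1)) - (\<Sum>k\<in>UNIV. D2v y (axis k 1) (axis k 1))
       = (\<Sum>k\<in>UNIV. D2v x (axis k 1) (axis k 1) - D2v y (R k) (R k))"
      using trace_reflection[OF bil[OF yS] z0] by (simp add: R_def Q_def sum_subtractf)
    also have "\<dots> \<le> (\<Sum>k\<in>(UNIV::'n set). 4 * K - F / Q * (z $ k * z $ k))"
      by (intro sum_mono refl)
    also have "\<dots> = n * (4 * K) - F / Q * (\<Sum>k\<in>UNIV. z $ k * z $ k)"
      unfolding sum_subtractf sum_distrib_left[symmetric] by (simp add: n_def)
    also have "(\<Sum>k\<in>UNIV. z $ k * z $ k) = Q" by (simp add: Q_def inner_vec_def)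
    finally have tr: "(\<Sum>k\<in>UNIV. D2v x (axis k 1) (axis k 1)) - (\<Sum>k\<in>UNIV. D2v y (axis k 1) (axis k 1))
       \<le> 4 * n * K - F" using Q0 by simp
    have n\<theta>: "0 \<le> n * \<theta>" "2 * (n * \<theta>) \<le> 1"
    proof -
      have "n * \<theta> \<le> n\<^sup>2 * \<theta>" using n \<theta> by (intro mult_right_mono) (auto simp: power2_eq_square)
      then show "2 * (n * \<theta>) \<le> 1" using \<theta> by simp
    qed (use n \<theta> in simp)
    have tx: "(\<Sum>k\<in>UNIV. \<Sum>l\<in>UNIV. a x k l * D2v x (axis k 1) (axis l 1))
        \<le> (1 - n * \<theta>) * (\<Sum>k\<in>UNIV. D2v x (axis k 1) (axis k 1)) + \<Lambda> / 8"
      unfolding n_def by (rule near_identity_trace_bound)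
        (use bil[OF xS] Xle \<Lambda>0 sym[OF xS] a[OF xS] \<theta> in \<open>auto simp: n_def\<close>)
    have "bilinear (\<lambda>w w'. - D2v y w w')"
      using bil[OF yS] by (auto simp: bilinear_def intro: linear_compose_neg)
    then have "(\<Sum>k\<in>UNIV. \<Sum>l\<in>UNIV. a y k l * - D2v y (axis k 1) (axis l 1))
        \<le> (1 - n * \<theta>) * (\<Sum>k\<in>UNIV. - D2v y (axis k 1) (axis k 1)) + \<Lambda> / 8"
      unfolding n_def by (rule near_identity_trace_bound)
        (use Yle \<Lambda>0 sym[OF yS] a[OF yS] \<theta> in \<open>auto simp: n_def\<close>)
    then have ty: "- (\<Sum>k\<in>UNIV. \<Sum>l\<in>UNIV. a y k l * D2v y (axis k 1) (axis l 1))
        \<le> - ((1 - n * \<theta>) * (\<Sum>k\<in>UNIV. D2v y (axis k 1) (axis k 1))) + \<Lambda> / 8"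
      by (simp add: sum_negf)
    have F0: "F > 0" using FC C by linarith
    \<comment> \<open>The large part of the gradient is \<open>F / 2\<close> times \<open>z\<close>,
      and \<open>norm z\<close> is at most \<open>2 * \<rho>\<close>. So the first-order terms are
      of size \<open>F * \<rho>\<close>, and a small radius lets the gain absorb them.\<close>
    have drift: "\<bar>\<Sum>k\<in>UNIV. b u k * Dv u (axis k 1)\<bar> \<le> n * B * (F * \<rho> + K)"
      if u: "u \<in> S" and Du: "\<And>w. \<bar>Dv u w\<bar> \<le> F / 2 * \<bar>z \<bullet> w\<bar> + 2 * K * \<bar>u \<bullet> w\<bar>" and nu: "norm u \<le> \<rho>" for u
    proof -
      have "\<bar>b u k * Dv u (axis k 1)\<bar> \<le> B * (F * \<rho> + K)" for k
      proof -
        have "\<bar>z \<bullet> axis k 1\<bar> \<le> 2 * \<rho>" "\<bar>u \<bullet> axis k 1\<bar> \<le> 1/2"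
          using component_le_norm_cart[of z k] component_le_norm_cart[of u k] nz nu \<rho>
          by (auto simp: inner_axis)
        then have "F / 2 * \<bar>z \<bullet> axis k 1\<bar> \<le> F / 2 * (2 * \<rho>)" "2 * K * \<bar>u \<bullet> axis k 1\<bar> \<le> 2 * K * (1/2)"
          using F0 K by (auto intro!: mult_left_mono)
        then have "\<bar>Dv u (axis k 1)\<bar> \<le> F * \<rho> + K" using Du[of "axis k 1"] by simp
        then show ?thesis unfolding abs_mult using b[OF u] B0 by (intro mult_mono) auto
      qed
      then have "(\<Sum>k\<in>UNIV. \<bar>b u k * Dv u (axis k 1)\<bar>) \<le> (\<Sum>k\<in>(UNIV::'n set). B * (F * \<rho> + K))"
        by (intro sum_mono)
      then show ?thesis by (intro order_trans[OF sum_abs]) (simp add: n_def mult.assoc)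
    qed
    have "\<bar>Dv x w\<bar> \<le> F / 2 * \<bar>z \<bullet> w\<bar> + 2 * K * \<bar>x \<bullet> w\<bar>" for w
      unfolding Dx using abs_triangle_ineq[of "F / 2 * (z \<bullet> w)" "2 * K * (x \<bullet> w)"] F0 K by (simp add: abs_mult)
    from drift[OF xS this xy(1)]
    have dx: "\<bar>\<Sum>k\<in>UNIV. b x k * Dv x (axis k 1)\<bar> \<le> n * B * (F * \<rho> + K)" .
    have "\<bar>Dv y w\<bar> \<le> F / 2 * \<bar>z \<bullet> w\<bar> + 2 * K * \<bar>y \<bullet> w\<bar>" for w
      unfolding Dy using abs_triangle_ineq4[of "F / 2 * (z \<bullet> w)" "2 * K * (y \<bullet> w)"] F0 K by (simp add: abs_mult)
    from drift[OF yS this xy(2)]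
    have dy: "\<bar>\<Sum>k\<in>UNIV. b y k * Dv y (axis k 1)\<bar> \<le> n * B * (F * \<rho> + K)" .
    have "(1 - n * \<theta>) * ((\<Sum>k\<in>UNIV. D2v x (axis k 1) (axis k 1)) - (\<Sum>k\<in>UNIV. D2v y (axis k 1) (axis k 1)))
       \<le> (1 - n * \<theta>) * (4 * n * K - F)"
      using n\<theta> by (intro mult_left_mono tr) auto
    also have "\<dots> = (1 - n * \<theta>) * (4 * n * K) - (1 - n * \<theta>) * F" by (simp add: algebra_simps)
    also have "\<dots> \<le> 1 * (4 * n * K) - 1/2 * F"
      using n\<theta> n K F0 by (intro diff_mono mult_right_mono) auto
    finally have tr': "(1 - n * \<theta>) * (\<Sum>k\<in>UNIV. D2v x (axis k 1) (axis k 1))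
       - (1 - n * \<theta>) * (\<Sum>k\<in>UNIV. D2v y (axis k 1) (axis k 1)) \<le> 4 * n * K - F / 2"
      by (simp add: right_diff_distrib)
    have "16 * n * B * \<rho> * F \<le> 1 * F" using \<rho>(3) F0 by (intro mult_right_mono) auto
    then have dF: "2 * (n * B * (F * \<rho> + K)) \<le> F / 8 + 2 * (n * B * K)" by (simp add: algebra_simps)
    \<comment> \<open>Balance of the terms in \<open>F\<close>: of the gain \<open>F / 2\<close>,
      one eighth of \<open>F\<close> is lost in \<open>\<Lambda> / 4\<close> and one eighth in the
      drift. The remaining \<open>F / 4\<close> is bounded by a multiple of \<open>K\<close>,
      against the choice of \<open>C\<close>.\<close>
    have "0 \<le> 4 * n * K - F / 2 + \<Lambda> / 4 + 2 * (n * B * (F * \<rho> + K))"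
      using eq[OF xS] eq[OF yS] tx ty tr' dx dy by linarith
    moreover have "F / 4 \<le> 4 * s + K / 2 + 2 * q"
      if "0 \<le> 4 * s - F / 2 + \<Lambda> / 4 + 2 * p" "2 * p \<le> F / 8 + 2 * q" for p q s :: real
      using that unfolding \<Lambda>_def by argo
    ultimately have "F / 4 \<le> 4 * n * K + K / 2 + 2 * (n * B * K)"
      using dF unfolding mult.assoc by blast
    moreover have "C / 4 > 4 * n * K + K / 2 + 2 * (n * B * K)" using K by (simp add: C_def algebra_simps)
    ultimately show False using FC by linarith
  qed
  \<comment> \<open>Taking the centre as the second point turns the maximum bound into a modulus of
    continuity at 0.\<close>
  moreover have "G w 0 \<le> G x y" using max[of w 0] w \<rho> by simp
  ultimately show ?thesis by (simp add: G_def C_def)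
qed

corollary elliptic_holder_estimate_abs:
  fixes v :: "real^'n::finite \<Rightarrow> real" and a :: "real^'n \<Rightarrow> 'n \<Rightarrow> 'n \<Rightarrow> real"
    and b :: "real^'n \<Rightarrow> 'n \<Rightarrow> real"
  defines "n \<equiv> real CARD('n)"
  assumes \<rho>: "0 < \<rho>" "2 * \<rho> \<le> 1" "16 * n * B * \<rho> \<le> 1" and "cball 0 \<rho> \<subseteq> S"
    and v: "\<And>z. z \<in> S \<Longrightarrow> (v has_derivative Dv z) (at z)"
    and Dv: "\<And>z w. z \<in> S \<Longrightarrow> ((\<lambda>z. Dv z w) has_derivative D2v z w) (at z)"
    and bil: "\<And>z. z \<in> S \<Longrightarrow> bilinear (D2v z)"
    and sym: "\<And>z k l. z \<in> S \<Longrightarrow> a z k l = a z l k"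
    and a: "\<And>z k l. z \<in> S \<Longrightarrow> \<bar>a z k l - (if k = l then 1 else 0)\<bar> \<le> \<theta>"
    and \<theta>: "0 \<le> \<theta>" "16 * n\<^sup>2 * \<theta> \<le> 1"
    and b: "\<And>z k. z \<in> S \<Longrightarrow> \<bar>b z k\<bar> \<le> B"
    and M: "\<And>z. z \<in> S \<Longrightarrow> \<bar>v z\<bar> \<le> M"
    and eq: "\<And>z. z \<in> S \<Longrightarrow> (\<Sum>k\<in>UNIV. \<Sum>l\<in>UNIV. a z k l * D2v z (axis k 1) (axis l 1))
        + (\<Sum>k\<in>UNIV. b z k * Dv z (axis k 1)) = 0"
    and w: "norm w \<le> \<rho>"
  defines "K \<equiv> (2 * M + 1) / \<rho>\<^sup>2"
  shows "\<bar>v w - v 0\<bar> \<le> (4 * K * (4 * n + 1 + 2 * n * B) + 1) * (w \<bullet> w) powr (1/4) + K * (w \<bullet> w)"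
proof -
  have "bilinear (\<lambda>w w'. - D2v z w w')" if "z \<in> S" for z
    using bil[OF that] by (auto simp: bilinear_def intro: linear_compose_neg)
  moreover have "(\<Sum>k\<in>UNIV. \<Sum>l\<in>UNIV. a z k l * - D2v z (axis k 1) (axis l 1))
        + (\<Sum>k\<in>UNIV. b z k * - Dv z (axis k 1)) = 0" if "z \<in> S" for z
    using eq[OF that] by (simp add: sum_negf)
  ultimately have "- v w - - v 0 \<le> (4 * K * (4 * n + 1 + 2 * n * B) + 1) * (w \<bullet> w) powr (1/4) + K * (w \<bullet> w)"
    unfolding K_def n_def
    using \<rho> \<open>cball 0 \<rho> \<subseteq> S\<close> v Dv sym a \<theta> b M w
    by (intro elliptic_holder_estimate[where v = "\<lambda>z. - v z" and Dv = "\<lambda>z w. - Dv z w"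
          and D2v = "\<lambda>z w w'. - D2v z w w'" and a = a and b = b and S = S and \<theta> = \<theta>])
      (auto intro: has_derivative_minus simp: n_def)
  moreover have "v w - v 0 \<le> (4 * K * (4 * n + 1 + 2 * n * B) + 1) * (w \<bullet> w) powr (1/4) + K * (w \<bullet> w)"
    unfolding K_def n_def
    by (rule elliptic_holder_estimate[OF assms(2-16)[unfolded n_def]])
  ultimately show ?thesis by linarith
qed

section \<open>The Laplacian in non-divergence form\<close>

text \<open>The derivative is an arbitrary witness whose continuity is tested in each direction
  separately. Product, chain and determinant rules then only have to exhibit a derivative, without
  the recursion over partial derivatives in \<open>Ck_on\<close>.\<close>

definition C1_on :: "(real^'n::finite \<Rightarrow> real) \<Rightarrow> (real^'n) set \<Rightarrow> bool" where
  "C1_on f S \<longleftrightarrow> (\<exists>f'. (\<forall>y\<in>S. (f has_derivative f' y) (at y)) \<and> (\<forall>h. continuous_on S (\<lambda>y. f' y h)))"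

lemma C1_onI:
  assumes "\<And>y. y \<in> S \<Longrightarrow> (f has_derivative f' y) (at y)" "\<And>h. continuous_on S (\<lambda>y. f' y h)"
  shows "C1_on f S"
  using assms unfolding C1_on_def by blast

lemma C1_onE:
  assumes "C1_on f S"
  obtains f' where "\<And>y. y \<in> S \<Longrightarrow> (f has_derivative f' y) (at y)" "\<And>h. continuous_on S (\<lambda>y. f' y h)"
  using assms unfolding C1_on_def by blast

lemma C1_on_imp_continuous_on: "C1_on f S \<Longrightarrow> continuous_on S f"
  by (metis C1_on_def continuous_at_imp_continuous_on has_derivative_continuous)

lemma partial_deriv_eq: "(f has_derivative f') (at y) \<Longrightarrow> partial_deriv i f y = f' (axis i 1)"
  unfolding partial_deriv_def by (metis frechet_derivative_at)

lemma C1_on_imp_differentiable: "C1_on f S \<Longrightarrow> y \<in> S \<Longrightarrow> f differentiable (at y)"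
  unfolding C1_on_def differentiable_def by blast

lemma C1_on_continuous_partial_deriv:
  assumes "C1_on f S"
  shows "continuous_on S (partial_deriv i f)"
proof -
  obtain f' where f': "\<And>y. y \<in> S \<Longrightarrow> (f has_derivative f' y) (at y)" "\<And>h. continuous_on S (\<lambda>y. f' y h)"
    using C1_onE[OF assms] by blast
  show ?thesis using f'(2)[of "axis i 1"] partial_deriv_eq[OF f'(1)]
    by (simp cong: continuous_on_cong)
qed

lemma C1_on_const: "C1_on (\<lambda>_. c) S"
  by (rule C1_onI[where f' = "\<lambda>_ _. 0"]) auto

lemma C1_on_add:
  assumes "C1_on f S" "C1_on g S"
  shows "C1_on (\<lambda>y. f y + g y) S"
proof -
  obtain f' where f': "\<And>y. y \<in> S \<Longrightarrow> (f has_derivative f' y) (at y)" "\<And>h. continuous_on S (\<lambda>y. f' y h)"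
    using C1_onE[OF assms(1)] by blast
  obtain g' where g': "\<And>y. y \<in> S \<Longrightarrow> (g has_derivative g' y) (at y)" "\<And>h. continuous_on S (\<lambda>y. g' y h)"
    using C1_onE[OF assms(2)] by blast
  show ?thesis
    by (rule C1_onI[where f' = "\<lambda>y h. f' y h + g' y h"]) (auto intro!: f' g' has_derivative_add continuous_intros)
qed

lemma C1_on_mult:
  assumes "C1_on f S" "C1_on g S"
  shows "C1_on (\<lambda>y. f y * g y) S"
proof -
  obtain f' where f': "\<And>y. y \<in> S \<Longrightarrow> (f has_derivative f' y) (at y)" "\<And>h. continuous_on S (\<lambda>y. f' y h)"
    using C1_onE[OF assms(1)] by blast
  obtain g' where g': "\<And>y. y \<in> S \<Longrightarrow> (g has_derivative g' y) (at y)" "\<And>h. continuous_on S (\<lambda>y. g' y h)"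
    using C1_onE[OF assms(2)] by blast
  show ?thesis
    by (rule C1_onI[where f' = "\<lambda>y h. f y * g' y h + f' y h * g y"])
      (auto intro!: f' g' has_derivative_mult continuous_intros C1_on_imp_continuous_on[OF assms(1)]
        C1_on_imp_continuous_on[OF assms(2)])
qed

lemma C1_on_compose:
  fixes \<psi> :: "real \<Rightarrow> real"
  assumes "C1_on f S" and \<psi>: "\<And>y. y \<in> S \<Longrightarrow> (\<psi> has_real_derivative \<psi>' (f y)) (at (f y))"
    and c: "continuous_on S (\<lambda>y. \<psi>' (f y))"
  shows "C1_on (\<lambda>y. \<psi> (f y)) S"
proof -
  obtain f' where f': "\<And>y. y \<in> S \<Longrightarrow> (f has_derivative f' y) (at y)" "\<And>h. continuous_on S (\<lambda>y. f' y h)"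
    using C1_onE[OF assms(1)] by blast
  show ?thesis
    by (rule C1_onI[where f' = "\<lambda>y h. \<psi>' (f y) * f' y h"])
      (auto intro!: continuous_intros c f' has_derivative_compose[OF f'(1) \<psi>[unfolded has_field_derivative_def]])
qed

lemma C1_on_sum:
  assumes "finite I" "\<And>i. i \<in> I \<Longrightarrow> C1_on (f i) S"
  shows "C1_on (\<lambda>y. \<Sum>i\<in>I. f i y) S"
  using assms by (induction I rule: finite_induct) (auto intro: C1_on_const C1_on_add)

lemma C1_on_prod:
  assumes "finite I" "\<And>i. i \<in> I \<Longrightarrow> C1_on (f i) S"
  shows "C1_on (\<lambda>y. \<Prod>i\<in>I. f i y) S"
  using assms by (induction I rule: finite_induct) (auto intro: C1_on_const C1_on_mult)

lemma C1_on_det: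
  fixes A :: "real^'m::finite \<Rightarrow> real^'n^'n"
  assumes "\<And>i j. C1_on (\<lambda>y. A y $ i $ j) S"
  shows "C1_on (\<lambda>y. det (A y)) S"
  unfolding det_def
  by (intro C1_on_sum C1_on_mult C1_on_const C1_on_prod assms) (auto simp: finite_permutations)

lemma C1_on_cong:
  assumes "open S" "C1_on f S" "\<And>y. y \<in> S \<Longrightarrow> f y = g y"
  shows "C1_on g S"
proof -
  obtain f' where f': "\<And>y. y \<in> S \<Longrightarrow> (f has_derivative f' y) (at y)" "\<And>h. continuous_on S (\<lambda>y. f' y h)"
    using C1_onE[OF assms(2)] by blast
  show ?thesis
    by (rule C1_onI[where f' = f']) (auto intro: has_derivative_transform_within_open[OF f'(1) assms(1)] assms f')
qed

lemma matrix_inv_det_nz: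
  fixes A :: "real^'n^'n"
  assumes "det A \<noteq> 0"
  shows "A ** matrix_inv A = mat 1" "matrix_inv A ** A = mat 1"
proof -
  have "\<exists>A'. A ** A' = mat 1 \<and> A' ** A = mat 1"
    using assms unfolding invertible_det_nz[symmetric] invertible_def .
  from someI_ex[OF this] show "A ** matrix_inv A = mat 1" "matrix_inv A ** A = mat 1"
    unfolding matrix_inv_def by blast+
qed

text \<open>By Cramer's rule every entry of the inverse is a quotient of two determinants, the
  numerator having its column \<open>i\<close> replaced by a unit vector.\<close>

lemma C1_on_matrix_inv:
  fixes A :: "real^'m::finite \<Rightarrow> real^'n^'n"
  assumes "open S" and A: "\<And>i j. C1_on (\<lambda>y. A y $ i $ j) S" and det: "\<And>y. y \<in> S \<Longrightarrow> det (A y) \<noteq> 0"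
  shows "C1_on (\<lambda>y. matrix_inv (A y) $ i $ j) S"
proof -
  define C where "C y = (\<chi> k l. if l = i then axis j 1 $ k else A y $ k $ l)" for y
  have "matrix_inv (A y) $ i $ j = det (C y) * inverse (det (A y))" if "y \<in> S" for y
  proof -
    have "A y *v (matrix_inv (A y) *v axis j 1) = axis j 1"
      using det[OF that] by (simp add: matrix_inv_det_nz matrix_vector_mul_assoc)
    then have "(matrix_inv (A y) *v axis j 1) $ i = det (C y) / det (A y)"
      using cramer[OF det[OF that]] by (simp add: C_def)
    then show ?thesis by (simp add: matrix_vector_mul_component inner_axis divide_inverse)
  qed
  moreover have "C1_on (\<lambda>y. det (C y)) S"
  proof (rule C1_on_det)
    show "C1_on (\<lambda>y. C y $ k $ l) S" for k l
      by (cases "l = i") (simp_all add: C_def C1_on_const A)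
  qed
  moreover have "C1_on (\<lambda>y. inverse (det (A y))) S"
  proof (rule C1_on_compose[where \<psi> = inverse and \<psi>' = "\<lambda>x. - (inverse x ^ Suc (Suc 0))"])
    show "C1_on (\<lambda>y. det (A y)) S" by (intro C1_on_det A)
    then show "continuous_on S (\<lambda>y. - (inverse (det (A y)) ^ Suc (Suc 0)))"
      using det by (intro continuous_intros C1_on_imp_continuous_on) auto
  qed (use det in \<open>blast intro: DERIV_inverse\<close>)
  ultimately show ?thesis
    using C1_on_cong[OF \<open>open S\<close> C1_on_mult[of "\<lambda>y. det (C y)" S "\<lambda>y. inverse (det (A y))"],
        of "\<lambda>y. matrix_inv (A y) $ i $ j"] by simp
qed

lemma frechet_derivative_axis_sum:
  fixes f :: "real^'n::finite \<Rightarrow> 'b::real_normed_vector"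
  assumes "f differentiable (at y)"
  shows "frechet_derivative f (at y) h = (\<Sum>i\<in>UNIV. h $ i *\<^sub>R partial_deriv i f y)"
proof -
  have l: "linear (frechet_derivative f (at y))" using assms by (rule linear_frechet_derivative)
  have "frechet_derivative f (at y) h = frechet_derivative f (at y) (\<Sum>k\<in>UNIV. h $ k *\<^sub>R axis k 1)"
    by (simp add: basis_expansion flip: scalar_mult_eq_scaleR)
  then show ?thesis by (simp add: linear_sum[OF l] linear_scale[OF l] partial_deriv_def)
qed

lemma Ck_on_1_component:
  fixes A :: "real^'m::finite \<Rightarrow> real^'n^'n"
  assumes "Ck_on 1 A S"
  shows "C1_on (\<lambda>y. A y $ i $ j) S"
proof (rule C1_onI)
  have *: "\<forall>y\<in>S. A differentiable (at y)" "\<And>i. continuous_on S (partial_deriv i A)" using assms by auto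
  show "((\<lambda>y. A y $ i $ j) has_derivative (\<lambda>h. frechet_derivative A (at y) h $ i $ j)) (at y)"
    if "y \<in> S" for y
    using * that frechet_derivative_works
    by (intro bounded_linear.has_derivative[OF bounded_linear_vec_nth]) auto
  show "continuous_on S (\<lambda>y. frechet_derivative A (at y) h $ i $ j)" for h
    using * by (auto simp: frechet_derivative_axis_sum intro!: continuous_intros cong: continuous_on_cong)
qed

text \<open>The product rule for the weighted inverse metric times the gradient. First derivatives
  of the metric end up in the drift coefficients, and the second-order part keeps the order of
  differentiation of the divergence form.\<close>

lemma coord_laplacian_expand:
  fixes g :: "real^'n::finite \<Rightarrow> real^'n^'n"
  assumes w: "\<And>i j. (\<lambda>z. sqrt (det (g z)) * matrix_inv (g z) $ i $ j) differentiable (at y)"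
    and u: "\<And>j. partial_deriv j u differentiable (at y)" and det: "det (g y) \<noteq> 0"
  shows "coord_laplacian g u y =
     (\<Sum>i\<in>UNIV. \<Sum>j\<in>UNIV. matrix_inv (g y) $ i $ j * partial_deriv i (partial_deriv j u) y)
   + (\<Sum>j\<in>UNIV. (\<Sum>i\<in>UNIV. partial_deriv i (\<lambda>z. sqrt (det (g z)) * matrix_inv (g z) $ i $ j) y)
        / sqrt (det (g y)) * partial_deriv j u y)"
proof -
  define W where "W i j z = sqrt (det (g z)) * matrix_inv (g z) $ i $ j" for i j z
  define s where "s = sqrt (det (g y))"
  have s: "s \<noteq> 0" using det by (simp add: s_def)
  have "partial_deriv i (\<lambda>z. sqrt (det (g z)) * (\<Sum>j\<in>UNIV. matrix_inv (g z) $ i $ j * partial_deriv j u z)) y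
      = (\<Sum>j\<in>UNIV. W i j y * partial_deriv i (partial_deriv j u) y + partial_deriv i (W i j) y * partial_deriv j u y)" for i
  proof -
    have "((\<lambda>z. \<Sum>j\<in>UNIV. W i j z * partial_deriv j u z) has_derivative
      (\<lambda>h. \<Sum>j\<in>UNIV. W i j y * frechet_derivative (partial_deriv j u) (at y) h
           + frechet_derivative (W i j) (at y) h * partial_deriv j u y)) (at y)"
      using w u by (intro has_derivative_sum has_derivative_mult) (simp_all add: frechet_derivative_works W_def[abs_def])
    from partial_deriv_eq[OF this, of i] show ?thesis
      by (simp add: W_def sum_distrib_left partial_deriv_def mult.assoc)
  qed
  then have "coord_laplacian g u y = (\<Sum>i\<in>UNIV. \<Sum>j\<in>UNIV. W i j y * partial_deriv i (partial_deriv j u) y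
     + partial_deriv i (W i j) y * partial_deriv j u y) / s"
    by (simp add: coord_laplacian_def s_def)
  also have "\<dots> = (\<Sum>i\<in>UNIV. \<Sum>j\<in>UNIV. matrix_inv (g y) $ i $ j * partial_deriv i (partial_deriv j u) y
     + partial_deriv i (W i j) y / s * partial_deriv j u y)"
    unfolding sum_divide_distrib using s by (intro sum.cong refl) (simp add: W_def add_divide_distrib flip: s_def)
  also have "\<dots> = (\<Sum>i\<in>UNIV. \<Sum>j\<in>UNIV. matrix_inv (g y) $ i $ j * partial_deriv i (partial_deriv j u) y)
     + (\<Sum>i\<in>UNIV. \<Sum>j\<in>UNIV. partial_deriv i (W i j) y / s * partial_deriv j u y)"
    by (simp add: sum.distrib)
  also have "(\<Sum>i\<in>UNIV. \<Sum>j\<in>UNIV. partial_deriv i (W i j) y / s * partial_deriv j u y)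
     = (\<Sum>j\<in>UNIV. (\<Sum>i\<in>UNIV. partial_deriv i (W i j) y) / s * partial_deriv j u y)"
    by (subst sum.swap) (simp add: sum_divide_distrib sum_distrib_right)
  finally show ?thesis by (simp add: W_def[abs_def] s_def)
qed

section \<open>Equicontinuity of bounded harmonic functions\<close>

text \<open>Gram-Schmidt orthonormalization for the inner product given by \<open>g\<close>.\<close>

lemma positive_definite_factorization:
  fixes g :: "real^'n::finite^'n"
  assumes sym: "transpose g = g" and pos: "\<And>v. v \<noteq> 0 \<Longrightarrow> v \<bullet> (g *v v) > 0"
  shows "\<exists>B :: real^'n^'n. transpose B ** g ** B = mat 1"
proof -
  define \<beta> where "\<beta> v w = v \<bullet> (g *v w)" for v w
  have bil: "bilinear \<beta>"
    unfolding bilinear_def \<beta>_def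
    by (auto intro!: linearI simp: inner_add_left inner_add_right matrix_vector_right_distrib matrix_vector_mult_scaleR)
  have \<beta>_sym: "\<beta> v w = \<beta> w v" for v w
    by (metis \<beta>_def dot_lmul_matrix inner_commute sym transpose_matrix_vector)
  note bl = bilinear_lsub[OF bil] bilinear_rsub[OF bil] bilinear_lmul[OF bil] bilinear_rmul[OF bil]
  have "\<exists>e. \<forall>i\<in>I. \<forall>j\<in>I. \<beta> (e i) (e j) = (if i = j then 1 else 0)" for I :: "'n set"
  proof (induction I rule: finite_induct[OF finite])
    case (2 a I)
    then obtain e where e: "\<And>i j. i \<in> I \<Longrightarrow> j \<in> I \<Longrightarrow> \<beta> (e i) (e j) = (if i = j then 1 else 0)" by blast
    \<comment> \<open>Fewer vectors than the dimension do not span, so there is a vector to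
      orthogonalize against those already found.\<close>
    have "dim (span (e ` I)) \<le> card I"
      by (metis 2(1) card_image_le dim_le_card' dim_span finite_imageI order_trans)
    also have "card I < CARD('n)" using 2(2) by (intro psubset_card_mono) auto
    finally have "span (e ` I) \<noteq> UNIV" by (metis DIM_cart DIM_real dim_UNIV mult.right_neutral nat_neq_iff)
    then obtain v where v: "v \<notin> span (e ` I)" by blast
    define v' where "v' = v - (\<Sum>i\<in>I. \<beta> (e i) v *\<^sub>R e i)"
    have "(\<Sum>i\<in>I. \<beta> (e i) v *\<^sub>R e i) \<in> span (e ` I)" by (intro span_sum span_scale span_base) auto
    then have "v' \<noteq> 0" using v by (auto simp: v'_def)
    then have p: "\<beta> v' v' > 0" using pos by (simp add: \<beta>_def)
    have orth: "\<beta> (e j) v' = 0" if "j \<in> I" for j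
    proof -
      have "\<beta> (e j) (\<Sum>i\<in>I. \<beta> (e i) v *\<^sub>R e i) = (\<Sum>i\<in>I. \<beta> (e i) v * \<beta> (e j) (e i))"
        using bil unfolding bilinear_def by (simp add: linear_sum linear_scale)
      also have "\<dots> = (\<Sum>i\<in>I. if i = j then \<beta> (e j) v else 0)"
        by (rule sum.cong) (auto simp: e that)
      finally show ?thesis using that 2(1) by (simp add: v'_def bl)
    qed
    have orth': "\<beta> v' (e j) = 0" if "j \<in> I" for j using orth[OF that] \<beta>_sym by simp
    define e' where "e' = e(a := (1 / sqrt (\<beta> v' v')) *\<^sub>R v')"
    have "\<beta> (e' i) (e' j) = (if i = j then 1 else 0)" if "i \<in> insert a I" "j \<in> insert a I" for i j
      using that 2(2) p by (auto simp: e'_def e bl orth orth')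
    then show ?case by blast
  qed auto
  from this[of UNIV] obtain e :: "'n \<Rightarrow> real^'n" where e: "\<And>i j. \<beta> (e i) (e j) = (if i = j then 1 else 0)" by blast
  define B :: "real^'n^'n" where "B = (\<chi> i j. e j $ i)"
  have "(transpose B ** g ** B) $ k $ l = \<beta> (e k) (e l)" for k l
  proof -
    have "(transpose B ** g ** B) $ k $ l = (transpose B ** (g ** B)) $ k $ l" by (simp add: matrix_mul_assoc)
    also have "\<dots> = \<beta> (e k) (e l)"
      by (simp add: \<beta>_def B_def matrix_matrix_mult_def transpose_def inner_vec_def matrix_vector_mult_def)
    finally show ?thesis .
  qed
  then have "transpose B ** g ** B = mat 1" by (simp add: vec_eq_iff e mat_def)
  then show ?thesis by blast
qed

text \<open>The linear substitution \<open>B\<close> transforms the Hessian by \<open>B\<close> and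
  the coefficient matrix by the inverse \<open>C\<close>, so their contraction is unchanged.\<close>

lemma bilinear_congruence_sum:
  fixes \<beta> :: "real^'n \<Rightarrow> real^'n \<Rightarrow> real" and A B C :: "real^'n^'n::finite"
  assumes bil: "bilinear \<beta>" and BC: "B ** C = mat 1"
  shows "(\<Sum>k\<in>UNIV. \<Sum>l\<in>UNIV. (C ** A ** transpose C) $ k $ l * \<beta> (B *v axis k 1) (B *v axis l 1))
       = (\<Sum>i\<in>UNIV. \<Sum>j\<in>UNIV. A $ i $ j * \<beta> (axis i 1) (axis j 1))"
proof -
  have lB: "(\<Sum>k\<in>UNIV. x $ k * f (B *v axis k 1)) = f (B *v x)" if "linear f" for f :: "real^'n \<Rightarrow> real" and x
    using sum_axis_inner[of "\<lambda>x. f (B *v x)" x] that by (simp add: linear_compose[unfolded o_def])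
  have l: "linear (\<lambda>x. \<beta> x y)" "linear (\<beta> y)" for y using bil by (auto simp: bilinear_def)
  have row: "B *v ((C ** A ** transpose C) $ k) = (C ** A) $ k" for k
  proof -
    have "B *v ((C ** A ** transpose C) $ k) = ((C ** A ** transpose C) ** transpose B) $ k"
      by (simp add: matrix_matrix_mult_def matrix_vector_mult_def transpose_def vec_eq_iff mult.commute)
    also have "(C ** A ** transpose C) ** transpose B = C ** A"
      by (metis BC matrix_mul_assoc matrix_mul_rid matrix_transpose_mul transpose_mat)
    finally show ?thesis .
  qed
  have col: "B *v (\<chi> k. (C ** A) $ k $ j) = (\<chi> i. A $ i $ j)" for j
  proof -
    have "B *v (\<chi> k. (C ** A) $ k $ j) = (\<chi> i. (B ** (C ** A)) $ i $ j)"
      by (simp add: matrix_matrix_mult_def matrix_vector_mult_def vec_eq_iff)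
    then show ?thesis by (simp add: matrix_mul_assoc BC)
  qed
  have "(\<Sum>k\<in>UNIV. \<Sum>l\<in>UNIV. (C ** A ** transpose C) $ k $ l * \<beta> (B *v axis k 1) (B *v axis l 1))
      = (\<Sum>k\<in>UNIV. \<beta> (B *v axis k 1) ((C ** A) $ k))"
    by (simp add: lB[OF l(2)] row)
  also have "\<dots> = (\<Sum>k\<in>UNIV. \<Sum>j\<in>UNIV. (C ** A) $ k $ j * \<beta> (B *v axis k 1) (axis j 1))"
    by (simp add: sum_axis_inner[OF l(2)])
  also have "\<dots> = (\<Sum>j\<in>UNIV. \<Sum>k\<in>UNIV. (\<chi> k. (C ** A) $ k $ j) $ k * \<beta> (B *v axis k 1) (axis j 1))"
    by (subst sum.swap) simp
  also have "\<dots> = (\<Sum>j\<in>UNIV. \<beta> (\<chi> i. A $ i $ j) (axis j 1))"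
    by (simp only: lB[OF l(1)] col)
  also have "\<dots> = (\<Sum>j\<in>UNIV. \<Sum>i\<in>UNIV. (\<chi> i. A $ i $ j) $ i * \<beta> (axis i 1) (axis j 1))"
    by (simp only: sum_axis_inner[OF l(1)])
  also have "\<dots> = (\<Sum>i\<in>UNIV. \<Sum>j\<in>UNIV. A $ i $ j * \<beta> (axis i 1) (axis j 1))"
    by (subst sum.swap) simp
  finally show ?thesis .
qed

lemma small_modulus:
  fixes C K e :: real
  assumes "0 < e"
  shows "\<exists>d>0. \<forall>w::'a::real_inner. norm w < d \<longrightarrow> C * (w \<bullet> w) powr (1/4) + K * (w \<bullet> w) < e"
proof -
  have "continuous_on UNIV (\<lambda>w::'a. C * (w \<bullet> w) powr (1/4) + K * (w \<bullet> w))"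
    by (intro continuous_intros continuous_on_powr') auto
  then have "open {w::'a. C * (w \<bullet> w) powr (1/4) + K * (w \<bullet> w) < e}"
    by (intro open_Collect_less continuous_on_const)
  moreover have "0 \<in> {w::'a. C * (w \<bullet> w) powr (1/4) + K * (w \<bullet> w) < e}" using assms by simp
  ultimately obtain d where "d > 0" "ball 0 d \<subseteq> {w::'a. C * (w \<bullet> w) powr (1/4) + K * (w \<bullet> w) < e}"
    using open_contains_ball by blast
  then show ?thesis by (intro exI[of _ d]) (auto simp: subset_iff)
qed

text \<open>The neighbourhood is chosen before \<open>u\<close> and depends only on the metric,
  \<open>M\<close> and \<epsilon>. In affine coordinates in which the metric at \<open>y0\<close> is
  the identity, the coefficients near \<open>y0\<close> satisfy the smallness conditions of the
  Hoelder estimate, whose constants do not involve \<open>u\<close>.\<close>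

lemma harmonic_equicontinuous_coordinates:
  fixes g :: "real^'n::finite \<Rightarrow> real^'n^'n"
  assumes "open U" "y0 \<in> U" and g1: "Ck_on 1 g U"
    and sym: "\<And>y. y \<in> U \<Longrightarrow> transpose (g y) = g y"
    and pos: "\<And>y v. y \<in> U \<Longrightarrow> v \<noteq> 0 \<Longrightarrow> v \<bullet> (g y *v v) > 0"
    and "0 < \<epsilon>"
  shows "\<exists>V. open V \<and> y0 \<in> V \<and> V \<subseteq> U \<and> (\<forall>u. Ck_on 2 u U \<and> (\<forall>y\<in>U. coord_laplacian g u y = 0) \<and>
    (\<forall>y\<in>U. \<bar>u y\<bar> \<le> M) \<longrightarrow> (\<forall>y\<in>V. \<bar>u y - u y0\<bar> < \<epsilon>))"
proof -
  define G where "G y = matrix_inv (g y)" for y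
  define W where "W i j y = sqrt (det (g y)) * G y $ i $ j" for i j y
  define b where "b j y = (\<Sum>i\<in>UNIV. partial_deriv i (W i j) y) / sqrt (det (g y))" for j y
  \<comment> \<open>Determinants in the factorization give
    \<open>(det B)\<^sup>2 * det (g y) = 1\<close>.\<close>
  have det: "det (g y) > 0" if yU: "y \<in> U" for y
  proof -
    have "\<exists>B :: real^'n^'n. transpose B ** g y ** B = mat 1"
      by (rule positive_definite_factorization) (simp_all add: sym pos yU)
    then obtain B :: "real^'n^'n" where "transpose B ** g y ** B = mat 1" by blast
    then have "det (transpose B ** g y ** B) = 1" by simp
    then have "(det B)\<^sup>2 * det (g y) = 1" by (simp add: det_mul det_transpose power2_eq_square algebra_simps)
    then have "0 < (det B)\<^sup>2 * det (g y)" by simp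
    then show ?thesis by (simp add: zero_less_mult_iff)
  qed
  have gC: "C1_on (\<lambda>y. g y $ i $ j) U" for i j using g1 by (rule Ck_on_1_component)
  have GC: "C1_on (\<lambda>y. G y $ i $ j) U" for i j
    unfolding G_def
  proof (rule C1_on_matrix_inv[OF \<open>open U\<close> gC])
    show "det (g y) \<noteq> 0" if "y \<in> U" for y using det[OF that] by simp
  qed
  have dC: "C1_on (\<lambda>y. det (g y)) U" by (intro C1_on_det gC)
  have sC: "C1_on (\<lambda>y. sqrt (det (g y))) U"
  proof (rule C1_on_compose[where \<psi>' = "\<lambda>x. inverse (sqrt x) / 2", OF dC])
    show "(sqrt has_real_derivative inverse (sqrt (det (g y))) / 2) (at (det (g y)))" if "y \<in> U" for y
      using DERIV_real_sqrt[OF det[OF that]] .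
    show "continuous_on U (\<lambda>y. inverse (sqrt (det (g y))) / 2)"
    proof (intro continuous_intros C1_on_imp_continuous_on[OF dC] ballI)
      show "sqrt (det (g y)) \<noteq> 0" if "y \<in> U" for y using det[OF that] by simp
    qed auto
  qed
  have WC: "C1_on (W i j) U" for i j unfolding W_def[abs_def] by (intro C1_on_mult sC GC)
  have bC: "continuous_on U (b j)" for j
    unfolding b_def[abs_def]
  proof (intro continuous_intros C1_on_continuous_partial_deriv WC C1_on_imp_continuous_on[OF dC] ballI)
    show "sqrt (det (g y)) \<noteq> 0" if "y \<in> U" for y using det[OF that] by simp
  qed
  have "\<exists>B :: real^'n^'n. transpose B ** g y0 ** B = mat 1"
    by (rule positive_definite_factorization) (simp_all add: sym pos \<open>y0 \<in> U\<close>)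
  then obtain B :: "real^'n^'n" where B: "transpose B ** g y0 ** B = mat 1" by blast
  \<comment> \<open>The factorization says that this is the inverse of \<open>B\<close>. In this
    form \<open>C ** G y0\<close> is \<open>transpose B\<close>, so that the transformed
    coefficients at the centre are the transpose of \<open>C ** B\<close>, the identity.\<close>
  define C where "C = transpose B ** g y0"
  have CB: "C ** B = mat 1" using B by (simp add: C_def)
  then have BC: "B ** C = mat 1" by (metis matrix_left_right_inverse)
  define a where "a z k l = (C ** G (y0 + B *v z) ** transpose C) $ k $ l" for z k l
  define b' where "b' z k = (\<Sum>j\<in>UNIV. C $ k $ j * b j (y0 + B *v z))" for z k
  define T where "T z = y0 + B *v z" for z
  have T0: "T 0 = y0" by (simp add: T_def)
  have Tc: "continuous_on A T" for A unfolding T_def[abs_def] by (intro continuous_intros)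
  define S0 where "S0 = T -` U"
  have S0: "open S0" "0 \<in> S0" unfolding S0_def using open_vimage[OF \<open>open U\<close> Tc] T0 \<open>y0 \<in> U\<close> by auto
  have GT: "continuous_on S0 (\<lambda>z. G (T z) $ i $ j)" for i j
    by (rule continuous_on_compose2[OF C1_on_imp_continuous_on[OF GC] Tc]) (auto simp: S0_def)
  have bT: "continuous_on S0 (\<lambda>z. b j (T z))" for j
    by (rule continuous_on_compose2[OF bC Tc]) (auto simp: S0_def)
  have ac: "continuous_on S0 (\<lambda>z. a z k l)" for k l
    unfolding a_def by (simp add: matrix_matrix_mult_def) (intro continuous_intros GT[unfolded T_def])
  have bc: "continuous_on S0 (\<lambda>z. b' z k)" for k
    unfolding b'_def by (intro continuous_intros bT[unfolded T_def])
  have a0: "a 0 k l = (if k = l then 1 else 0)" for k l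
  proof -
    have "det (g y0) \<noteq> 0" using det[OF \<open>y0 \<in> U\<close>] by simp
    then have "C ** G y0 = transpose B"
      unfolding C_def G_def by (simp add: matrix_inv_det_nz flip: matrix_mul_assoc)
    then have "C ** G y0 ** transpose C = transpose (C ** B)" by (simp add: matrix_transpose_mul)
    also have "\<dots> = mat 1" unfolding CB by (rule transpose_mat)
    finally have "C ** G y0 ** transpose C = mat 1" .
    then show ?thesis by (simp add: a_def) (simp add: mat_def)
  qed
  define n where "n = real CARD('n)"
  have n: "n \<ge> 1" by (simp add: n_def Suc_leI)
  \<comment> \<open>The largest deviation from the identity that the Hoelder estimate
    admits.\<close>
  define \<theta> where "\<theta> = 1 / (16 * n\<^sup>2)"
  have \<theta>: "\<theta> > 0" "16 * n\<^sup>2 * \<theta> \<le> 1" using n by (auto simp: \<theta>_def)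
  \<comment> \<open>The additional 1 makes the bound strict at the centre, so by continuity it
    persists nearby.\<close>
  define Bd where "Bd = 1 + Max (range (\<lambda>k. \<bar>b' 0 k\<bar>))"
  have Bd: "\<bar>b' 0 k\<bar> < Bd" for k
    unfolding Bd_def by (smt (verit) Max_ge finite_class.finite_UNIV finite_imageI rangeI)
  then have Bd0: "Bd > 0" by (meson abs_ge_zero le_less_trans)
  define S where "S = S0 \<inter> (\<Inter>k. \<Inter>l. {z\<in>S0. \<bar>a z k l - (if k = l then 1 else 0)\<bar> < \<theta>}) \<inter> (\<Inter>k. {z\<in>S0. \<bar>b' z k\<bar> < Bd})"
  have opn: "open {z\<in>S0. f z < c}" if "continuous_on S0 f" for f :: "_ \<Rightarrow> real" and c
    using continuous_on_open_vimage[OF S0(1), THEN iffD1, OF that, rule_format, of "{..<c}"]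
    by (simp add: vimage_def Int_def conj_commute)
  have "open S" unfolding S_def
    by (intro open_Int open_INT S0 finite ballI opn continuous_intros ac bc)
  moreover have "0 \<in> S" using S0 \<theta> Bd by (auto simp: S_def a0)
  ultimately obtain r where r: "r > 0" "cball 0 r \<subseteq> S" using open_contains_cball by blast
  \<comment> \<open>Three demands: the ball lies where the coefficient bounds hold, its diameter is
    at most 1, and the drift can be absorbed.\<close>
  define \<rho> where "\<rho> = min r (min (1/2) (1 / (16 * n * Bd)))"
  have nB: "n * Bd > 0" using n Bd0 by simp
  have \<rho>: "0 < \<rho>" "2 * \<rho> \<le> 1" "16 * n * Bd * \<rho> \<le> 1"
  proof -
    have c: "16 * n * Bd > 0" using nB by (simp add: mult.assoc)
    then have "1 / (16 * n * Bd) > 0" by simp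
    then show "0 < \<rho>" "2 * \<rho> \<le> 1" using r by (auto simp: \<rho>_def)
    have "\<rho> \<le> 1 / (16 * n * Bd)" by (simp add: \<rho>_def)
    then have "\<rho> * (16 * n * Bd) \<le> 1" using pos_le_divide_eq[OF c] by blast
    then show "16 * n * Bd * \<rho> \<le> 1" by (simp only: mult.commute)
  qed
  have \<rho>S: "cball 0 \<rho> \<subseteq> S" using r(2) by (auto simp: \<rho>_def)
  define K where "K = (2 * M + 1) / \<rho>\<^sup>2"
  obtain d where d: "d > 0" and dd: "\<And>w::real^'n. norm w < d \<Longrightarrow>
     (4 * K * (4 * n + 1 + 2 * n * Bd) + 1) * (w \<bullet> w) powr (1/4) + K * (w \<bullet> w) < \<epsilon>"
    using small_modulus[OF \<open>0 < \<epsilon>\<close>] by metis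
  \<comment> \<open>\<open>C *v (y - y0)\<close> inverts the affine map \<open>T\<close>, so this is
    the part of \<open>U\<close> that corresponds to a small ball about 0.\<close>
  define V where "V = {y \<in> U. norm (C *v (y - y0)) < min d \<rho>}"
  have "open {y. norm (C *v (y - y0)) < min d \<rho>}"
    by (intro open_Collect_less continuous_on_norm continuous_on_const
        continuous_on_compose2[OF linear_continuous_on[OF matrix_vector_mul_bounded_linear], where f = "\<lambda>y. y - y0" and t = UNIV]
        continuous_on_diff continuous_on_id) auto
  then have "open V" unfolding V_def Collect_conj_eq using \<open>open U\<close> by (auto intro: open_Int)
  moreover have "y0 \<in> V" using \<open>y0 \<in> U\<close> d \<rho> by (simp add: V_def)
  moreover have "\<bar>u y - u y0\<bar> < \<epsilon>"
    if u: "Ck_on 2 u U" "\<And>y. y \<in> U \<Longrightarrow> coord_laplacian g u y = 0" "\<And>y. y \<in> U \<Longrightarrow> \<bar>u y\<bar> \<le> M" and y: "y \<in> V"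
    for u y
  proof -
    have u1: "u differentiable (at y)" "partial_deriv i u differentiable (at y)" if "y \<in> U" for i y
      using u(1) that by (auto simp: numeral_2_eq_2)
    define Dv where "Dv z w = (\<Sum>i\<in>UNIV. (B *v w) $ i * partial_deriv i u (T z))" for z w
    define H where "H y w w' = (\<Sum>i\<in>UNIV. w $ i * frechet_derivative (partial_deriv i u) (at y) w')" for y w w'
    have Tder: "(T has_derivative (\<lambda>h. B *v h)) (at z)" for z
      unfolding T_def[abs_def]
      by (auto intro!: derivative_eq_intros bounded_linear.has_derivative[OF matrix_vector_mul_bounded_linear])
    have TU: "T z \<in> U" if "z \<in> S" for z using that by (auto simp: S_def S0_def)
    have v: "((\<lambda>z. u (T z)) has_derivative Dv z) (at z)" if "z \<in> S" for z
    proof -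
      have "((\<lambda>z. u (T z)) has_derivative (\<lambda>h. frechet_derivative u (at (T z)) (B *v h))) (at z)"
        using u1(1)[OF TU[OF that]] unfolding frechet_derivative_works
        by (rule has_derivative_compose[OF Tder])
      then show ?thesis by (simp add: Dv_def[abs_def] frechet_derivative_axis_sum[OF u1(1)[OF TU[OF that]]])
    qed
    have Dv: "((\<lambda>z. Dv z w) has_derivative (\<lambda>w'. H (T z) (B *v w) (B *v w'))) (at z)" if "z \<in> S" for z w
      unfolding Dv_def H_def
      by (intro has_derivative_sum has_derivative_mult_right has_derivative_compose[OF Tder])
         (use u1(2)[OF TU[OF that]] in \<open>simp add: frechet_derivative_works\<close>)
    have Hbil: "bilinear (H y)" if "y \<in> U" for y
    proof -
      have l: "linear (frechet_derivative (partial_deriv i u) (at y))" for i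
        using u1(2)[OF that] by (rule linear_frechet_derivative)
      show ?thesis unfolding bilinear_def H_def
        by (auto intro!: linearI simp: linear_add[OF l] linear_scale[OF l] sum.distrib sum_distrib_left algebra_simps)
    qed
    have H_axis: "H y (axis i 1) w' = frechet_derivative (partial_deriv i u) (at y) w'" for y i w'
    proof -
      have "H y (axis i 1) w' = (\<Sum>k\<in>UNIV. if k = i then frechet_derivative (partial_deriv k u) (at y) w' else 0)"
        unfolding H_def by (rule sum.cong) (auto simp: axis_def)
      then show ?thesis by simp
    qed
    have bil: "bilinear (\<lambda>w w'. H (T z) (B *v w) (B *v w'))" if "z \<in> S" for z
    proof -
      have "linear (\<lambda>w. H (T z) (B *v w) y)" "linear (\<lambda>w. H (T z) y (B *v w))" for y
        using Hbil[OF TU[OF that]] unfolding bilinear_def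
        by (auto intro: linear_compose[OF matrix_vector_mul_linear, unfolded o_def])
      then show ?thesis by (simp add: bilinear_def)
    qed
    have Gsym: "transpose (G y) = G y" if "y \<in> U" for y
    proof -
      have nz: "det (g y) \<noteq> 0" using det[OF that] by simp
      have "transpose (G y) ** g y = mat 1"
        by (metis G_def matrix_inv_det_nz(1)[OF nz] matrix_transpose_mul sym[OF that] transpose_mat)
      then show ?thesis
        by (metis G_def matrix_inv_det_nz(1)[OF nz] matrix_mul_assoc matrix_mul_lid matrix_mul_rid)
    qed
    have asym: "a z k l = a z l k" if "z \<in> S" for z k l
    proof -
      have "transpose (C ** G (T z) ** transpose C) = C ** G (T z) ** transpose C"
        by (simp add: matrix_transpose_mul Gsym[OF TU[OF that]] matrix_mul_assoc)
      then have "transpose (C ** G (T z) ** transpose C) $ l $ k = (C ** G (T z) ** transpose C) $ l $ k" by simp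
      then show ?thesis by (simp add: a_def T_def transpose_def)
    qed
    have eq: "(\<Sum>k\<in>UNIV. \<Sum>l\<in>UNIV. a z k l * H (T z) (B *v axis k 1) (B *v axis l 1))
        + (\<Sum>k\<in>UNIV. b' z k * Dv z (axis k 1)) = 0" if "z \<in> S" for z
    proof -
      let ?y = "T z"
      have yU: "?y \<in> U" using TU[OF that] .
      have "(\<Sum>k\<in>UNIV. \<Sum>l\<in>UNIV. a z k l * H ?y (B *v axis k 1) (B *v axis l 1))
        = (\<Sum>i\<in>UNIV. \<Sum>j\<in>UNIV. G ?y $ i $ j * H ?y (axis i 1) (axis j 1))"
        unfolding a_def T_def[symmetric] by (rule bilinear_congruence_sum[OF Hbil[OF yU] BC])
      also have "\<dots> = (\<Sum>i\<in>UNIV. \<Sum>j\<in>UNIV. G ?y $ i $ j * partial_deriv j (partial_deriv i u) ?y)"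
        by (simp add: H_axis partial_deriv_def)
      \<comment> \<open>\<open>H\<close> takes the two derivatives in the opposite order to the
        Laplacian. Symmetry of \<open>G\<close> and a renaming of the indices reconcile them,
        without interchanging mixed partial derivatives.\<close>
      also have "\<dots> = (\<Sum>i\<in>UNIV. \<Sum>j\<in>UNIV. G ?y $ j $ i * partial_deriv j (partial_deriv i u) ?y)"
      proof (intro sum.cong refl)
        fix i j
        have "transpose (G ?y) $ j $ i = G ?y $ j $ i" by (simp only: Gsym[OF yU])
        then show "G ?y $ i $ j * partial_deriv j (partial_deriv i u) ?y = G ?y $ j $ i * partial_deriv j (partial_deriv i u) ?y"
          by (simp add: transpose_def)
      qed
      also have "\<dots> = (\<Sum>i\<in>UNIV. \<Sum>j\<in>UNIV. G ?y $ i $ j * partial_deriv i (partial_deriv j u) ?y)"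
        by (rule sum.swap)
      finally have 1: "(\<Sum>k\<in>UNIV. \<Sum>l\<in>UNIV. a z k l * H ?y (B *v axis k 1) (B *v axis l 1))
         = (\<Sum>i\<in>UNIV. \<Sum>j\<in>UNIV. G ?y $ i $ j * partial_deriv i (partial_deriv j u) ?y)" .
      \<comment> \<open>The drift term is the derivative of the transformed function along the
        vector of drift coefficients, and \<open>B\<close> carries this vector back to the original
        one.\<close>
      define \<beta>1 where "\<beta>1 = (\<chi> k. b' z k)"
      define bv where "bv = (\<chi> j. b j ?y)"
      have "\<beta>1 = C *v bv" by (simp add: \<beta>1_def bv_def b'_def T_def matrix_vector_mult_def)
      then have Bb: "B *v \<beta>1 = bv" by (simp add: matrix_vector_mul_assoc BC)
      have lin: "linear (Dv z)" using v[OF that] by (rule has_derivative_linear)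
      have "(\<Sum>k\<in>UNIV. b' z k * Dv z (axis k 1)) = Dv z \<beta>1"
        using sum_axis_inner[OF lin, of \<beta>1] by (simp add: \<beta>1_def)
      also have "\<dots> = (\<Sum>j\<in>UNIV. b j ?y * partial_deriv j u ?y)"
        by (simp add: Dv_def Bb) (simp add: bv_def)
      finally have 2: "(\<Sum>k\<in>UNIV. b' z k * Dv z (axis k 1)) = (\<Sum>j\<in>UNIV. b j ?y * partial_deriv j u ?y)" .
      have nz: "det (g ?y) \<noteq> 0" using det[OF yU] by simp
      have "coord_laplacian g u ?y =
         (\<Sum>i\<in>UNIV. \<Sum>j\<in>UNIV. G ?y $ i $ j * partial_deriv i (partial_deriv j u) ?y)
          + (\<Sum>j\<in>UNIV. b j ?y * partial_deriv j u ?y)"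
        unfolding b_def W_def[abs_def] G_def
        using C1_on_imp_differentiable[OF WC yU] u1(2)[OF yU]
        by (intro coord_laplacian_expand nz) (simp_all add: W_def[abs_def] G_def)
      then show ?thesis using u(2)[OF yU] 1 2 by simp
    qed
    define w where "w = C *v (y - y0)"
    have Tw: "T w = y" by (simp add: T_def w_def matrix_vector_mul_assoc BC)
    have w: "norm w < d" "norm w \<le> \<rho>" using y by (auto simp: V_def w_def)
    have "\<bar>u (T w) - u (T 0)\<bar> \<le> (4 * K * (4 * n + 1 + 2 * n * Bd) + 1) * (w \<bullet> w) powr (1/4) + K * (w \<bullet> w)"
      unfolding K_def n_def
    proof (rule elliptic_holder_estimate_abs[where v = "\<lambda>z. u (T z)" and Dv = Dv
          and D2v = "\<lambda>z w w'. H (T z) (B *v w) (B *v w')" and a = a and b = b' and S = S and \<theta> = \<theta>])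
      show "\<bar>a z k l - (if k = l then 1 else 0)\<bar> \<le> \<theta>" if "z \<in> S" for z k l
        using that unfolding S_def by (blast intro: less_imp_le)
      show "\<bar>b' z k\<bar> \<le> Bd" if "z \<in> S" for z k
        using that unfolding S_def by (blast intro: less_imp_le)
      show "\<bar>u (T z)\<bar> \<le> M" if "z \<in> S" for z using u(3) TU[OF that] .
    qed (use \<rho> \<rho>S v Dv bil asym \<theta> eq w in \<open>auto simp: n_def\<close>)
    then show ?thesis using dd[OF w(1)] by (simp add: Tw T0)
  qed
  ultimately show ?thesis by (intro exI[of _ V]) (auto simp: V_def)
qed

section \<open>Locality of harmonicity\<close>

text \<open>\<open>frechet_derivative\<close> is a choice from the set of all derivatives. Functions
  that agree near the point have the same such set, so the chosen values agree even where it is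
  empty.\<close>

lemma partial_deriv_cong:
  assumes "open S" "y \<in> S" "\<And>z. z \<in> S \<Longrightarrow> f z = g z"
  shows "partial_deriv i f y = partial_deriv i g y"
proof -
  have "(f has_derivative f') (at y) \<longleftrightarrow> (g has_derivative f') (at y)" for f'
    using assms by (metis has_derivative_transform_within_open)
  then show ?thesis by (simp add: partial_deriv_def frechet_derivative_def)
qed

lemma Ck_on_cong:
  assumes "open S" "\<And>z. z \<in> S \<Longrightarrow> f z = g z"
  shows "Ck_on k f S \<longleftrightarrow> Ck_on k g S"
  using assms(2)
proof (induction k arbitrary: f g)
  case 0
  then show ?case by (simp cong: continuous_on_cong)
next
  case (Suc k)
  have "f differentiable (at y) \<longleftrightarrow> g differentiable (at y)" if "y \<in> S" for y
    unfolding differentiable_def using that assms(1) Suc.prems by (metis has_derivative_transform_within_open)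
  moreover have "Ck_on k (partial_deriv i f) S \<longleftrightarrow> Ck_on k (partial_deriv i g) S" for i
    by (intro Suc.IH partial_deriv_cong[OF assms(1)] Suc.prems)
  ultimately show ?case by simp
qed

lemma Ck_on_subset: "Ck_on k f S \<Longrightarrow> T \<subseteq> S \<Longrightarrow> Ck_on k f T"
  by (induction k arbitrary: f) (auto intro: continuous_on_subset)

text \<open>\<open>partial_deriv\<close> does not refer to the set, so the local hypotheses all
  speak of one and the same function and nothing has to be glued.\<close>

lemma Ck_on_local:
  assumes "\<And>y. y \<in> S \<Longrightarrow> \<exists>T. open T \<and> y \<in> T \<and> Ck_on k f T"
  shows "Ck_on k f S"
  using assms
proof (induction k arbitrary: f)
  case 0
  then show ?case
    by simp (metis continuous_at_imp_continuous_on continuous_on_eq_continuous_at)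
next
  case (Suc k)
  have "f differentiable (at y)" if "y \<in> S" for y using Suc.prems[OF that] by auto
  moreover have "Ck_on k (partial_deriv i f) S" for i
  proof (rule Suc.IH)
    show "\<exists>T. open T \<and> y \<in> T \<and> Ck_on k (partial_deriv i f) T" if "y \<in> S" for y
      using Suc.prems[OF that] by auto
  qed
  ultimately show ?case by simp
qed

lemma coord_laplacian_cong:
  assumes "open S" "y \<in> S" "\<And>z. z \<in> S \<Longrightarrow> u z = v z"
  shows "coord_laplacian g u y = coord_laplacian g v y"
  unfolding coord_laplacian_def
  by (intro arg_cong2[where f = "(/)"] sum.cong refl partial_deriv_cong[OF assms(1,2)]
      arg_cong2[where f = "(*)"] partial_deriv_cong[OF assms(1)] assms(3))

section \<open>Charts and local compactness of a Riemannian manifold\<close>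

lemma riemannian_manifold_chart:
  assumes "riemannian_manifold A" "c \<in> A"
  shows "open (rc_dom c)" "open (rc_img c)"
    "homeomorphism (rc_dom c) (rc_img c) (rc_map c) (rc_param c)"
    "smooth_on (rc_metric c) (rc_img c)"
    "\<And>y. y \<in> rc_img c \<Longrightarrow> transpose (rc_metric c y) = rc_metric c y"
    "\<And>y v. y \<in> rc_img c \<Longrightarrow> v \<noteq> 0 \<Longrightarrow> v \<bullet> (rc_metric c y *v v) > 0"
  using assms unfolding riemannian_manifold_def by blast+

lemma riemannian_manifold_cover:
  fixes p :: "'a::{t2_space, second_countable_topology}"
  assumes "riemannian_manifold A"
  obtains c where "c \<in> A" "p \<in> rc_dom c"
  using assms unfolding riemannian_manifold_def by blast

lemma homeomorphism_open_image:
  assumes "homeomorphism S T f g" "open T" "W \<subseteq> S" "open W"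
  shows "open (f ` W)"
proof -
  have "openin (top_of_set S) W" using assms(3,4) open_subset by blast
  then have "openin (top_of_set T) (f ` W)" using assms(1) homeomorphism_imp_open_map by blast
  then show ?thesis using assms(2) openin_open_trans by blast
qed

lemma riemannian_manifold_compact_neighbourhood:
  fixes A :: "('a::{t2_space, second_countable_topology}, 'n::finite) rchart set" and p :: 'a
  assumes M: "riemannian_manifold A"
  obtains V K where "open V" "p \<in> V" "V \<subseteq> K" "compact K"
proof -
  obtain c where c: "c \<in> A" "p \<in> rc_dom c" using riemannian_manifold_cover[OF M] .
  note ch = riemannian_manifold_chart[OF M c(1)]
  have "rc_map c p \<in> rc_img c" using c by (simp add: rc_img_def)
  then obtain r where r: "r > 0" "cball (rc_map c p) r \<subseteq> rc_img c"
    using ch(2) open_contains_cball by blast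
  have sub: "ball (rc_map c p) r \<subseteq> rc_img c" using r by force
  show thesis
  proof
    show "open (rc_param c ` ball (rc_map c p) r)"
      using homeomorphism_open_image[OF homeomorphism_symD[OF ch(3)] ch(1) sub] by simp
    show "p \<in> rc_param c ` ball (rc_map c p) r"
      using homeomorphism_apply1[OF ch(3) c(2)] r by (intro image_eqI[of _ _ "rc_map c p"]) auto
    show "rc_param c ` ball (rc_map c p) r \<subseteq> rc_param c ` cball (rc_map c p) r" by (intro image_mono) auto
    show "compact (rc_param c ` cball (rc_map c p) r)"
      using ch(3) r(2) by (intro compact_continuous_image compact_cball)
        (auto simp: homeomorphism_def intro: continuous_on_subset)
  qed
qed

text \<open>The quantifier order is the point: \<open>V\<close> depends on \<open>p\<close>,
  \<epsilon> and \<open>m\<close> only, so that it can serve a whole family of functions indexed by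
  the fiber.\<close>

lemma harmonic_equicontinuous:
  fixes A :: "('a::{t2_space, second_countable_topology}, 'n::finite) rchart set" and p :: 'a
  assumes M: "riemannian_manifold A" and "0 < \<epsilon>"
  obtains V where "open V" "p \<in> V"
    "\<And>h q. harmonic A h \<Longrightarrow> (\<And>p. \<bar>h p\<bar> \<le> m) \<Longrightarrow> q \<in> V \<Longrightarrow> \<bar>h q - h p\<bar> < \<epsilon>"
proof -
  obtain c where c: "c \<in> A" "p \<in> rc_dom c" using riemannian_manifold_cover[OF M] .
  note ch = riemannian_manifold_chart[OF M c(1)]
  have y0: "rc_map c p \<in> rc_img c" using c by (simp add: rc_img_def)
  have g1: "Ck_on 1 (rc_metric c) (rc_img c)" using ch(4) by (simp add: smooth_on_def del: Ck_on.simps)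
  have "\<exists>V. open V \<and> rc_map c p \<in> V \<and> V \<subseteq> rc_img c \<and> (\<forall>u. Ck_on 2 u (rc_img c) \<and>
      (\<forall>y\<in>rc_img c. coord_laplacian (rc_metric c) u y = 0) \<and> (\<forall>y\<in>rc_img c. \<bar>u y\<bar> \<le> m) \<longrightarrow>
      (\<forall>y\<in>V. \<bar>u y - u (rc_map c p)\<bar> < \<epsilon>))"
    by (rule harmonic_equicontinuous_coordinates[OF ch(2) y0 g1 _ _ \<open>0 < \<epsilon>\<close>]; rule ch(5,6); assumption)
  then obtain V where V: "open V" "rc_map c p \<in> V" "V \<subseteq> rc_img c"
    and Vu: "\<forall>u. Ck_on 2 u (rc_img c) \<and> (\<forall>y\<in>rc_img c. coord_laplacian (rc_metric c) u y = 0) \<and>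
      (\<forall>y\<in>rc_img c. \<bar>u y\<bar> \<le> m) \<longrightarrow> (\<forall>y\<in>V. \<bar>u y - u (rc_map c p)\<bar> < \<epsilon>)"
    by (elim exE conjE) (rule that; assumption)
  show thesis
  proof
    show "open (rc_param c ` V)"
      using homeomorphism_open_image[OF homeomorphism_symD[OF ch(3)] ch(1) V(3,1)] .
    show "p \<in> rc_param c ` V"
      using homeomorphism_apply1[OF ch(3) c(2)] V by (intro image_eqI[of _ _ "rc_map c p"]) auto
    fix h q assume h: "harmonic A h" "\<And>p. \<bar>h p\<bar> \<le> m" and "q \<in> rc_param c ` V"
    then obtain y where y: "y \<in> V" "q = rc_param c y" by blast
    have "coord_laplacian (rc_metric c) (h \<circ> rc_param c) y = 0" if "y \<in> rc_img c" for y
    proof -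
      obtain p where "p \<in> rc_dom c" "y = rc_map c p" using \<open>y \<in> rc_img c\<close> by (auto simp: rc_img_def)
      then show ?thesis using h(1) c(1) by (auto simp: harmonic_def chart_laplacian_def)
    qed
    moreover have "Ck_on 2 (h \<circ> rc_param c) (rc_img c)" using h(1) c(1) by (simp add: harmonic_def)
    ultimately have "\<bar>(h \<circ> rc_param c) y - (h \<circ> rc_param c) (rc_map c p)\<bar> < \<epsilon>"
      using h(2) y(1) Vu[rule_format, of "h \<circ> rc_param c" y] by auto
    then show "\<bar>h q - h p\<bar> < \<epsilon>" by (simp add: y homeomorphism_apply1[OF ch(3) c(2)])
  qed
qed

text \<open>A transported chart has the same coordinates and the same Gram matrix as the restriction
  of the original one, so both sides make the same statement on the coordinate images of the sets
  \<open>W\<close>. Being \<open>C\<^sup>2\<close> and harmonic is local, and local injectivity of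
  \<open>q\<close> lets the admissible \<open>W\<close> exhaust every chart.\<close>

lemma harmonic_covering_iff:
  fixes A :: "('a::{t2_space, second_countable_topology}, 'n::finite) rchart set" and q :: "'a \<Rightarrow> 'b"
  assumes M: "riemannian_manifold A"
    and inj: "\<And>p. \<exists>W. open W \<and> p \<in> W \<and> inj_on q W"
  shows "harmonic {RChart (q ` W) (rc_map c \<circ> inv_into W q) (rc_metric c) | c W.
            c \<in> A \<and> open W \<and> W \<subseteq> rc_dom c \<and> inj_on q W} f \<longleftrightarrow> harmonic A (f \<circ> q)"
proof -
  define R :: "('a, 'n) rchart \<Rightarrow> 'a set \<Rightarrow> ('b, 'n) rchart" where "R c W = RChart (q ` W) (rc_map c \<circ> inv_into W q) (rc_metric c)" for c W
  define ok where "ok c W \<longleftrightarrow> c \<in> A \<and> open W \<and> W \<subseteq> rc_dom c \<and> inj_on q W" for c W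
  have main: "open (rc_map c ` W) \<and> rc_img (R c W) = rc_map c ` W \<and>
      (\<forall>y\<in>rc_map c ` W. (f \<circ> rc_param (R c W)) y = ((f \<circ> q) \<circ> rc_param c) y) \<and>
      (\<forall>p\<in>W. chart_laplacian (R c W) f (q p) = chart_laplacian c (f \<circ> q) p)"
    if "ok c W" for c W
  proof -
    have W: "c \<in> A" "open W" "W \<subseteq> rc_dom c" "inj_on q W" using that by (auto simp: ok_def)
    note ch = riemannian_manifold_chart[OF M W(1)]
    have inv: "rc_param c (rc_map c p) = p" if "p \<in> W" for p
      using homeomorphism_apply1[OF ch(3)] that W(3) by blast
    have mapR: "rc_map (R c W) (q p) = rc_map c p" if "p \<in> W" for p
      using that W(4) by (simp add: R_def)
    have img: "rc_img (R c W) = rc_map c ` W"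
      using mapR by (force simp: rc_img_def R_def)
    have injR: "inj_on (rc_map (R c W)) (q ` W)"
    proof (rule inj_onI)
      fix m m' assume mm: "m \<in> q ` W" "m' \<in> q ` W" "rc_map (R c W) m = rc_map (R c W) m'"
      then obtain p p' where p: "p \<in> W" "m = q p" "p' \<in> W" "m' = q p'" by blast
      then have "rc_map c p = rc_map c p'" using mm(3) mapR by simp
      then show "m = m'" using p inv by metis
    qed
    have par: "rc_param (R c W) (rc_map c p) = q p" if "p \<in> W" for p
    proof -
      have "rc_dom (R c W) = q ` W" by (simp add: R_def)
      then have "rc_param (R c W) (rc_map (R c W) (q p)) = q p"
        unfolding rc_param_def using injR that by (simp add: inv_into_f_f)
      then show ?thesis by (simp add: mapR that)
    qed
    have op: "open (rc_map c ` W)" by (rule homeomorphism_open_image[OF ch(3,2) W(3,2)])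
    have agree: "\<forall>y\<in>rc_map c ` W. (f \<circ> rc_param (R c W)) y = ((f \<circ> q) \<circ> rc_param c) y"
      by (auto simp: par inv)
    have "chart_laplacian (R c W) f (q p) = chart_laplacian c (f \<circ> q) p" if "p \<in> W" for p
    proof -
      have "chart_laplacian (R c W) f (q p) = coord_laplacian (rc_metric c) (f \<circ> rc_param (R c W)) (rc_map c p)"
        using mapR[OF that] by (simp add: chart_laplacian_def) (simp add: R_def)
      also have "\<dots> = coord_laplacian (rc_metric c) ((f \<circ> q) \<circ> rc_param c) (rc_map c p)"
        using agree that by (intro coord_laplacian_cong[OF op]) auto
      finally show ?thesis by (simp add: chart_laplacian_def)
    qed
    then show ?thesis using op img agree by blast
  qed
  have domR: "rc_dom (R c W) = q ` W" for c W by (simp add: R_def)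
  have Ck_iff: "Ck_on 2 (f \<circ> rc_param (R c W)) (rc_img (R c W)) \<longleftrightarrow> Ck_on 2 ((f \<circ> q) \<circ> rc_param c) (rc_map c ` W)"
    if "ok c W" for c W
    using main[OF that] Ck_on_cong[of "rc_map c ` W"] by metis
  have "harmonic {R c W | c W. ok c W} f \<longleftrightarrow> (\<forall>c W. ok c W \<longrightarrow>
      Ck_on 2 ((f \<circ> q) \<circ> rc_param c) (rc_map c ` W) \<and> (\<forall>p\<in>W. chart_laplacian c (f \<circ> q) p = 0))"
  proof -
    have "harmonic {R c W | c W. ok c W} f \<longleftrightarrow> (\<forall>c W. ok c W \<longrightarrow>
      Ck_on 2 (f \<circ> rc_param (R c W)) (rc_img (R c W)) \<and> (\<forall>p\<in>W. chart_laplacian (R c W) f (q p) = 0))"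
      unfolding harmonic_def using domR by fastforce
    then show ?thesis using Ck_iff main by (metis (no_types, lifting))
  qed
  also have "\<dots> \<longleftrightarrow> harmonic A (f \<circ> q)"
  proof
    assume h: "harmonic A (f \<circ> q)"
    show "\<forall>c W. ok c W \<longrightarrow>
      Ck_on 2 ((f \<circ> q) \<circ> rc_param c) (rc_map c ` W) \<and> (\<forall>p\<in>W. chart_laplacian c (f \<circ> q) p = 0)"
    proof (intro allI impI)
      fix c W assume "ok c W"
      then have W: "c \<in> A" "W \<subseteq> rc_dom c" by (auto simp: ok_def)
      then have "rc_map c ` W \<subseteq> rc_img c" by (auto simp: rc_img_def)
      then show "Ck_on 2 ((f \<circ> q) \<circ> rc_param c) (rc_map c ` W) \<and> (\<forall>p\<in>W. chart_laplacian c (f \<circ> q) p = 0)"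
        using h W unfolding harmonic_def by (blast intro: Ck_on_subset)
    qed
  next
    assume h: "\<forall>c W. ok c W \<longrightarrow>
      Ck_on 2 ((f \<circ> q) \<circ> rc_param c) (rc_map c ` W) \<and> (\<forall>p\<in>W. chart_laplacian c (f \<circ> q) p = 0)"
    have small: "\<exists>W. ok c W \<and> p \<in> W" if "c \<in> A" "p \<in> rc_dom c" for c p
    proof -
      obtain W where "open W" "p \<in> W" "inj_on q W" using inj by blast
      then have "ok c (W \<inter> rc_dom c)" using that riemannian_manifold_chart(1)[OF M that(1)]
        by (auto simp: ok_def intro: inj_on_subset)
      then show ?thesis using that \<open>p \<in> W\<close> by blast
    qed
    show "harmonic A (f \<circ> q)"
      unfolding harmonic_def
    proof (intro ballI conjI)
      fix c assume c: "c \<in> A"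
      show "Ck_on 2 ((f \<circ> q) \<circ> rc_param c) (rc_img c)"
      proof (rule Ck_on_local)
        fix y assume "y \<in> rc_img c"
        then obtain p where p: "p \<in> rc_dom c" "y = rc_map c p" by (auto simp: rc_img_def)
        obtain W where W: "ok c W" "p \<in> W" using small[OF c p(1)] by blast
        then show "\<exists>T. open T \<and> y \<in> T \<and> Ck_on 2 ((f \<circ> q) \<circ> rc_param c) T"
          using h main[OF W(1)] p(2) by blast
      qed
      show "chart_laplacian c (f \<circ> q) p = 0" if "p \<in> rc_dom c" for p
        using small[OF c that] h by blast
    qed
  qed
  finally show ?thesis by (simp add: R_def ok_def)
qed

section \<open>Functions on the orbit space\<close>

locale transformation_action =
  fixes \<Gamma> :: "('d::topological_space \<Rightarrow> 'd) set"
    and \<alpha> :: "('d \<Rightarrow> 'd) \<Rightarrow> 'x::topological_space \<Rightarrow> 'x"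
  assumes subgroup: "subgroup \<Gamma> (BijGroup UNIV)"
    and action: "acts_by_homeomorphisms \<Gamma> \<alpha>"
begin

abbreviation \<pi> :: "'d \<times> 'x \<Rightarrow> ('d \<times> 'x) set" where
  "\<pi> \<equiv> bundle_proj \<Gamma> \<alpha>"

abbreviation ginv :: "('d \<Rightarrow> 'd) \<Rightarrow> 'd \<Rightarrow> 'd" where
  "ginv \<equiv> inv_into UNIV"

section \<open>Group laws for the transformations and for their action on the fiber\<close>

lemma bij: "\<gamma> \<in> \<Gamma> \<Longrightarrow> bij \<gamma>"
  using subgroup.subset[OF subgroup] by (auto simp: BijGroup_def Bij_def)

lemma Bij: "\<gamma> \<in> \<Gamma> \<Longrightarrow> \<gamma> \<in> Bij UNIV"
  using subgroup.subset[OF subgroup] by (auto simp: BijGroup_def)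

lemma id_mem: "id \<in> \<Gamma>"
  using subgroup.one_closed[OF subgroup] by (simp add: BijGroup_def id_def restrict_def)

lemma mult_eq: "\<gamma> \<in> \<Gamma> \<Longrightarrow> \<delta> \<in> \<Gamma> \<Longrightarrow> \<gamma> \<otimes>\<^bsub>BijGroup UNIV\<^esub> \<delta> = \<gamma> \<circ> \<delta>"
  by (simp add: BijGroup_def Bij compose_def fun_eq_iff)

lemma comp_mem: "\<gamma> \<in> \<Gamma> \<Longrightarrow> \<delta> \<in> \<Gamma> \<Longrightarrow> \<gamma> \<circ> \<delta> \<in> \<Gamma>"
  using subgroup.m_closed[OF subgroup] mult_eq by metis

lemma inv_mem: "\<gamma> \<in> \<Gamma> \<Longrightarrow> ginv \<gamma> \<in> \<Gamma>"
  using subgroup.m_inv_closed[OF subgroup, of \<gamma>] by (simp add: inv_BijGroup Bij restrict_def)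

lemma inv_apply [simp]: "\<gamma> \<in> \<Gamma> \<Longrightarrow> ginv \<gamma> (\<gamma> p) = p" "\<gamma> \<in> \<Gamma> \<Longrightarrow> \<gamma> (ginv \<gamma> p) = p"
  using bij by (simp_all add: bij_is_inj bij_is_surj surj_f_inv_f)

lemma inv_comp_id: "\<gamma> \<in> \<Gamma> \<Longrightarrow> ginv \<gamma> \<circ> \<gamma> = id" "\<gamma> \<in> \<Gamma> \<Longrightarrow> \<gamma> \<circ> ginv \<gamma> = id"
  by (simp_all add: fun_eq_iff)

lemma inv_inv: "\<gamma> \<in> \<Gamma> \<Longrightarrow> ginv (ginv \<gamma>) = \<gamma>"
  by (simp add: bij inv_inv_eq)

lemma group_action: "group_action (transformation_group \<Gamma>) UNIV \<alpha>"
  using action by (simp add: acts_by_homeomorphisms_def)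

lemma action_id [simp]: "\<alpha> id x = x"
proof -
  have "\<one>\<^bsub>transformation_group \<Gamma>\<^esub> = id" by (simp add: transformation_group_def BijGroup_def id_def restrict_def)
  then show ?thesis using group_action.id_eq_one[OF group_action] by (metis restrict_apply UNIV_I)
qed

lemma action_comp: "\<gamma> \<in> \<Gamma> \<Longrightarrow> \<delta> \<in> \<Gamma> \<Longrightarrow> \<alpha> (\<gamma> \<circ> \<delta>) x = \<alpha> \<gamma> (\<alpha> \<delta> x)"
  using group_action.composition_rule[OF group_action, of x \<gamma> \<delta>] mult_eq
  by (simp add: transformation_group_def)

lemma action_inv [simp]: "\<gamma> \<in> \<Gamma> \<Longrightarrow> \<alpha> (ginv \<gamma>) (\<alpha> \<gamma> x) = x" "\<gamma> \<in> \<Gamma> \<Longrightarrow> \<alpha> \<gamma> (\<alpha> (ginv \<gamma>) x) = x"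
  using action_comp[of "ginv \<gamma>" \<gamma> x] action_comp[of \<gamma> "ginv \<gamma>" x] by (simp_all add: inv_mem inv_comp_id)

lemma action_continuous: "\<gamma> \<in> \<Gamma> \<Longrightarrow> continuous_on UNIV (\<alpha> \<gamma>)"
  using action homeomorphic_imp_continuous_map unfolding acts_by_homeomorphisms_def by fastforce

lemma proj_eq: "\<pi> (p, x) = {(\<gamma> p, \<alpha> \<gamma> x) | \<gamma>. \<gamma> \<in> \<Gamma>}"
  by (simp add: bundle_proj_def orbit_def transformation_group_def)

lemma base_proj_eq: "base_proj \<Gamma> p = (\<lambda>\<gamma>. \<gamma> p) ` \<Gamma>"
  by (auto simp: base_proj_def orbit_def transformation_group_def)

lemma base_proj_self: "p \<in> base_proj \<Gamma> p"
  unfolding base_proj_eq by (intro image_eqI[of _ _ id] id_mem) simp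

lemma base_proj_action:
  assumes \<gamma>: "\<gamma> \<in> \<Gamma>"
  shows "base_proj \<Gamma> (\<gamma> p) = base_proj \<Gamma> p"
proof (intro equalityI subsetI)
  fix r assume "r \<in> base_proj \<Gamma> (\<gamma> p)"
  then obtain \<delta> where \<delta>: "\<delta> \<in> \<Gamma>" "r = \<delta> (\<gamma> p)" unfolding base_proj_eq by (rule imageE)
  then show "r \<in> base_proj \<Gamma> p"
    unfolding base_proj_eq by (intro image_eqI[of _ _ "\<delta> \<circ> \<gamma>"] comp_mem \<gamma>) simp_all
next
  fix r assume "r \<in> base_proj \<Gamma> p"
  then obtain \<delta> where \<delta>: "\<delta> \<in> \<Gamma>" "r = \<delta> p" unfolding base_proj_eq by (rule imageE)
  then show "r \<in> base_proj \<Gamma> (\<gamma> p)"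
    unfolding base_proj_eq by (intro image_eqI[of _ _ "\<delta> \<circ> ginv \<gamma>"] comp_mem inv_mem \<gamma>) (simp_all add: \<gamma>)
qed

lemma proj_action: "\<gamma> \<in> \<Gamma> \<Longrightarrow> \<pi> (\<gamma> p, \<alpha> \<gamma> x) = \<pi> (p, x)"
proof -
  assume \<gamma>: "\<gamma> \<in> \<Gamma>"
  have "(\<delta> (\<gamma> p), \<alpha> \<delta> (\<alpha> \<gamma> x)) \<in> \<pi> (p, x)" if "\<delta> \<in> \<Gamma>" for \<delta>
    unfolding proj_eq using comp_mem[OF that \<gamma>] action_comp[OF that \<gamma>]
    by (intro CollectI exI[of _ "\<delta> \<circ> \<gamma>"]) simp
  moreover have "(\<delta> p, \<alpha> \<delta> x) \<in> \<pi> (\<gamma> p, \<alpha> \<gamma> x)" if "\<delta> \<in> \<Gamma>" for \<delta>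
  proof -
    have m: "\<delta> \<circ> ginv \<gamma> \<in> \<Gamma>" using that \<gamma> by (intro comp_mem inv_mem)
    have "(\<delta> p, \<alpha> \<delta> x) = ((\<delta> \<circ> ginv \<gamma>) (\<gamma> p), \<alpha> (\<delta> \<circ> ginv \<gamma>) (\<alpha> \<gamma> x))"
      using that \<gamma> by (simp add: action_comp inv_mem)
    then show ?thesis unfolding proj_eq using m by blast
  qed
  ultimately show ?thesis unfolding proj_eq by blast
qed

lemma proj_eq_iff: "\<pi> (p, x) = \<pi> (p', x') \<longleftrightarrow> (\<exists>\<gamma>\<in>\<Gamma>. p' = \<gamma> p \<and> x' = \<alpha> \<gamma> x)"
proof
  assume e: "\<pi> (p, x) = \<pi> (p', x')"
  have "(p', x') \<in> \<pi> (p, x)" unfolding e unfolding proj_eq using id_mem by (intro CollectI exI[of _ id]) simp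
  then show "\<exists>\<gamma>\<in>\<Gamma>. p' = \<gamma> p \<and> x' = \<alpha> \<gamma> x" unfolding proj_eq by blast
qed (auto simp: proj_action)

section \<open>Functions on the orbit space as invariant functions on the product\<close>

lemma bundle_continuous_iff:
  "f \<in> bundle_continuous \<Gamma> \<alpha> \<longleftrightarrow> f \<in> extensional (range \<pi>) \<and> continuous_on UNIV (f \<circ> \<pi>)"
proof -
  have "continuous_map (quotient_topology \<pi>) euclideanreal f \<longleftrightarrow> continuous_on UNIV (f \<circ> \<pi>)"
  proof -
    have "\<pi> -` {m \<in> range \<pi>. f m \<in> U} = (f \<circ> \<pi>) -` U" for U by auto
    then show ?thesis
      by (simp add: continuous_map openin_quotient_topology continuous_on_open_vimage image_subset_iff vimage_def)
  qed
  then show ?thesis by (simp add: bundle_continuous_def foliated_bundle_def)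
qed

text \<open>By invariance the value does not depend on the chosen representative; the restriction to
  \<open>range \<pi>\<close> provides the extensional form.\<close>

lemma bundle_continuous_lift:
  assumes F: "continuous_on UNIV F" and inv: "\<And>\<gamma> p x. \<gamma> \<in> \<Gamma> \<Longrightarrow> F (\<gamma> p, \<alpha> \<gamma> x) = F (p, x)"
  obtains f where "f \<in> bundle_continuous \<Gamma> \<alpha>" "f \<circ> \<pi> = F"
proof -
  define f where "f = restrict (\<lambda>m. F (SOME z. \<pi> z = m)) (range \<pi>)"
  have "f (\<pi> (p, x)) = F (p, x)" for p x
  proof -
    obtain p' x' where s: "(SOME z. \<pi> z = \<pi> (p, x)) = (p', x')" by (metis surj_pair)
    have "\<pi> (p', x') = \<pi> (p, x)" unfolding s[symmetric] by (rule someI[of _ "(p, x)"]) simp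
    then obtain \<gamma> where "\<gamma> \<in> \<Gamma>" "p = \<gamma> p'" "x = \<alpha> \<gamma> x'" unfolding proj_eq_iff by blast
    then have "F (p, x) = F (p', x')" using inv by simp
    then show ?thesis by (simp add: f_def s)
  qed
  then have "f \<circ> \<pi> = F" by (auto simp: fun_eq_iff)
  moreover have "f \<in> bundle_continuous \<Gamma> \<alpha>"
    unfolding bundle_continuous_iff \<open>f \<circ> \<pi> = F\<close> using F by (simp add: f_def)
  ultimately show thesis using that by blast
qed

lemma bundle_continuous_eqI:
  assumes "f \<in> bundle_continuous \<Gamma> \<alpha>" "g \<in> bundle_continuous \<Gamma> \<alpha>" "\<And>p x. f (\<pi> (p, x)) = g (\<pi> (p, x))"
  shows "f = g"
  using assms unfolding bundle_continuous_iff by (intro extensionalityI[of f "range \<pi>" g]) auto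

lemma restriction_eq: "restriction_map \<Gamma> \<alpha> p\<^sub>0 f x = f (\<pi> (p\<^sub>0, x))"
  by (simp add: restriction_map_def)

lemma leafwise_constant_iff: "leafwise_constant \<Gamma> \<alpha> f \<longleftrightarrow> (\<forall>p p' x. f (\<pi> (p, x)) = f (\<pi> (p', x)))"
  unfolding leafwise_constant_def leaf_def constant_on_def by (auto, metis)

lemma restriction_continuous:
  assumes "f \<in> bundle_continuous \<Gamma> \<alpha>"
  shows "continuous_on UNIV (restriction_map \<Gamma> \<alpha> p\<^sub>0 f)"
proof -
  have "continuous_on UNIV (\<lambda>x. (f \<circ> \<pi>) (p\<^sub>0, x))"
    using assms unfolding bundle_continuous_iff
    by (intro continuous_on_compose2[of UNIV "f \<circ> \<pi>" UNIV "\<lambda>x. (p\<^sub>0, x)"]) (auto intro!: continuous_intros)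
  then show ?thesis by (simp add: restriction_map_def[abs_def])
qed

text \<open>A leafwise constant function lifts to a function of \<open>x\<close> alone, and for such
  a function invariance under the diagonal action is invariance on the fiber.\<close>

lemma leafwise_constant_bij:
  "bij_betw (restriction_map \<Gamma> \<alpha> p\<^sub>0) {f \<in> bundle_continuous \<Gamma> \<alpha>. leafwise_constant \<Gamma> \<alpha> f}
     {\<phi>. continuous_on UNIV \<phi> \<and> action_invariant \<Gamma> \<alpha> \<phi>}"
  unfolding bij_betw_def
proof
  show "inj_on (restriction_map \<Gamma> \<alpha> p\<^sub>0) {f \<in> bundle_continuous \<Gamma> \<alpha>. leafwise_constant \<Gamma> \<alpha> f}"
  proof (rule inj_onI, clarsimp)
    fix f g assume fg: "f \<in> bundle_continuous \<Gamma> \<alpha>" "g \<in> bundle_continuous \<Gamma> \<alpha>"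
      "leafwise_constant \<Gamma> \<alpha> f" "leafwise_constant \<Gamma> \<alpha> g"
      and e: "restriction_map \<Gamma> \<alpha> p\<^sub>0 f = restriction_map \<Gamma> \<alpha> p\<^sub>0 g"
    have "f (\<pi> (p\<^sub>0, x)) = g (\<pi> (p\<^sub>0, x))" for x using fun_cong[OF e] by (simp add: restriction_eq)
    then show "f = g" using fg(3,4) unfolding leafwise_constant_iff
      by (intro bundle_continuous_eqI[OF fg(1,2)]) metis
  qed
  show "restriction_map \<Gamma> \<alpha> p\<^sub>0 ` {f \<in> bundle_continuous \<Gamma> \<alpha>. leafwise_constant \<Gamma> \<alpha> f}
     = {\<phi>. continuous_on UNIV \<phi> \<and> action_invariant \<Gamma> \<alpha> \<phi>}" (is "?L = ?R")
  proof
    show "?L \<subseteq> ?R"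
    proof clarify
      fix f assume f: "f \<in> bundle_continuous \<Gamma> \<alpha>" "leafwise_constant \<Gamma> \<alpha> f"
      \<comment> \<open>Leafwise constancy moves \<open>p\<^sub>0\<close> to
        \<open>\<gamma> p\<^sub>0\<close> within the leaf of \<open>\<alpha> \<gamma> x\<close>; the
        resulting pair represents the same point as \<open>(p\<^sub>0, x)\<close>.\<close>
      have "f (\<pi> (p\<^sub>0, \<alpha> \<gamma> x)) = f (\<pi> (p\<^sub>0, x))" if "\<gamma> \<in> \<Gamma>" for \<gamma> x
        using f(2) proj_action[OF that, of p\<^sub>0 x] unfolding leafwise_constant_iff by metis
      then show "continuous_on UNIV (restriction_map \<Gamma> \<alpha> p\<^sub>0 f) \<and> action_invariant \<Gamma> \<alpha> (restriction_map \<Gamma> \<alpha> p\<^sub>0 f)"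
        using restriction_continuous[OF f(1)] by (simp add: action_invariant_def restriction_eq)
    qed
    show "?R \<subseteq> ?L"
    proof clarify
      fix \<phi> :: "'x \<Rightarrow> real" assume \<phi>: "continuous_on UNIV \<phi>" "action_invariant \<Gamma> \<alpha> \<phi>"
      have "continuous_on UNIV (\<lambda>z::'d \<times> 'x. \<phi> (snd z))"
        by (rule continuous_on_compose2[OF \<phi>(1)]) (auto intro: continuous_intros)
      then obtain f where f: "f \<in> bundle_continuous \<Gamma> \<alpha>" "f \<circ> \<pi> = (\<lambda>z. \<phi> (snd z))"
        by (rule bundle_continuous_lift) (use \<phi>(2) in \<open>auto simp: action_invariant_def\<close>)
      have v: "f (\<pi> (p, x)) = \<phi> x" for p x using fun_cong[OF f(2), of "(p, x)"] by simp
      then have "\<phi> = restriction_map \<Gamma> \<alpha> p\<^sub>0 f" by (simp add: restriction_eq fun_eq_iff)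
      moreover have "leafwise_constant \<Gamma> \<alpha> f" by (simp add: leafwise_constant_iff v)
      ultimately show "\<phi> \<in> ?L" using f(1) by blast
    qed
  qed
qed

end

text \<open>Proper discontinuity on a compact neighbourhood leaves finitely many group elements to
  deal with. Each of them moves \<open>p\<close> by freeness, so the Hausdorff property supplies a
  neighbourhood that it moves off itself.\<close>

lemma wandering_neighbourhood:
  fixes A :: "('d::{t2_space, second_countable_topology}, 'n::finite) rchart set" and p :: 'd
  assumes M: "riemannian_manifold A"
    and cont: "\<And>\<gamma>. \<gamma> \<in> \<Gamma> \<Longrightarrow> continuous_on UNIV \<gamma>"
    and free: "acts_freely \<Gamma>" and pd: "acts_properly_discontinuously \<Gamma>"
  obtains W where "open W" "p \<in> W" "\<And>\<gamma>. \<gamma> \<in> \<Gamma> \<Longrightarrow> \<gamma> \<noteq> id \<Longrightarrow> \<gamma> ` W \<inter> W = {}"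
proof -
  obtain V K where VK: "open V" "p \<in> V" "V \<subseteq> K" "compact K"
    using riemannian_manifold_compact_neighbourhood[OF M] .
  define F where "F = {\<gamma>\<in>\<Gamma>. \<gamma> ` K \<inter> K \<noteq> {}} - {id}"
  have "finite F" using pd VK(4) by (simp add: F_def acts_properly_discontinuously_def)
  have "\<exists>U. open U \<and> p \<in> U \<and> \<gamma> ` U \<inter> U = {}" if "\<gamma> \<in> F" for \<gamma>
  proof -
    have \<gamma>: "\<gamma> \<in> \<Gamma>" "\<gamma> \<noteq> id" using that by (auto simp: F_def)
    then have "\<gamma> p \<noteq> p" using free by (auto simp: acts_freely_def)
    then obtain U1 U2 where U: "open U1" "open U2" "p \<in> U1" "\<gamma> p \<in> U2" "U1 \<inter> U2 = {}"
      by (metis hausdorff)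
    have "open (U1 \<inter> \<gamma> -` U2)" using U cont[OF \<gamma>(1)] open_vimage by blast
    then show ?thesis using U by (intro exI[of _ "U1 \<inter> \<gamma> -` U2"]) auto
  qed
  then obtain U where U: "\<And>\<gamma>. \<gamma> \<in> F \<Longrightarrow> open (U \<gamma>)" "\<And>\<gamma>. \<gamma> \<in> F \<Longrightarrow> p \<in> U \<gamma>"
    "\<And>\<gamma>. \<gamma> \<in> F \<Longrightarrow> \<gamma> ` U \<gamma> \<inter> U \<gamma> = {}" by metis
  show thesis
  proof
    show "open (V \<inter> (\<Inter>\<gamma>\<in>F. U \<gamma>))" using VK(1) \<open>finite F\<close> U(1) by (intro open_Int open_INT) auto
    show "p \<in> V \<inter> (\<Inter>\<gamma>\<in>F. U \<gamma>)" using VK U by blast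
    show "\<gamma> ` (V \<inter> (\<Inter>\<gamma>\<in>F. U \<gamma>)) \<inter> (V \<inter> (\<Inter>\<gamma>\<in>F. U \<gamma>)) = {}" if \<gamma>: "\<gamma> \<in> \<Gamma>" "\<gamma> \<noteq> id" for \<gamma>
    proof (cases "\<gamma> \<in> F")
      case True
      then have "\<gamma> ` (V \<inter> (\<Inter>\<gamma>\<in>F. U \<gamma>)) \<subseteq> \<gamma> ` U \<gamma>" "V \<inter> (\<Inter>\<gamma>\<in>F. U \<gamma>) \<subseteq> U \<gamma>" by blast+
      then show ?thesis using U(3)[OF True] by blast
    next
      case False
      then have "\<gamma> ` K \<inter> K = {}" using \<gamma> by (simp add: F_def)
      then show ?thesis using VK(3) by blast
    qed
  qed
qed

section \<open>Continuity of dominated sums and joint continuity\<close>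

lemma continuous_on_infsum_dominated:
  fixes f :: "'i \<Rightarrow> 'x::topological_space \<Rightarrow> real"
  assumes "\<And>i. i \<in> I \<Longrightarrow> continuous_on UNIV (f i)" "\<And>i x. i \<in> I \<Longrightarrow> \<bar>f i x\<bar> \<le> B i" "B summable_on I"
  shows "continuous_on UNIV (\<lambda>x. \<Sum>\<^sub>\<infinity>i\<in>I. f i x)"
proof (rule uniform_limit_theorem)
  show "uniform_limit UNIV (\<lambda>F x. \<Sum>i\<in>F. f i x) (\<lambda>x. \<Sum>\<^sub>\<infinity>i\<in>I. f i x) (finite_subsets_at_top I)"
    using assms by (intro Weierstrass_m_test_general[where M = B]) auto
  show "\<forall>\<^sub>F F in finite_subsets_at_top I. continuous_on UNIV (\<lambda>x. \<Sum>i\<in>F. f i x)"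
    unfolding eventually_finite_subsets_at_top
    by (intro exI[of _ "{}"]) (auto intro!: continuous_on_sum assms(1))
qed auto

text \<open>The bound in the first variable holds for all \<open>x\<close>, so \<open>q\<close> can
  be replaced by \<open>p\<close> at the moving fiber point \<open>y\<close> before \<open>y\<close>
  is replaced by \<open>x\<close> at the fixed \<open>p\<close>.\<close>

lemma jointly_continuous_if_equicontinuous:
  fixes F :: "'a::topological_space \<times> 'b::topological_space \<Rightarrow> real"
  assumes fst: "\<And>p e. 0 < e \<Longrightarrow> \<exists>V. open V \<and> p \<in> V \<and> (\<forall>q\<in>V. \<forall>x. \<bar>F (q, x) - F (p, x)\<bar> < e)"
    and snd: "\<And>p. continuous_on UNIV (\<lambda>x. F (p, x))"
  shows "continuous_on UNIV F"
  unfolding continuous_on_def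
proof
  fix z :: "'a \<times> 'b"
  obtain p x where z: "z = (p, x)" by (cases z)
  have ev: "\<forall>\<^sub>F z' in nhds z. dist (F z') (F z) < e" if "0 < e" for e
  proof -
    obtain V where V: "open V" "p \<in> V" "\<And>q x. q \<in> V \<Longrightarrow> \<bar>F (q, x) - F (p, x)\<bar> < e / 2"
      using fst[of "e / 2" p] \<open>0 < e\<close> by auto
    define N where "N = {y. \<bar>F (p, y) - F (p, x)\<bar> < e / 2}"
    have "open N" unfolding N_def by (intro open_Collect_less continuous_intros snd)
    moreover have "x \<in> N" using \<open>0 < e\<close> by (simp add: N_def)
    moreover have "dist (F z') (F z) < e" if zVN: "z' \<in> V \<times> N" for z'
    proof -
      obtain q y where z': "z' = (q, y)" "q \<in> V" "y \<in> N" using zVN by (cases z') auto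
      have "\<bar>F (q, y) - F (p, y)\<bar> < e / 2" "\<bar>F (p, y) - F (p, x)\<bar> < e / 2"
        using V(3)[OF z'(2)] z'(3) by (auto simp: N_def)
      then show ?thesis unfolding z z'(1) dist_real_def by linarith
    qed
    ultimately show ?thesis unfolding eventually_nhds using V
      by (intro exI[of _ "V \<times> N"]) (auto simp: z open_Times)
  qed
  show "(F \<longlongrightarrow> F z) (at z)"
  proof (rule tendstoI)
    show "\<forall>\<^sub>F z' in at z. dist (F z') (F z) < e" if "0 < e" for e
      unfolding eventually_at_filter by (rule eventually_mono[OF ev[OF that]]) simp
  qed
qed

section \<open>Leaf structure and compactness of the bundle\<close>

locale compact_bundle = transformation_action \<Gamma> \<alpha>
  for \<Gamma> :: "('d::{t2_space, second_countable_topology} \<Rightarrow> 'd) set"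
    and \<alpha> :: "('d \<Rightarrow> 'd) \<Rightarrow> 'x::topological_space \<Rightarrow> 'x" +
  fixes A :: "('d, 'n::finite) rchart set"
  assumes manifold: "riemannian_manifold A"
    and isometries: "isometry_group A \<Gamma>"
    and free: "acts_freely \<Gamma>"
    and properly_discontinuous: "acts_properly_discontinuously \<Gamma>"
    and base_compact: "compact_space (base_space \<Gamma>)"
    and fiber_compact: "compact (UNIV :: 'x set)"
begin

lemma continuous: "\<gamma> \<in> \<Gamma> \<Longrightarrow> continuous_on UNIV \<gamma>"
  using isometries by (simp add: isometry_group_def riemannian_isometry_def preserves_metric_def)

text \<open>Two points of a wandering neighbourhood in the same orbit coincide, so the
  parametrization of a leaf is locally injective. It need not be injective, since elements fixing
  \<open>x\<close> identify points of \<open>D\<close>.\<close>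

lemma leaf_harmonic_iff: "harmonic (leaf_atlas A \<Gamma> \<alpha> x) f \<longleftrightarrow> harmonic A (\<lambda>p. f (\<pi> (p, x)))"
proof -
  have "\<exists>W. open W \<and> p \<in> W \<and> inj_on (\<lambda>p. \<pi> (p, x)) W" for p
  proof -
    obtain W where W: "open W" "p \<in> W" "\<And>\<gamma>. \<gamma> \<in> \<Gamma> \<Longrightarrow> \<gamma> \<noteq> id \<Longrightarrow> \<gamma> ` W \<inter> W = {}"
      using wandering_neighbourhood[OF manifold continuous free properly_discontinuous] by blast
    have "inj_on (\<lambda>p. \<pi> (p, x)) W"
    proof (rule inj_onI)
      fix p1 p2 assume p: "p1 \<in> W" "p2 \<in> W" and "\<pi> (p1, x) = \<pi> (p2, x)"
      then obtain \<gamma> where \<gamma>: "\<gamma> \<in> \<Gamma>" "p2 = \<gamma> p1" unfolding proj_eq_iff by blast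
      then show "p1 = p2" using W(3)[OF \<gamma>(1)] p by (cases "\<gamma> = id") auto
    qed
    then show ?thesis using W by blast
  qed
  from harmonic_covering_iff[OF manifold this] show ?thesis
    by (simp add: leaf_atlas_def o_def Let_def)
qed

lemma leafwise_harmonic_iff:
  "f \<in> leafwise_harmonic A \<Gamma> \<alpha> \<longleftrightarrow> f \<in> bundle_continuous \<Gamma> \<alpha> \<and> (\<forall>x. harmonic A (\<lambda>p. f (\<pi> (p, x))))"
  by (simp add: leafwise_harmonic_def leaf_harmonic_iff)

text \<open>The saturation of an open set is a union of translates, so small open sets have open
  images in the base. Finitely many of these images cover it, and the corresponding compact
  neighbourhoods together meet every orbit.\<close>

lemma compact_fundamental_set:
  "\<exists>K. compact K \<and> (\<forall>p. \<exists>\<gamma>\<in>\<Gamma>. \<gamma> p \<in> K)"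
proof -
  have "\<exists>V K. open V \<and> p \<in> V \<and> V \<subseteq> K \<and> compact K" for p :: 'd
    using riemannian_manifold_compact_neighbourhood[OF manifold, of p] by metis
  then obtain V K where VK: "\<And>p::'d. open (V p)" "\<And>p. p \<in> V p" "\<And>p. V p \<subseteq> K p" "\<And>p. compact (K p)"
    by metis
  have vim: "base_proj \<Gamma> -` (base_proj \<Gamma> ` V p) = (\<Union>\<gamma>\<in>\<Gamma>. \<gamma> -` V p)" for p
  proof (intro equalityI subsetI)
    fix q assume "q \<in> base_proj \<Gamma> -` (base_proj \<Gamma> ` V p)"
    then obtain r where r: "r \<in> V p" "base_proj \<Gamma> q = base_proj \<Gamma> r" by auto
    have "r \<in> base_proj \<Gamma> q" unfolding r(2) by (rule base_proj_self)
    then obtain \<gamma> where "\<gamma> \<in> \<Gamma>" "r = \<gamma> q" unfolding base_proj_eq by (rule imageE)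
    then have "\<gamma> \<in> \<Gamma>" "q \<in> \<gamma> -` V p" using r(1) by auto
    then show "q \<in> (\<Union>\<gamma>\<in>\<Gamma>. \<gamma> -` V p)" by (intro UN_I[of \<gamma>])
  next
    fix q assume "q \<in> (\<Union>\<gamma>\<in>\<Gamma>. \<gamma> -` V p)"
    then obtain \<gamma> where \<gamma>: "\<gamma> \<in> \<Gamma>" "q \<in> \<gamma> -` V p" by (rule UN_E)
    then have "base_proj \<Gamma> q \<in> base_proj \<Gamma> ` V p"
      by (intro image_eqI[of _ _ "\<gamma> q"]) (simp_all add: base_proj_action)
    then show "q \<in> base_proj \<Gamma> -` (base_proj \<Gamma> ` V p)" by simp
  qed
  have op: "openin (base_space \<Gamma>) (base_proj \<Gamma> ` V p)" for p
    unfolding base_space_def openin_quotient_topology vim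
    using open_vimage[OF VK(1) continuous] by (intro conjI open_UN ballI) auto
  have cov: "topspace (base_space \<Gamma>) \<subseteq> \<Union> (range (\<lambda>p. base_proj \<Gamma> ` V p))"
    using VK(2) by (auto simp: base_space_def)
  have "\<exists>\<F>. finite \<F> \<and> \<F> \<subseteq> range (\<lambda>p. base_proj \<Gamma> ` V p) \<and> topspace (base_space \<Gamma>) \<subseteq> \<Union>\<F>"
    by (rule base_compact[unfolded compact_space_alt, rule_format]) (use cov op in auto)
  then obtain \<F> where \<F>: "finite \<F>" "\<F> \<subseteq> range (\<lambda>p. base_proj \<Gamma> ` V p)" "topspace (base_space \<Gamma>) \<subseteq> \<Union>\<F>"
    by blast
  obtain S where S: "finite S" "\<F> = (\<lambda>p. base_proj \<Gamma> ` V p) ` S"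
    using finite_subset_image[OF \<F>(1,2)] by blast
  show ?thesis
  proof (intro exI conjI allI)
    show "compact (\<Union>p\<in>S. K p)" using S VK by (intro compact_UN) auto
    fix q
    have "base_proj \<Gamma> q \<in> topspace (base_space \<Gamma>)" by (simp add: base_space_def)
    then obtain p where p: "p \<in> S" "base_proj \<Gamma> q \<in> base_proj \<Gamma> ` V p" using \<F>(3) S by blast
    then have "q \<in> base_proj \<Gamma> -` (base_proj \<Gamma> ` V p)" by simp
    then obtain \<gamma> where "\<gamma> \<in> \<Gamma>" "q \<in> \<gamma> -` V p" unfolding vim by (rule UN_E)
    then show "\<exists>\<gamma>\<in>\<Gamma>. \<gamma> q \<in> (\<Union>p\<in>S. K p)" using p(1) VK(3) by (intro bexI[of _ \<gamma>]) auto
  qed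
qed

text \<open>The kernel represents bounded harmonic functions only. Boundedness comes from the
  compact set \<open>K \<times> UNIV\<close>, which contains a representative of every point of the
  bundle.\<close>

lemma bundle_continuous_bounded:
  assumes "f \<in> bundle_continuous \<Gamma> \<alpha>"
  shows "bounded (range (\<lambda>p. f (\<pi> (p, x))))"
proof -
  obtain K where K: "compact K" "\<And>p. \<exists>\<gamma>\<in>\<Gamma>. \<gamma> p \<in> K" using compact_fundamental_set by blast
  have "continuous_on (K \<times> UNIV) (f \<circ> \<pi>)"
    using assms unfolding bundle_continuous_iff by (blast intro: continuous_on_subset)
  then have "compact ((f \<circ> \<pi>) ` (K \<times> UNIV))"
    by (intro compact_continuous_image compact_Times K fiber_compact)
  then have "bounded ((f \<circ> \<pi>) ` (K \<times> UNIV))" by (rule compact_imp_bounded)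
  moreover have "range (\<lambda>p. f (\<pi> (p, x))) \<subseteq> (f \<circ> \<pi>) ` (K \<times> UNIV)"
  proof clarify
    fix p
    obtain \<gamma> where \<gamma>: "\<gamma> \<in> \<Gamma>" "\<gamma> p \<in> K" using K(2) by blast
    then have "f (\<pi> (p, x)) = (f \<circ> \<pi>) (\<gamma> p, \<alpha> \<gamma> x)" by (simp add: proj_action)
    then show "f (\<pi> (p, x)) \<in> (f \<circ> \<pi>) ` (K \<times> UNIV)" using \<gamma> by blast
  qed
  ultimately show ?thesis by (rule bounded_subset)
qed

end

section \<open>The restriction map\<close>

locale discretized_bundle = compact_bundle \<Gamma> \<alpha> A
  for \<Gamma> :: "('d::{t2_space, second_countable_topology} \<Rightarrow> 'd) set"
    and \<alpha> :: "('d \<Rightarrow> 'd) \<Rightarrow> 'x::topological_space \<Rightarrow> 'x"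
    and A :: "('d, 'n::finite) rchart set" +
  fixes p\<^sub>0 :: 'd and \<mu> :: "('d \<Rightarrow> 'd) pmf" and P :: "'d \<Rightarrow> 'd \<Rightarrow> real"
  assumes kernel: "discretization_kernel A \<Gamma> p\<^sub>0 P"
    and \<mu>: "\<And>\<gamma>. \<gamma> \<in> \<Gamma> \<Longrightarrow> pmf \<mu> \<gamma> = P (\<gamma> p\<^sub>0) p\<^sub>0"
begin

definition V where "V = base_proj \<Gamma> p\<^sub>0"

definition poisson where "poisson \<phi> p = (\<Sum>\<^sub>\<infinity>v\<in>V. P p v * \<phi> v)"

lemma kernel_nonneg: "v \<in> V \<Longrightarrow> 0 \<le> P p v"
  using kernel unfolding discretization_kernel_def Let_def V_def by (meson less_imp_le)

lemma kernel_sum: "(P p has_sum 1) V"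
  using kernel unfolding discretization_kernel_def Let_def V_def by blast

lemma kernel_equivariant: "\<gamma> \<in> \<Gamma> \<Longrightarrow> v \<in> V \<Longrightarrow> P (\<gamma> p) (\<gamma> v) = P p v"
  using kernel unfolding discretization_kernel_def Let_def V_def by blast

lemma poisson_bij: "bij_betw poisson (bounded_P_harmonic V P) (bounded_harmonic A)"
  using kernel unfolding discretization_kernel_def Let_def poisson_def[abs_def] V_def by blast

lemma poisson_inverse: "h \<in> bounded_harmonic A \<Longrightarrow> inv_into (bounded_P_harmonic V P) poisson h = restrict h V"
  using kernel unfolding discretization_kernel_def Let_def poisson_def[abs_def] V_def by blast

lemma bounded_harmonic_eq_poisson:
  assumes "h \<in> bounded_harmonic A"
  shows "h p = (\<Sum>\<^sub>\<infinity>v\<in>V. P p v * h v)"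
proof -
  have "h \<in> poisson ` bounded_P_harmonic V P" using poisson_bij assms by (simp add: bij_betw_def)
  then have "poisson (restrict h V) = h" using f_inv_into_f poisson_inverse[OF assms] by metis
  then have "h p = poisson (restrict h V) p" by simp
  also have "\<dots> = (\<Sum>\<^sub>\<infinity>v\<in>V. P p v * h v)" unfolding poisson_def by (intro infsum_cong) simp
  finally show ?thesis .
qed

lemma mem_V: "\<gamma> \<in> \<Gamma> \<Longrightarrow> \<gamma> p\<^sub>0 \<in> V"
  by (simp add: V_def base_proj_eq)

lemma mem_V_E:
  assumes "v \<in> V"
  obtains \<gamma> where "\<gamma> \<in> \<Gamma>" "v = \<gamma> p\<^sub>0"
  using assms unfolding V_def base_proj_eq by (rule imageE)

lemma p0_mem_V: "p\<^sub>0 \<in> V"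
  using mem_V[OF id_mem] by simp

section \<open>The orbit of the base point as a copy of the group\<close>

lemma orbit_bij: "bij_betw (\<lambda>\<gamma>. \<gamma> p\<^sub>0) \<Gamma> V"
  unfolding bij_betw_def
proof
  show "inj_on (\<lambda>\<gamma>. \<gamma> p\<^sub>0) \<Gamma>"
  proof (rule inj_onI)
    fix \<gamma> \<delta> assume *: "\<gamma> \<in> \<Gamma>" "\<delta> \<in> \<Gamma>" "\<gamma> p\<^sub>0 = \<delta> p\<^sub>0"
    then have "(ginv \<delta> \<circ> \<gamma>) p\<^sub>0 = p\<^sub>0" by simp
    moreover have "ginv \<delta> \<circ> \<gamma> \<in> \<Gamma>" using * by (intro comp_mem inv_mem)
    ultimately have id: "ginv \<delta> \<circ> \<gamma> = id" using free by (simp only: acts_freely_def)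
    show "\<gamma> = \<delta>"
    proof
      fix p show "\<gamma> p = \<delta> p" using fun_cong[OF id, of p] inv_apply(2)[OF *(2), of "\<gamma> p"] by simp
    qed
  qed
qed (simp add: V_def base_proj_eq)

lemma left_translation_bij: "\<delta> \<in> \<Gamma> \<Longrightarrow> bij_betw (\<lambda>\<eta>. \<delta> \<circ> \<eta>) \<Gamma> \<Gamma>"
  by (rule bij_betw_byWitness[where f' = "\<lambda>\<eta>. ginv \<delta> \<circ> \<eta>"]) (auto simp: comp_mem inv_mem fun_eq_iff)

lemma inversion_bij: "bij_betw ginv \<Gamma> \<Gamma>"
  by (rule bij_betw_byWitness[where f' = ginv]) (auto simp: inv_mem inv_inv)

text \<open>The indexing of the orbit adapted to \<mu>: a step with weight
  \<open>pmf \<mu> \<eta>\<close> leads from \<open>\<delta> p\<^sub>0\<close> to the point with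
  index \<eta>.\<close>

lemma twisted_orbit_bij: "\<delta> \<in> \<Gamma> \<Longrightarrow> bij_betw (\<lambda>\<eta>. (\<delta> \<circ> ginv \<eta>) p\<^sub>0) \<Gamma> V"
  using bij_betw_trans[OF bij_betw_trans[OF inversion_bij left_translation_bij] orbit_bij]
  by (simp add: o_def)

text \<open>Two uses of equivariance: \<delta> is cancelled from both arguments, and \<eta> is then
  applied to both, which brings the second argument back to \<open>p\<^sub>0\<close>.\<close>

lemma kernel_eq_\<mu>: "\<delta> \<in> \<Gamma> \<Longrightarrow> \<eta> \<in> \<Gamma> \<Longrightarrow> P (\<delta> p\<^sub>0) ((\<delta> \<circ> ginv \<eta>) p\<^sub>0) = pmf \<mu> \<eta>"
  using kernel_equivariant[of \<delta> "ginv \<eta> p\<^sub>0" p\<^sub>0] kernel_equivariant[of \<eta> "ginv \<eta> p\<^sub>0" p\<^sub>0]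
  by (simp add: \<mu> mem_V inv_mem)

lemma leafwise_harmonic_poisson:
  assumes "f \<in> leafwise_harmonic A \<Gamma> \<alpha>"
  shows "f (\<pi> (p, x)) = (\<Sum>\<^sub>\<infinity>v\<in>V. P p v * f (\<pi> (v, x)))"
proof -
  have "(\<lambda>p. f (\<pi> (p, x))) \<in> bounded_harmonic A"
    using assms bundle_continuous_bounded by (simp add: leafwise_harmonic_iff bounded_harmonic_def)
  from bounded_harmonic_eq_poisson[OF this] show ?thesis .
qed

text \<open>The pairs \<open>(\<gamma> p\<^sub>0, x)\<close> and
  \<open>(p\<^sub>0, \<alpha> (ginv \<gamma>) x)\<close> are in the same orbit.\<close>

lemma lift_on_orbit:
  assumes "\<gamma> \<in> \<Gamma>"
  shows "f (\<pi> (\<gamma> p\<^sub>0, x)) = restriction_map \<Gamma> \<alpha> p\<^sub>0 f (\<alpha> (ginv \<gamma>) x)"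
  using proj_action[OF assms, of p\<^sub>0 "\<alpha> (ginv \<gamma>) x"] assms by (simp add: restriction_eq)

lemma restriction_fiber_harmonic:
  assumes f: "f \<in> leafwise_harmonic A \<Gamma> \<alpha>"
  shows "restriction_map \<Gamma> \<alpha> p\<^sub>0 f \<in> fiber_harmonic \<Gamma> \<alpha> \<mu>"
proof -
  let ?\<phi> = "restriction_map \<Gamma> \<alpha> p\<^sub>0 f"
  have "?\<phi> x = (\<Sum>\<^sub>\<infinity>\<gamma>\<in>\<Gamma>. pmf \<mu> \<gamma> * ?\<phi> (\<alpha> \<gamma> x))" for x
  proof -
    have "?\<phi> x = (\<Sum>\<^sub>\<infinity>v\<in>V. P p\<^sub>0 v * f (\<pi> (v, x)))"
      unfolding restriction_eq by (rule leafwise_harmonic_poisson[OF f])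
    \<comment> \<open>Indexing by inverses makes the kernel weight \<open>pmf \<mu> \<eta>\<close>;
      at the same time the lift at that orbit point becomes the restriction at
      \<open>\<alpha> \<eta> x\<close>.\<close>
    also have "\<dots> = (\<Sum>\<^sub>\<infinity>\<eta>\<in>\<Gamma>. P p\<^sub>0 ((id \<circ> ginv \<eta>) p\<^sub>0) * f (\<pi> ((id \<circ> ginv \<eta>) p\<^sub>0, x)))"
      by (rule infsum_reindex_bij_betw[OF twisted_orbit_bij[OF id_mem], symmetric])
    also have "\<dots> = (\<Sum>\<^sub>\<infinity>\<gamma>\<in>\<Gamma>. pmf \<mu> \<gamma> * ?\<phi> (\<alpha> \<gamma> x))"
    proof (rule infsum_cong)
      fix \<eta> assume \<eta>: "\<eta> \<in> \<Gamma>"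
      show "P p\<^sub>0 ((id \<circ> ginv \<eta>) p\<^sub>0) * f (\<pi> ((id \<circ> ginv \<eta>) p\<^sub>0, x)) = pmf \<mu> \<eta> * ?\<phi> (\<alpha> \<eta> x)"
        using kernel_eq_\<mu>[OF id_mem \<eta>] lift_on_orbit[OF inv_mem[OF \<eta>], of f x] by (simp add: inv_inv \<eta>)
    qed
    finally show ?thesis .
  qed
  moreover have "continuous_on UNIV ?\<phi>"
    using f restriction_continuous by (simp add: leafwise_harmonic_iff)
  ultimately show ?thesis unfolding fiber_harmonic_def by blast
qed

lemma restriction_inj: "inj_on (restriction_map \<Gamma> \<alpha> p\<^sub>0) (leafwise_harmonic A \<Gamma> \<alpha>)"
proof (rule inj_onI)
  fix f g assume f: "f \<in> leafwise_harmonic A \<Gamma> \<alpha>" and g: "g \<in> leafwise_harmonic A \<Gamma> \<alpha>"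
    and e: "restriction_map \<Gamma> \<alpha> p\<^sub>0 f = restriction_map \<Gamma> \<alpha> p\<^sub>0 g"
  have V: "f (\<pi> (v, x)) = g (\<pi> (v, x))" if "v \<in> V" for v x
    using that e by (auto elim!: mem_V_E simp: lift_on_orbit)
  have "f (\<pi> (p, x)) = g (\<pi> (p, x))" for p x
  proof -
    have "f (\<pi> (p, x)) = (\<Sum>\<^sub>\<infinity>v\<in>V. P p v * f (\<pi> (v, x)))" by (rule leafwise_harmonic_poisson[OF f])
    also have "\<dots> = (\<Sum>\<^sub>\<infinity>v\<in>V. P p v * g (\<pi> (v, x)))" by (intro infsum_cong) (simp add: V)
    also have "\<dots> = g (\<pi> (p, x))" by (rule leafwise_harmonic_poisson[OF g, symmetric])
    finally show ?thesis .
  qed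
  with f g show "f = g" by (intro bundle_continuous_eqI) (auto simp: leafwise_harmonic_iff)
qed

section \<open>Extension of functions on the fiber by Poisson integrals\<close>

lemma poisson_bound:
  assumes "\<And>v. v \<in> V \<Longrightarrow> \<bar>\<phi> v\<bar> \<le> m"
  shows "\<bar>poisson \<phi> p\<bar> \<le> m"
proof -
  have m: "((\<lambda>v. P p v * m) has_sum 1 * m) V" by (rule has_sum_cmult_left[OF kernel_sum])
  have le: "norm (P p v * \<phi> v) \<le> P p v * m" if "v \<in> V" for v
    using kernel_nonneg[OF that] assms[OF that] by (simp add: abs_mult mult_left_mono)
  have "(\<lambda>v. P p v * \<phi> v) summable_on V"
    by (rule abs_summable_summable,
        rule Infinite_Sum.abs_summable_on_comparison_test'[OF has_sum_imp_summable[OF m]], rule le)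
  then have "((\<lambda>v. P p v * \<phi> v) has_sum poisson \<phi> p) V" unfolding poisson_def by (rule has_sum_infsum)
  from norm_infsum_le[OF this m le] show ?thesis by simp
qed

lemma restriction_surj:
  assumes \<phi>: "\<phi> \<in> fiber_harmonic \<Gamma> \<alpha> \<mu>"
  obtains f where "f \<in> leafwise_harmonic A \<Gamma> \<alpha>" "restriction_map \<Gamma> \<alpha> p\<^sub>0 f = \<phi>"
proof -
  have \<phi>c: "continuous_on UNIV \<phi>" and \<phi>h: "\<And>x. \<phi> x = (\<Sum>\<^sub>\<infinity>\<gamma>\<in>\<Gamma>. pmf \<mu> \<gamma> * \<phi> (\<alpha> \<gamma> x))"
    using \<phi> unfolding fiber_harmonic_def by blast+
  have "bounded (range \<phi>)"
    by (intro compact_imp_bounded compact_continuous_image \<phi>c fiber_compact)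
  then obtain m where m: "\<And>x. \<bar>\<phi> x\<bar> \<le> m" unfolding bounded_iff by auto
  \<comment> \<open>Freeness makes the group element recoverable from its orbit point.\<close>
  define g where "g = inv_into \<Gamma> (\<lambda>\<gamma>. \<gamma> p\<^sub>0)"
  have g: "g (\<gamma> p\<^sub>0) = \<gamma>" if "\<gamma> \<in> \<Gamma>" for \<gamma>
    unfolding g_def using bij_betw_inv_into_left[OF orbit_bij that] .
  \<comment> \<open>The values on the orbit are forced by \<open>lift_on_orbit\<close>; the
    restriction to \<open>V\<close> is the extensional form required of elements of
    \<open>bounded_P_harmonic\<close>.\<close>
  define \<Phi> where "\<Phi> x = restrict (\<lambda>v. \<phi> (\<alpha> (ginv (g v)) x)) V" for x
  have \<Phi>: "\<Phi> x (\<gamma> p\<^sub>0) = \<phi> (\<alpha> (ginv \<gamma>) x)" if "\<gamma> \<in> \<Gamma>" for x \<gamma>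
    by (simp add: \<Phi>_def mem_V that g)
  have \<Phi>b: "\<bar>\<Phi> x v\<bar> \<le> m" if "v \<in> V" for x v using that m by (simp add: \<Phi>_def)
  \<comment> \<open>At \<open>\<delta> p\<^sub>0\<close> the mean value property for
    \<open>P\<close> is the one for \<mu> at the fiber point
    \<open>\<alpha> (ginv \<delta>) x\<close>.\<close>
  have \<Phi>h: "\<Phi> x u = poisson (\<Phi> x) u" if u: "u \<in> V" for x u
  proof -
    obtain \<delta> where \<delta>: "\<delta> \<in> \<Gamma>" "u = \<delta> p\<^sub>0" using u by (rule mem_V_E)
    have "poisson (\<Phi> x) u = (\<Sum>\<^sub>\<infinity>\<eta>\<in>\<Gamma>. P u ((\<delta> \<circ> ginv \<eta>) p\<^sub>0) * \<Phi> x ((\<delta> \<circ> ginv \<eta>) p\<^sub>0))"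
      unfolding poisson_def by (rule infsum_reindex_bij_betw[OF twisted_orbit_bij[OF \<delta>(1)], symmetric])
    also have "\<dots> = (\<Sum>\<^sub>\<infinity>\<eta>\<in>\<Gamma>. pmf \<mu> \<eta> * \<phi> (\<alpha> \<eta> (\<alpha> (ginv \<delta>) x)))"
    proof (rule infsum_cong)
      fix \<eta> assume \<eta>: "\<eta> \<in> \<Gamma>"
      have m1: "\<delta> \<circ> ginv \<eta> \<in> \<Gamma>" using \<delta> \<eta> by (intro comp_mem inv_mem)
      have "ginv (\<delta> \<circ> ginv \<eta>) = \<eta> \<circ> ginv \<delta>"
        using \<delta> \<eta> by (simp add: o_inv_distrib bij inv_mem inv_inv)
      then have "\<Phi> x ((\<delta> \<circ> ginv \<eta>) p\<^sub>0) = \<phi> (\<alpha> \<eta> (\<alpha> (ginv \<delta>) x))"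
        using \<Phi>[OF m1, of x] \<delta> \<eta> by (simp add: action_comp inv_mem)
      then show "P u ((\<delta> \<circ> ginv \<eta>) p\<^sub>0) * \<Phi> x ((\<delta> \<circ> ginv \<eta>) p\<^sub>0) = pmf \<mu> \<eta> * \<phi> (\<alpha> \<eta> (\<alpha> (ginv \<delta>) x))"
        using kernel_eq_\<mu>[OF \<delta>(1) \<eta>] \<delta>(2) by simp
    qed
    also have "\<dots> = \<phi> (\<alpha> (ginv \<delta>) x)" by (rule \<phi>h[symmetric])
    finally show ?thesis using \<Phi>[OF \<delta>(1)] \<delta>(2) by simp
  qed
  have "\<Phi> x \<in> bounded_P_harmonic V P" for x
    unfolding bounded_P_harmonic_def
  proof (intro CollectI conjI)
    show "\<Phi> x \<in> extensional V" by (simp add: \<Phi>_def)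
    show "bounded (\<Phi> x ` V)" using \<Phi>b by (auto simp: bounded_iff)
    show "\<forall>u\<in>V. \<Phi> x u = (\<Sum>\<^sub>\<infinity>v\<in>V. P u v * \<Phi> x v)" using \<Phi>h unfolding poisson_def by blast
  qed
  then have harm: "harmonic A (poisson (\<Phi> x))" for x
    using poisson_bij by (auto simp: bij_betw_def bounded_harmonic_def)
  define F where "F z = poisson (\<Phi> (snd z)) (fst z)" for z
  have Feq: "F (p, x) = (\<Sum>\<^sub>\<infinity>\<gamma>\<in>\<Gamma>. P p (\<gamma> p\<^sub>0) * \<phi> (\<alpha> (ginv \<gamma>) x))" for p x
  proof -
    have "F (p, x) = (\<Sum>\<^sub>\<infinity>\<gamma>\<in>\<Gamma>. P p (\<gamma> p\<^sub>0) * \<Phi> x (\<gamma> p\<^sub>0))"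
      unfolding F_def poisson_def fst_conv snd_conv by (rule infsum_reindex_bij_betw[OF orbit_bij, symmetric])
    then show ?thesis by (simp add: \<Phi> cong: infsum_cong)
  qed
  \<comment> \<open>Reindexing by left translation: in \<open>ginv (\<gamma> \<circ> \<tau>)\<close>
    the factor \<gamma> cancels against the one acting on \<open>x\<close>, and equivariance removes
    it from the kernel.\<close>
  have Finv: "F (\<gamma> p, \<alpha> \<gamma> x) = F (p, x)" if \<gamma>: "\<gamma> \<in> \<Gamma>" for \<gamma> p x
  proof -
    have "F (\<gamma> p, \<alpha> \<gamma> x) = (\<Sum>\<^sub>\<infinity>\<tau>\<in>\<Gamma>. P (\<gamma> p) ((\<gamma> \<circ> \<tau>) p\<^sub>0) * \<phi> (\<alpha> (ginv (\<gamma> \<circ> \<tau>)) (\<alpha> \<gamma> x)))"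
      unfolding Feq by (rule infsum_reindex_bij_betw[OF left_translation_bij[OF \<gamma>], symmetric])
    also have "\<dots> = F (p, x)"
      unfolding Feq
    proof (rule infsum_cong)
      fix \<tau> assume \<tau>: "\<tau> \<in> \<Gamma>"
      have "ginv (\<gamma> \<circ> \<tau>) = ginv \<tau> \<circ> ginv \<gamma>" using \<gamma> \<tau> by (simp add: o_inv_distrib bij)
      then have "\<alpha> (ginv (\<gamma> \<circ> \<tau>)) (\<alpha> \<gamma> x) = \<alpha> (ginv \<tau>) x"
        using \<gamma> \<tau> by (simp add: action_comp inv_mem)
      then show "P (\<gamma> p) ((\<gamma> \<circ> \<tau>) p\<^sub>0) * \<phi> (\<alpha> (ginv (\<gamma> \<circ> \<tau>)) (\<alpha> \<gamma> x)) = P p (\<tau> p\<^sub>0) * \<phi> (\<alpha> (ginv \<tau>) x)"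
        using kernel_equivariant[OF \<gamma> mem_V[OF \<tau>], of p] by simp
    qed
    finally show ?thesis .
  qed
  have "continuous_on UNIV F"
  proof (rule jointly_continuous_if_equicontinuous)
    fix p :: 'd and e :: real assume "0 < e"
    then obtain W where W: "open W" "p \<in> W"
      "\<And>h q. harmonic A h \<Longrightarrow> (\<And>p. \<bar>h p\<bar> \<le> m) \<Longrightarrow> q \<in> W \<Longrightarrow> \<bar>h q - h p\<bar> < e"
      using harmonic_equicontinuous[OF manifold, where m = m] by metis
    \<comment> \<open>The bound \<open>m\<close> is the same for all \<open>x\<close>, so one
      neighbourhood \<open>W\<close> works for the whole family.\<close>
    have "\<bar>F (q, x) - F (p, x)\<bar> < e" if "q \<in> W" for q x
      using W(3)[OF harm poisson_bound[OF \<Phi>b] that, of x] by (simp add: F_def)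
    then show "\<exists>V. open V \<and> p \<in> V \<and> (\<forall>q\<in>V. \<forall>x. \<bar>F (q, x) - F (p, x)\<bar> < e)" using W(1,2) by blast
  next
    fix p
    \<comment> \<open>The kernel weights times \<open>m\<close> form a summable majorant that does
      not depend on \<open>x\<close>.\<close>
    have s: "(\<lambda>\<gamma>. P p (\<gamma> p\<^sub>0) * m) summable_on \<Gamma>"
      using has_sum_imp_summable[OF has_sum_cmult_left[OF kernel_sum, of p m]]
        summable_on_reindex_bij_betw[OF orbit_bij, of "\<lambda>v. P p v * m"] by blast
    show "continuous_on UNIV (\<lambda>x. F (p, x))"
      unfolding Feq
    proof (rule continuous_on_infsum_dominated[OF _ _ s])
      show "continuous_on UNIV (\<lambda>x. P p (\<gamma> p\<^sub>0) * \<phi> (\<alpha> (ginv \<gamma>) x))" if "\<gamma> \<in> \<Gamma>" for \<gamma>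
        using action_continuous[OF inv_mem[OF that]]
        by (intro continuous_on_mult continuous_on_const continuous_on_compose2[OF \<phi>c]) auto
      show "\<bar>P p (\<gamma> p\<^sub>0) * \<phi> (\<alpha> (ginv \<gamma>) x)\<bar> \<le> P p (\<gamma> p\<^sub>0) * m" if "\<gamma> \<in> \<Gamma>" for \<gamma> x
        using kernel_nonneg[OF mem_V[OF that], of p] m by (simp add: abs_mult mult_left_mono)
    qed
  qed
  then obtain f where f: "f \<in> bundle_continuous \<Gamma> \<alpha>" "f \<circ> \<pi> = F"
    using Finv by (rule bundle_continuous_lift)
  have fF: "f (\<pi> (p, x)) = poisson (\<Phi> x) p" for p x using fun_cong[OF f(2), of "(p, x)"] by (simp add: F_def)
  show thesis
  proof
    show "f \<in> leafwise_harmonic A \<Gamma> \<alpha>" using f(1) harm by (simp add: leafwise_harmonic_iff fF)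
    show "restriction_map \<Gamma> \<alpha> p\<^sub>0 f = \<phi>"
    proof
      fix x
      \<comment> \<open>The base point belongs to the orbit, where the Poisson integral of a
        \<open>P\<close>-harmonic function returns the function itself.\<close>
      have "restriction_map \<Gamma> \<alpha> p\<^sub>0 f x = \<Phi> x (id p\<^sub>0)" by (simp add: restriction_eq fF \<Phi>h[OF p0_mem_V, symmetric])
      then show "restriction_map \<Gamma> \<alpha> p\<^sub>0 f x = \<phi> x" using \<Phi>[OF id_mem, of x] by simp
    qed
  qed
qed

lemma restriction_bij:
  "bij_betw (restriction_map \<Gamma> \<alpha> p\<^sub>0) (leafwise_harmonic A \<Gamma> \<alpha>) (fiber_harmonic \<Gamma> \<alpha> \<mu>)"
  unfolding bij_betw_def
  using restriction_inj restriction_fiber_harmonic restriction_surj by (auto, metis imageI)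

text \<open>For the converse, invariance makes the lift constant along the orbit of
  \<open>p\<^sub>0\<close> in each leaf. Since the kernel weights sum to 1, the Poisson integral
  spreads this constant over the leaf.\<close>

lemma leafwise_constant_iff_restriction_invariant:
  assumes f: "f \<in> leafwise_harmonic A \<Gamma> \<alpha>"
  shows "leafwise_constant \<Gamma> \<alpha> f \<longleftrightarrow> action_invariant \<Gamma> \<alpha> (restriction_map \<Gamma> \<alpha> p\<^sub>0 f)"
proof
  assume "leafwise_constant \<Gamma> \<alpha> f"
  then show "action_invariant \<Gamma> \<alpha> (restriction_map \<Gamma> \<alpha> p\<^sub>0 f)"
    using f leafwise_constant_bij[of p\<^sub>0] by (auto simp: leafwise_harmonic_iff bij_betw_def)
next
  assume inv: "action_invariant \<Gamma> \<alpha> (restriction_map \<Gamma> \<alpha> p\<^sub>0 f)"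
  have "f (\<pi> (p, x)) = restriction_map \<Gamma> \<alpha> p\<^sub>0 f x" for p x
  proof -
    have V: "f (\<pi> (v, x)) = restriction_map \<Gamma> \<alpha> p\<^sub>0 f x" if "v \<in> V" for v
      using that inv inv_mem by (auto elim!: mem_V_E simp: lift_on_orbit action_invariant_def)
    have "f (\<pi> (p, x)) = (\<Sum>\<^sub>\<infinity>v\<in>V. P p v * f (\<pi> (v, x)))" by (rule leafwise_harmonic_poisson[OF f])
    also have "\<dots> = (\<Sum>\<^sub>\<infinity>v\<in>V. P p v * restriction_map \<Gamma> \<alpha> p\<^sub>0 f x)"
      by (intro infsum_cong) (simp add: V)
    also have "\<dots> = restriction_map \<Gamma> \<alpha> p\<^sub>0 f x"
      using infsumI[OF has_sum_cmult_left[OF kernel_sum, of p "restriction_map \<Gamma> \<alpha> p\<^sub>0 f x"]] by simp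
    finally show ?thesis .
  qed
  then show "leafwise_constant \<Gamma> \<alpha> f" by (simp add: leafwise_constant_iff)
qed

lemma liouville_iff:
  "liouville_property A \<Gamma> \<alpha> \<longleftrightarrow> (\<forall>\<phi>\<in>fiber_harmonic \<Gamma> \<alpha> \<mu>. action_invariant \<Gamma> \<alpha> \<phi>)"
proof -
  have "fiber_harmonic \<Gamma> \<alpha> \<mu> = restriction_map \<Gamma> \<alpha> p\<^sub>0 ` leafwise_harmonic A \<Gamma> \<alpha>"
    using restriction_bij by (simp add: bij_betw_def)
  then show ?thesis
    by (simp add: liouville_property_def leafwise_constant_iff_restriction_invariant)
qed

end

theorem theorem12p2:
  fixes A :: "('d::{t2_space, second_countable_topology}, 'n::finite) rchart set"
    and \<Gamma> :: "('d \<Rightarrow> 'd) set"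
    and p\<^sub>0 :: 'd
    and \<mu> :: "('d \<Rightarrow> 'd) pmf"
    and \<alpha> :: "('d \<Rightarrow> 'd) \<Rightarrow> 'x::topological_space \<Rightarrow> 'x"
  assumes "riemannian_manifold A"
    and "connected (UNIV :: 'd set)"
    and "transient A"
    and "isometry_group A \<Gamma>"
    and "countable \<Gamma>"
    and "acts_freely \<Gamma>"
    and "acts_properly_discontinuously \<Gamma>"
    and "compact_space (base_space \<Gamma>)"
    and "discretization_measure A \<Gamma> p\<^sub>0 \<mu>"
    and "compact (UNIV :: 'x set)"
    and "acts_by_homeomorphisms \<Gamma> \<alpha>"
  shows "bij_betw (restriction_map \<Gamma> \<alpha> p\<^sub>0)
           (leafwise_harmonic A \<Gamma> \<alpha>) (fiber_harmonic \<Gamma> \<alpha> \<mu>) \<and>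
         bij_betw (restriction_map \<Gamma> \<alpha> p\<^sub>0)
           {f \<in> bundle_continuous \<Gamma> \<alpha>. leafwise_constant \<Gamma> \<alpha> f}
           {\<phi>. continuous_on UNIV \<phi> \<and> action_invariant \<Gamma> \<alpha> \<phi>} \<and>
         (liouville_property A \<Gamma> \<alpha> \<longleftrightarrow>
           (\<forall>\<phi>\<in>fiber_harmonic \<Gamma> \<alpha> \<mu>. action_invariant \<Gamma> \<alpha> \<phi>))"
proof -
  obtain P where P: "discretization_kernel A \<Gamma> p\<^sub>0 P" "\<And>\<gamma>. \<gamma> \<in> \<Gamma> \<Longrightarrow> pmf \<mu> \<gamma> = P (\<gamma> p\<^sub>0) p\<^sub>0"
    using assms(9) unfolding discretization_measure_def by blast
  interpret discretized_bundle \<Gamma> \<alpha> A p\<^sub>0 \<mu> P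
    by (intro discretized_bundle.intro compact_bundle.intro transformation_action.intro
        compact_bundle_axioms.intro discretized_bundle_axioms.intro)
      (use assms P in \<open>auto simp: isometry_group_def\<close>)
  show ?thesis using restriction_bij leafwise_constant_bij[of p\<^sub>0] liouville_iff by blast
qed

end
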